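(* Let $(M^{2n+s}, \phi, \xi_i, \eta_j, g)$ be an $\mathcal{S}$-manifold and let $\pi : M^{2n+s}\to N^{2n}$ be the canonical $\mathfrak{u}(n)$-submersion over the Kähler manifold $(N^{2n}, g', \mathbb{J})$. Suppose that the base space $N^{2n}$ is Kähler-Einstein with Einstein constant $\lambda$. Then the total space $M^{2n+s}$ is $\eta$-Einstein with $\alpha, \beta$ given by $\alpha=\lambda-2s$ and $\beta=2n-(\lambda-2s)$, respectively. Conversely, suppose that $(M^{2n+s}, \phi, \xi_i, \eta_j, g)$ is an $\eta$-Einstein $\mathcal{S}$-manifold with constants $\alpha,\beta$. Then the base space $(N^{2n}, g', \mathbb{J})$ of the canonical $\mathfrak{u}(n)$-submersion $\pi$ is Kähler-Einstein with Einstein constant $\lambda=\alpha+2s$ (and hence it is Ricci-flat if and only if $\alpha+2s=0$).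
   Context: A metric $f$-manifold $(M^{2n+s},\phi,\xi_i,\eta_j,g)$ is a smooth connected manifold of dimension $2n+s$ with an endomorphism $\phi$ of $TM$ of constant rank $2n$, global vector fields $\xi_1,\dots,\xi_s$, 1-forms $\eta_1,\dots,\eta_s$ and a Riemannian metric $g$ such that $\mathrm{Ker}(\phi)=\langle\xi_1,\dots,\xi_s\rangle$, $\eta_i(\xi_j)=\delta_{ij}$, $\eta_i\circ\phi=0$, $\phi^2=-\mathrm{Id}+\sum_{i=1}^s\eta_i\otimes\xi_i$, and $g(\phi X,\phi Y)=g(X,Y)-\sum_{i=1}^s\eta_i(X)\eta_i(Y)$. Set $F(X,Y)=g(X,\phi Y)$ and $N^{(1)}=N_\phi+\sum_i d\eta_i\otimes\xi_i$, where $N_\phi(X,Y)=[\phi X,\phi Y]+\phi^2[X,Y]-\phi[X,\phi Y]-\phi[\phi X,Y]$ and $d\eta(X,Y)=X\eta(Y)-Y\eta(X)-\eta([X,Y])$. It is an $\mathcal{S}$-manifold if $s\ge1$, $2F=d\eta_j$ for all $j$, and $N^{(1)}=0$. Put $\mathcal{D}=\mathrm{Im}(\phi)=\bigcap_i\mathrm{Ker}(\eta_i)$ and $\mathcal{D}^\perp=\mathrm{Ker}(\phi)$; the distribution $\mathcal{D}^\perp$ is integrable. The canonical $\mathfrak{u}(n)$-submersion (canonical submersion) $\pi:M^{2n+s}\to N^{2n}$ is the locally defined Riemannian submersion with horizontal distribution $\mathcal{H}=\mathcal{D}$ and vertical distribution $\mathcal{V}=\mathcal{D}^\perp$: restricting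 to a sufficiently small open subset of $M$, $N$ is the (smooth) leaf space of the foliation tangent to $\mathcal{D}^\perp$ and $\pi$ the quotient map. The base carries the Kähler structure $(g',\mathbb{J})$ with $g'(X,Y)\circ\pi=g(X^h,Y^h)$ and $\mathbb{J}X=\pi_*\phi(X^h)$, where $X^h$ is the horizontal lift. The base is Kähler-Einstein with Einstein constant $\lambda$ if $\mathrm{Ric}^{g'}=\lambda g'$. An $\mathcal{S}$-manifold is $\eta$-Einstein if there are constants $\alpha,\beta$ with $$\mathrm{Ric}^{g}(X, Y)=\alpha\, g(X, Y)+\beta \sum_{i=1}^{s}\eta_{i}(X)\eta_{i}(Y)+(\alpha+\beta)\sum_{1\leq i\neq j\leq s}\eta_{i}(X)\eta_{j}(Y)$$ for all $X,Y\in TM$, where $\mathrm{Ric}^g$ is the Riemannian Ricci tensor. *)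

theory Defs
  imports "HOL-Analysis.Analysis"
begin

section \<open>Smooth maps between Euclidean spaces\<close>

abbreviation fderiv :: "('v::real_normed_vector \<Rightarrow> 'w::real_normed_vector) \<Rightarrow> 'v \<Rightarrow> 'v \<Rightarrow> 'w"
  where "fderiv f x \<equiv> frechet_derivative f (at x)"

text \<open>Only used for open \<open>S\<close> and finite-dimensional domain, where continuity of all iterated
  directional derivatives up to order \<open>k\<close> is the usual notion of class \<open>C\<^sup>k\<close>.\<close>

primrec Ck_on ::
  "nat \<Rightarrow> 'v::real_normed_vector set \<Rightarrow> ('v \<Rightarrow> 'w::real_normed_vector) \<Rightarrow> bool" where
  "Ck_on 0 S f \<longleftrightarrow> continuous_on S f"
| "Ck_on (Suc k) S f \<longleftrightarrow>
     (\<forall>x\<in>S. f differentiable (at x)) \<and> (\<forall>v. Ck_on k S (\<lambda>x. fderiv f x v))"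

definition smooth_on :: "'v::real_normed_vector set \<Rightarrow> ('v \<Rightarrow> 'w::real_normed_vector) \<Rightarrow> bool"
  where "smooth_on S f \<longleftrightarrow> (\<forall>k. Ck_on k S f)"


section \<open>Tensor calculus in a coordinate domain\<close>

text \<open>In an open subset of a Euclidean space \<open>'e\<close>, all tangent spaces are identified with \<open>'e\<close>.
  The inner product of \<open>'e\<close> plays no geometric role; the metric is the argument \<open>g\<close>.\<close>

definition lie_bracket ::
  "('e::real_normed_vector \<Rightarrow> 'e) \<Rightarrow> ('e \<Rightarrow> 'e) \<Rightarrow> 'e \<Rightarrow> 'e"
  where "lie_bracket X Y x = fderiv Y x (X x) - fderiv X x (Y x)"

text \<open>Exterior derivatives of a 1-form and of a 2-form, evaluated on vector fields and normalised
  without the factors \<open>1/2\<close>, \<open>1/3\<close>.\<close>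

definition d_one_form ::
  "('e::real_normed_vector \<Rightarrow> 'e \<Rightarrow> real) \<Rightarrow> ('e \<Rightarrow> 'e) \<Rightarrow> ('e \<Rightarrow> 'e) \<Rightarrow> 'e \<Rightarrow> real"
  where "d_one_form \<eta> X Y x =
    fderiv (\<lambda>y. \<eta> y (Y y)) x (X x) - fderiv (\<lambda>y. \<eta> y (X y)) x (Y x) - \<eta> x (lie_bracket X Y x)"

definition d_two_form ::
  "('e::real_normed_vector \<Rightarrow> 'e \<Rightarrow> 'e \<Rightarrow> real) \<Rightarrow>
    ('e \<Rightarrow> 'e) \<Rightarrow> ('e \<Rightarrow> 'e) \<Rightarrow> ('e \<Rightarrow> 'e) \<Rightarrow> 'e \<Rightarrow> real"
  where "d_two_form \<omega> X Y Z x =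
      fderiv (\<lambda>y. \<omega> y (Y y) (Z y)) x (X x)
    + fderiv (\<lambda>y. \<omega> y (Z y) (X y)) x (Y x)
    + fderiv (\<lambda>y. \<omega> y (X y) (Y y)) x (Z x)
    - \<omega> x (lie_bracket X Y x) (Z x)
    - \<omega> x (lie_bracket Y Z x) (X x)
    - \<omega> x (lie_bracket Z X x) (Y x)"

definition nijenhuis ::
  "('e::real_normed_vector \<Rightarrow> 'e \<Rightarrow> 'e) \<Rightarrow> ('e \<Rightarrow> 'e) \<Rightarrow> ('e \<Rightarrow> 'e) \<Rightarrow> 'e \<Rightarrow> 'e"
  where "nijenhuis \<phi> X Y x =
      lie_bracket (\<lambda>y. \<phi> y (X y)) (\<lambda>y. \<phi> y (Y y)) x
    + \<phi> x (\<phi> x (lie_bracket X Y x))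
    - \<phi> x (lie_bracket X (\<lambda>y. \<phi> y (Y y)) x)
    - \<phi> x (lie_bracket (\<lambda>y. \<phi> y (X y)) Y x)"

definition fundamental_form ::
  "('e \<Rightarrow> 'e \<Rightarrow> 'e \<Rightarrow> real) \<Rightarrow> ('e \<Rightarrow> 'e \<Rightarrow> 'e) \<Rightarrow> 'e \<Rightarrow> 'e \<Rightarrow> 'e \<Rightarrow> real"
  where "fundamental_form g \<phi> x u v = g x u (\<phi> x v)"

text \<open>The vector \<open>\<Gamma>\<^sub>x(u,v)\<close> with components \<open>\<Gamma>\<^sup>k\<^sub>i\<^sub>j u\<^sup>i v\<^sup>j\<close>: this is the Koszul formula for
  the coordinate-constant fields \<open>u\<close>, \<open>v\<close>, \<open>w\<close>, whose Lie brackets vanish.\<close>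

definition christoffel ::
  "('e::real_normed_vector \<Rightarrow> 'e \<Rightarrow> 'e \<Rightarrow> real) \<Rightarrow> 'e \<Rightarrow> 'e \<Rightarrow> 'e \<Rightarrow> 'e"
  where "christoffel g x u v = (THE z. \<forall>w. 2 * g x z w =
      fderiv (\<lambda>y. g y v w) x u + fderiv (\<lambda>y. g y u w) x v - fderiv (\<lambda>y. g y u v) x w)"

definition levi_civita ::
  "('e::real_normed_vector \<Rightarrow> 'e \<Rightarrow> 'e \<Rightarrow> real) \<Rightarrow> ('e \<Rightarrow> 'e) \<Rightarrow> ('e \<Rightarrow> 'e) \<Rightarrow> 'e \<Rightarrow> 'e"
  where "levi_civita g X Y x = fderiv Y x (X x) + christoffel g x (X x) (Y x)"

definition riemann ::
  "('e::real_normed_vector \<Rightarrow> 'e \<Rightarrow> 'e \<Rightarrow> real) \<Rightarrow>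
    ('e \<Rightarrow> 'e) \<Rightarrow> ('e \<Rightarrow> 'e) \<Rightarrow> ('e \<Rightarrow> 'e) \<Rightarrow> 'e \<Rightarrow> 'e"
  where "riemann g X Y Z x =
      levi_civita g X (levi_civita g Y Z) x
    - levi_civita g Y (levi_civita g X Z) x
    - levi_civita g (lie_bracket X Y) Z x"

text \<open>\<open>Ric(u,v)\<close> is the trace of the endomorphism \<open>w \<mapsto> R(w,u)v\<close> of the tangent space. A trace may
  be computed in any basis; the one used here need not be orthonormal for \<open>g\<close>.\<close>

definition ricci ::
  "('e::euclidean_space \<Rightarrow> 'e \<Rightarrow> 'e \<Rightarrow> real) \<Rightarrow> 'e \<Rightarrow> 'e \<Rightarrow> 'e \<Rightarrow> real"
  where "ricci g x u v = (\<Sum>b\<in>Basis. riemann g (\<lambda>_. b) (\<lambda>_. u) (\<lambda>_. v) x \<bullet> b)"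


section \<open>Smooth manifolds and tensor fields\<close>

text \<open>A chart is a coordinate domain together with its coordinate map; the values of the map
  outside the domain are irrelevant.\<close>

type_synonym ('a, 'e) chart = "'a set \<times> ('a \<Rightarrow> 'e)"

abbreviation cdom :: "('a, 'e) chart \<Rightarrow> 'a set" where "cdom \<equiv> fst"
abbreviation cmap :: "('a, 'e) chart \<Rightarrow> 'a \<Rightarrow> 'e" where "cmap \<equiv> snd"

definition cran :: "('a, 'e) chart \<Rightarrow> 'e set"
  where "cran c = cmap c ` cdom c"

definition cinv :: "('a, 'e) chart \<Rightarrow> 'e \<Rightarrow> 'a"
  where "cinv c = inv_into (cdom c) (cmap c)"

definition overlap :: "('a, 'e) chart \<Rightarrow> ('a, 'e) chart \<Rightarrow> 'e set"
  where "overlap c d = cmap c ` (cdom c \<inter> cdom d)"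

definition transition :: "('a, 'e) chart \<Rightarrow> ('a, 'e) chart \<Rightarrow> 'e \<Rightarrow> 'e"
  where "transition c d = cmap d \<circ> cinv c"

definition smooth_manifold :: "'a topology \<Rightarrow> ('a, 'e::euclidean_space) chart set \<Rightarrow> bool"
  where "smooth_manifold T A \<longleftrightarrow>
    Hausdorff_space T \<and> second_countable T \<and>
    (\<forall>c\<in>A. openin T (cdom c) \<and> open (cran c) \<and>
       homeomorphic_map (subtopology T (cdom c)) (top_of_set (cran c)) (cmap c)) \<and>
    (\<Union>c\<in>A. cdom c) = topspace T \<and>
    (\<forall>c\<in>A. \<forall>d\<in>A. smooth_on (overlap c d) (transition c d))"

text \<open>A tensor field is the family of its coordinate representations, one for each chart \<open>c\<close> and
  defined on the range of \<open>c\<close>, subject to the usual transformation law.\<close>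

definition vector_field ::
  "('a, 'e::euclidean_space) chart set \<Rightarrow> (('a, 'e) chart \<Rightarrow> 'e \<Rightarrow> 'e) \<Rightarrow> bool"
  where "vector_field A X \<longleftrightarrow>
    (\<forall>c\<in>A. smooth_on (cran c) (X c)) \<and>
    (\<forall>c\<in>A. \<forall>d\<in>A. \<forall>x\<in>overlap c d. X d (transition c d x) = fderiv (transition c d) x (X c x))"

definition one_form ::
  "('a, 'e::euclidean_space) chart set \<Rightarrow> (('a, 'e) chart \<Rightarrow> 'e \<Rightarrow> 'e \<Rightarrow> real) \<Rightarrow> bool"
  where "one_form A \<eta> \<longleftrightarrow>
    (\<forall>c\<in>A. (\<forall>x\<in>cran c. linear (\<eta> c x)) \<and> (\<forall>v. smooth_on (cran c) (\<lambda>x. \<eta> c x v))) \<and>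
    (\<forall>c\<in>A. \<forall>d\<in>A. \<forall>x\<in>overlap c d. \<forall>v.
       \<eta> d (transition c d x) (fderiv (transition c d) x v) = \<eta> c x v)"

definition endomorphism_field ::
  "('a, 'e::euclidean_space) chart set \<Rightarrow> (('a, 'e) chart \<Rightarrow> 'e \<Rightarrow> 'e \<Rightarrow> 'e) \<Rightarrow> bool"
  where "endomorphism_field A \<phi> \<longleftrightarrow>
    (\<forall>c\<in>A. (\<forall>x\<in>cran c. linear (\<phi> c x)) \<and> (\<forall>v. smooth_on (cran c) (\<lambda>x. \<phi> c x v))) \<and>
    (\<forall>c\<in>A. \<forall>d\<in>A. \<forall>x\<in>overlap c d. \<forall>v.
       \<phi> d (transition c d x) (fderiv (transition c d) x v) =
       fderiv (transition c d) x (\<phi> c x v))"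

definition riemannian_metric ::
  "('a, 'e::euclidean_space) chart set \<Rightarrow> (('a, 'e) chart \<Rightarrow> 'e \<Rightarrow> 'e \<Rightarrow> 'e \<Rightarrow> real) \<Rightarrow> bool"
  where "riemannian_metric A g \<longleftrightarrow>
    (\<forall>c\<in>A. (\<forall>x\<in>cran c. bilinear (g c x) \<and> (\<forall>u v. g c x u v = g c x v u) \<and>
              (\<forall>v. v \<noteq> 0 \<longrightarrow> g c x v v > 0)) \<and>
           (\<forall>u v. smooth_on (cran c) (\<lambda>x. g c x u v))) \<and>
    (\<forall>c\<in>A. \<forall>d\<in>A. \<forall>x\<in>overlap c d. \<forall>u v.
       g d (transition c d x) (fderiv (transition c d) x u) (fderiv (transition c d) x v) =
       g c x u v)"


section \<open>Metric f-manifolds and S-manifolds\<close>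

text \<open>The indices \<open>1,\<dots>,s\<close> are rendered as \<open>0,\<dots>,s-1\<close>.\<close>

definition metric_f_manifold ::
  "'a topology \<Rightarrow> ('a, 'e::euclidean_space) chart set \<Rightarrow> nat \<Rightarrow> nat \<Rightarrow>
    (('a, 'e) chart \<Rightarrow> 'e \<Rightarrow> 'e \<Rightarrow> 'e) \<Rightarrow>
    (nat \<Rightarrow> ('a, 'e) chart \<Rightarrow> 'e \<Rightarrow> 'e) \<Rightarrow>
    (nat \<Rightarrow> ('a, 'e) chart \<Rightarrow> 'e \<Rightarrow> 'e \<Rightarrow> real) \<Rightarrow>
    (('a, 'e) chart \<Rightarrow> 'e \<Rightarrow> 'e \<Rightarrow> 'e \<Rightarrow> real) \<Rightarrow> bool"
  where "metric_f_manifold T A n s \<phi> \<xi> \<eta> g \<longleftrightarrow>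
    smooth_manifold T A \<and> connected_space T \<and> DIM('e) = 2 * n + s \<and>
    endomorphism_field A \<phi> \<and> riemannian_metric A g \<and>
    (\<forall>i<s. vector_field A (\<xi> i) \<and> one_form A (\<eta> i)) \<and>
    (\<forall>c\<in>A. \<forall>x\<in>cran c.
       dim (range (\<phi> c x)) = 2 * n \<and>
       {v. \<phi> c x v = 0} = span ((\<lambda>i. \<xi> i c x) ` {..<s}) \<and>
       (\<forall>i<s. \<forall>j<s. \<eta> i c x (\<xi> j c x) = (if i = j then 1 else 0)) \<and>
       (\<forall>i<s. \<forall>v. \<eta> i c x (\<phi> c x v) = 0) \<and>
       (\<forall>v. \<phi> c x (\<phi> c x v) = - v + (\<Sum>i<s. \<eta> i c x v *\<^sub>R \<xi> i c x)) \<and>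
       (\<forall>u v. g c x (\<phi> c x u) (\<phi> c x v) = g c x u v - (\<Sum>i<s. \<eta> i c x u * \<eta> i c x v)))"

definition S_manifold ::
  "'a topology \<Rightarrow> ('a, 'e::euclidean_space) chart set \<Rightarrow> nat \<Rightarrow> nat \<Rightarrow>
    (('a, 'e) chart \<Rightarrow> 'e \<Rightarrow> 'e \<Rightarrow> 'e) \<Rightarrow>
    (nat \<Rightarrow> ('a, 'e) chart \<Rightarrow> 'e \<Rightarrow> 'e) \<Rightarrow>
    (nat \<Rightarrow> ('a, 'e) chart \<Rightarrow> 'e \<Rightarrow> 'e \<Rightarrow> real) \<Rightarrow>
    (('a, 'e) chart \<Rightarrow> 'e \<Rightarrow> 'e \<Rightarrow> 'e \<Rightarrow> real) \<Rightarrow> bool"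
  where "S_manifold T A n s \<phi> \<xi> \<eta> g \<longleftrightarrow>
    metric_f_manifold T A n s \<phi> \<xi> \<eta> g \<and> s \<ge> 1 \<and>
    (\<forall>c\<in>A. \<forall>X Y. smooth_on (cran c) X \<and> smooth_on (cran c) Y \<longrightarrow>
       (\<forall>x\<in>cran c.
          (\<forall>j<s. 2 * fundamental_form (g c) (\<phi> c) x (X x) (Y x) = d_one_form (\<eta> j c) X Y x) \<and>
          nijenhuis (\<phi> c) X Y x + (\<Sum>i<s. d_one_form (\<eta> i c) X Y x *\<^sub>R \<xi> i c x) = 0))"

definition eta_einstein ::
  "('a, 'e::euclidean_space) chart set \<Rightarrow> nat \<Rightarrow>
    (nat \<Rightarrow> ('a, 'e) chart \<Rightarrow> 'e \<Rightarrow> 'e \<Rightarrow> real) \<Rightarrow>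
    (('a, 'e) chart \<Rightarrow> 'e \<Rightarrow> 'e \<Rightarrow> 'e \<Rightarrow> real) \<Rightarrow> real \<Rightarrow> real \<Rightarrow> bool"
  where "eta_einstein A s \<eta> g \<alpha> \<beta> \<longleftrightarrow>
    (\<forall>c\<in>A. \<forall>x\<in>cran c. \<forall>u v. ricci (g c) x u v =
       \<alpha> * g c x u v + \<beta> * (\<Sum>i<s. \<eta> i c x u * \<eta> i c x v)
       + (\<alpha> + \<beta>) * (\<Sum>i<s. \<Sum>j\<in>{..<s} - {i}. \<eta> i c x u * \<eta> j c x v))"


section \<open>Kaehler-Einstein manifolds\<close>

text \<open>Integrability of \<open>J\<close> is expressed by the vanishing of its Nijenhuis tensor.\<close>

definition kaehler_manifold ::
  "'a topology \<Rightarrow> ('a, 'e::euclidean_space) chart set \<Rightarrow>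
    (('a, 'e) chart \<Rightarrow> 'e \<Rightarrow> 'e \<Rightarrow> 'e \<Rightarrow> real) \<Rightarrow>
    (('a, 'e) chart \<Rightarrow> 'e \<Rightarrow> 'e \<Rightarrow> 'e) \<Rightarrow> bool"
  where "kaehler_manifold T A g J \<longleftrightarrow>
    smooth_manifold T A \<and> riemannian_metric A g \<and> endomorphism_field A J \<and>
    (\<forall>c\<in>A. \<forall>x\<in>cran c. (\<forall>v. J c x (J c x v) = - v) \<and>
       (\<forall>u v. g c x (J c x u) (J c x v) = g c x u v)) \<and>
    (\<forall>c\<in>A. \<forall>X Y. smooth_on (cran c) X \<and> smooth_on (cran c) Y \<longrightarrow>
       (\<forall>x\<in>cran c. nijenhuis (J c) X Y x = 0)) \<and>
    (\<forall>c\<in>A. \<forall>X Y Z. smooth_on (cran c) X \<and> smooth_on (cran c) Y \<and> smooth_on (cran c) Z \<longrightarrow>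
       (\<forall>x\<in>cran c. d_two_form (fundamental_form (g c) (J c)) X Y Z x = 0))"

definition kaehler_einstein ::
  "'a topology \<Rightarrow> ('a, 'e::euclidean_space) chart set \<Rightarrow>
    (('a, 'e) chart \<Rightarrow> 'e \<Rightarrow> 'e \<Rightarrow> 'e \<Rightarrow> real) \<Rightarrow>
    (('a, 'e) chart \<Rightarrow> 'e \<Rightarrow> 'e \<Rightarrow> 'e) \<Rightarrow> real \<Rightarrow> bool"
  where "kaehler_einstein T A g J lam \<longleftrightarrow>
    kaehler_manifold T A g J \<and>
    (\<forall>c\<in>A. \<forall>x\<in>cran c. \<forall>u v. ricci (g c) x u v = lam * g c x u v)"

definition ricci_flat ::
  "('a, 'e::euclidean_space) chart set \<Rightarrow>
    (('a, 'e) chart \<Rightarrow> 'e \<Rightarrow> 'e \<Rightarrow> 'e \<Rightarrow> real) \<Rightarrow> bool"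
  where "ricci_flat A g \<longleftrightarrow> (\<forall>c\<in>A. \<forall>x\<in>cran c. \<forall>u v. ricci (g c) x u v = 0)"


section \<open>The canonical submersion\<close>

definition coord_rep :: "('a, 'e) chart \<Rightarrow> ('b, 'f) chart \<Rightarrow> ('a \<Rightarrow> 'b) \<Rightarrow> 'e \<Rightarrow> 'f"
  where "coord_rep c d f = cmap d \<circ> f \<circ> cinv c"

text \<open>Smoothness on an open subset \<open>U\<close> of the source, as a map into the manifold \<open>(S, B)\<close>.\<close>

definition smooth_map ::
  "'a topology \<Rightarrow> ('a, 'e::euclidean_space) chart set \<Rightarrow> 'a set \<Rightarrow>
    'b topology \<Rightarrow> ('b, 'f::euclidean_space) chart set \<Rightarrow> ('a \<Rightarrow> 'b) \<Rightarrow> bool"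
  where "smooth_map T A U S B f \<longleftrightarrow>
    continuous_map (subtopology T U) S f \<and>
    (\<forall>c\<in>A. \<forall>d\<in>B. smooth_on (cmap c ` {p \<in> U \<inter> cdom c. f p \<in> cdom d}) (coord_rep c d f))"

text \<open>The differential at \<open>p\<close>, in the charts \<open>c\<close> around \<open>p\<close> and \<open>d\<close> around \<open>f p\<close>.\<close>

definition differential ::
  "('a, 'e::euclidean_space) chart \<Rightarrow> ('b, 'f::euclidean_space) chart \<Rightarrow> ('a \<Rightarrow> 'b) \<Rightarrow> 'a \<Rightarrow> 'e \<Rightarrow> 'f"
  where "differential c d f p = fderiv (coord_rep c d f) (cmap c p)"

definition vertical_space ::
  "('a, 'e::euclidean_space) chart \<Rightarrow> ('b, 'f::euclidean_space) chart \<Rightarrow> ('a \<Rightarrow> 'b) \<Rightarrow> 'a \<Rightarrow> 'e set"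
  where "vertical_space c d f p = {v. differential c d f p v = 0}"

definition horizontal_space ::
  "(('a, 'e) chart \<Rightarrow> 'e \<Rightarrow> 'e \<Rightarrow> 'e \<Rightarrow> real) \<Rightarrow>
    ('a, 'e::euclidean_space) chart \<Rightarrow> ('b, 'f::euclidean_space) chart \<Rightarrow> ('a \<Rightarrow> 'b) \<Rightarrow> 'a \<Rightarrow> 'e set"
  where "horizontal_space g c d f p =
    {u. \<forall>v\<in>vertical_space c d f p. g c (cmap c p) u v = 0}"

definition riemannian_submersion ::
  "'a topology \<Rightarrow> ('a, 'e::euclidean_space) chart set \<Rightarrow>
    (('a, 'e) chart \<Rightarrow> 'e \<Rightarrow> 'e \<Rightarrow> 'e \<Rightarrow> real) \<Rightarrow> 'a set \<Rightarrow>
    'b topology \<Rightarrow> ('b, 'f::euclidean_space) chart set \<Rightarrow>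
    (('b, 'f) chart \<Rightarrow> 'f \<Rightarrow> 'f \<Rightarrow> 'f \<Rightarrow> real) \<Rightarrow> ('a \<Rightarrow> 'b) \<Rightarrow> bool"
  where "riemannian_submersion T A g U S B g' f \<longleftrightarrow>
    smooth_map T A U S B f \<and> f ` U = topspace S \<and>
    (\<forall>c\<in>A. \<forall>d\<in>B. \<forall>p\<in>U. p \<in> cdom c \<and> f p \<in> cdom d \<longrightarrow>
       surj (differential c d f p) \<and>
       (\<forall>u\<in>horizontal_space g c d f p. \<forall>v\<in>horizontal_space g c d f p.
          g' d (cmap d (f p)) (differential c d f p u) (differential c d f p v) =
          g c (cmap c p) u v))"

text \<open>Paths in \<open>U\<close> tangent to the distribution \<open>Ker \<phi>\<close>. When this distribution is integrable, the
  leaf through \<open>p\<close> of the induced foliation of \<open>U\<close> is the set of endpoints of such paths starting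
  at \<open>p\<close>. Differentiable (rather than piecewise differentiable) paths suffice, since
  a path can be reparametrised so as to have zero velocity at its endpoints.\<close>

definition leaf_path ::
  "'a topology \<Rightarrow> ('a, 'e::euclidean_space) chart set \<Rightarrow>
    (('a, 'e) chart \<Rightarrow> 'e \<Rightarrow> 'e \<Rightarrow> 'e) \<Rightarrow> 'a set \<Rightarrow> (real \<Rightarrow> 'a) \<Rightarrow> bool"
  where "leaf_path T A \<phi> U \<gamma> \<longleftrightarrow>
    pathin (subtopology T U) \<gamma> \<and>
    (\<forall>c\<in>A. \<forall>t\<in>{0..1}. \<gamma> t \<in> cdom c \<longrightarrow>
       (\<exists>v. ((\<lambda>r. cmap c (\<gamma> r)) has_vector_derivative v) (at t within {0..1}) \<and>
            \<phi> c (cmap c (\<gamma> t)) v = 0))"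

definition leaf ::
  "'a topology \<Rightarrow> ('a, 'e::euclidean_space) chart set \<Rightarrow>
    (('a, 'e) chart \<Rightarrow> 'e \<Rightarrow> 'e \<Rightarrow> 'e) \<Rightarrow> 'a set \<Rightarrow> 'a \<Rightarrow> 'a set"
  where "leaf T A \<phi> U p = {q. \<exists>\<gamma>. leaf_path T A \<phi> U \<gamma> \<and> \<gamma> 0 = p \<and> \<gamma> 1 = q}"

text \<open>The canonical submersion of the open set \<open>U\<close>. The points of the base are the leaves of the
  foliation of \<open>U\<close> tangent to \<open>Ker \<phi>\<close>, its topology \<open>S\<close> is the quotient topology, the projection is
  the quotient map \<open>p \<mapsto> leaf through p\<close>, and \<open>B\<close> is an atlas on the leaf space. The last
  conjunct determines \<open>J\<close>; the Riemannian submersion property determines the base metric \<open>g'\<close>.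
  That \<open>(g', J)\<close> is a Kaehler structure is not part of this definition.\<close>

definition canonical_submersion ::
  "'a topology \<Rightarrow> ('a, 'e::euclidean_space) chart set \<Rightarrow> nat \<Rightarrow>
    (('a, 'e) chart \<Rightarrow> 'e \<Rightarrow> 'e \<Rightarrow> 'e) \<Rightarrow>
    (('a, 'e) chart \<Rightarrow> 'e \<Rightarrow> 'e \<Rightarrow> 'e \<Rightarrow> real) \<Rightarrow> 'a set \<Rightarrow>
    'a set topology \<Rightarrow> ('a set, 'f::euclidean_space) chart set \<Rightarrow>
    (('a set, 'f) chart \<Rightarrow> 'f \<Rightarrow> 'f \<Rightarrow> 'f \<Rightarrow> real) \<Rightarrow>
    (('a set, 'f) chart \<Rightarrow> 'f \<Rightarrow> 'f \<Rightarrow> 'f) \<Rightarrow> bool"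
  where "canonical_submersion T A n \<phi> g U S B g' J \<longleftrightarrow>
    openin T U \<and> U \<noteq> {} \<and>
    quotient_map (subtopology T U) S (leaf T A \<phi> U) \<and>
    smooth_manifold S B \<and> DIM('f) = 2 * n \<and>
    riemannian_metric B g' \<and> endomorphism_field B J \<and>
    riemannian_submersion T A g U S B g' (leaf T A \<phi> U) \<and>
    (\<forall>c\<in>A. \<forall>d\<in>B. \<forall>p\<in>U. p \<in> cdom c \<and> leaf T A \<phi> U p \<in> cdom d \<longrightarrow>
       vertical_space c d (leaf T A \<phi> U) p = {v. \<phi> c (cmap c p) v = 0} \<and>
       horizontal_space g c d (leaf T A \<phi> U) p = range (\<phi> c (cmap c p)) \<and>
       (\<forall>u\<in>horizontal_space g c d (leaf T A \<phi> U) p.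
          J d (cmap d (leaf T A \<phi> U p)) (differential c d (leaf T A \<phi> U) p u) =
          differential c d (leaf T A \<phi> U) p (\<phi> c (cmap c p) u)))"

end

theory Submission
  imports Defs
begin

text \<open>On \<open>M\<close> take the frame consisting of the horizontal lifts of coordinate fields of the base and the
  \<open>\<xi>\<^sub>i\<close>. Since \<open>d\<eta>\<^sub>i = 2F\<close>, its only nonzero brackets are \<open>[X\<^sub>a, X\<^sub>b] = -2 g'(a, Jb) \<Sum>\<^sub>i \<xi>\<^sub>i\<close>, so the Koszul formula
  expresses the Levi-Civita connection of \<open>M\<close> in this frame through \<open>\<nabla>'\<close>, \<open>J\<close> and \<open>g'\<close> alone. The
  base is Kaehler: its Nijenhuis tensor is the projection of that of \<open>\<phi>\<close>, and its Kaehler form pulls back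
  to \<open>d\<eta>\<^sub>i / 2\<close>. Hence \<open>\<nabla>'J = 0\<close>, and taking the trace of the curvature in the frame gives, with
  \<open>\<eta> = \<Sum>\<^sub>i \<eta>\<^sub>i\<close>, the identity \<open>Ric(u,v) = Ric'(\<pi>\<^sub>*u, \<pi>\<^sub>*v) - 2s g'(\<pi>\<^sub>*u, \<pi>\<^sub>*v) + 2n \<eta>(u) \<eta>(v)\<close>, from which
  both implications are read off.\<close>

section \<open>Calculus of smooth maps\<close>

text \<open>All derivatives are taken in one pair of charts, where the submersion is a map
  \<open>f\<close> between Euclidean domains and the foliation is visible only as the kernel of its
  differential. The Christoffel vector and the horizontal lift are unique solutions of linear
  equations there, so their smoothness is not visible; it comes from a general statement on linear
  systems with smooth coefficients, in place of explicit inverse matrices. The frame is taken with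
  constant components: its inner products are then functions on the base and the
  \<open>\<eta> i\<close> are constant on it, so only base derivatives survive. As all the
  \<open>d\<eta>_i\<close> coincide, the vertical parts of brackets and of covariant derivatives of
  frame fields are multiples of the single field \<open>\<xi>_sum\<close>; the sum of the
  \<open>\<eta> i\<close> takes the value s on it, which is the source of the factor s in the Ricci
  tensor. Identities on the base are first obtained at points \<open>f x\<close> only; surjectivity
  of the projection carries them to whole base charts before \<open>J^2 = -1\<close> is
  differentiated there.\<close>

lemma fderiv_works: "f differentiable (at x) \<Longrightarrow> (f has_derivative fderiv f x) (at x)"
  by (simp add: frechet_derivative_works)

lemma fderiv_eq: "(f has_derivative f') (at x) \<Longrightarrow> fderiv f x v = f' v"
  using frechet_derivative_at by metis

lemma fderiv_cong:
  assumes "open S" "x \<in> S" "\<And>y. y \<in> S \<Longrightarrow> f y = h y"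
  shows "fderiv f x = fderiv h x"
proof -
  have "(f has_derivative f') (at x) \<longleftrightarrow> (h has_derivative f') (at x)" for f'
    using assms has_derivative_transform_within_open[of f f' x UNIV S h]
      has_derivative_transform_within_open[of h f' x UNIV S f] by auto
  then show ?thesis by (simp add: frechet_derivative_def)
qed

lemma differentiable_cong:
  assumes "open S" "x \<in> S" "\<And>y. y \<in> S \<Longrightarrow> f y = h y"
  shows "f differentiable (at x) \<longleftrightarrow> h differentiable (at x)"
  using assms has_derivative_transform_within_open[of f _ x UNIV S h]
      has_derivative_transform_within_open[of h _ x UNIV S f]
  unfolding differentiable_def by (metis)

lemma fderiv_linear_comp:
  assumes "bounded_linear h" "f differentiable (at x)"
  shows "fderiv (\<lambda>y. h (f y)) x v = h (fderiv f x v)"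
  by (rule fderiv_eq) (use bounded_linear.has_derivative[OF assms(1) fderiv_works[OF assms(2)]] in simp)

lemma fderiv_add:
  assumes "f differentiable (at x)" "h differentiable (at x)"
  shows "fderiv (\<lambda>y. f y + h y) x v = fderiv f x v + fderiv h x v"
  by (rule fderiv_eq) (intro has_derivative_add fderiv_works assms)

lemma fderiv_diff:
  assumes "f differentiable (at x)" "h differentiable (at x)"
  shows "fderiv (\<lambda>y. f y - h y) x v = fderiv f x v - fderiv h x v"
  by (rule fderiv_eq) (intro has_derivative_diff fderiv_works assms)

lemma fderiv_minus:
  assumes "f differentiable (at x)"
  shows "fderiv (\<lambda>y. - f y) x v = - fderiv f x v"
  by (rule fderiv_eq) (intro has_derivative_minus fderiv_works assms)

lemma fderiv_sum:
  assumes "\<And>i. i \<in> I \<Longrightarrow> f i differentiable (at x)"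
  shows "fderiv (\<lambda>y. \<Sum>i\<in>I. f i y) x v = (\<Sum>i\<in>I. fderiv (f i) x v)"
  by (rule fderiv_eq) (intro has_derivative_sum fderiv_works assms)

lemma fderiv_scaleR:
  fixes a :: "'v::real_normed_vector \<Rightarrow> real"
  assumes "a differentiable (at x)" "f differentiable (at x)"
  shows "fderiv (\<lambda>y. a y *\<^sub>R f y) x v = fderiv a x v *\<^sub>R f x + a x *\<^sub>R fderiv f x v"
  using fderiv_eq[OF has_derivative_scaleR[OF fderiv_works fderiv_works, OF assms], of v] by simp

lemma fderiv_cmult:
  fixes a :: "'v::real_normed_vector \<Rightarrow> real"
  assumes "a differentiable (at x)"
  shows "fderiv (\<lambda>y. c * a y) x v = c * fderiv a x v"
  using fderiv_linear_comp[OF bounded_linear_mult_right[of c] assms, of v] by simp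

lemma fderiv_compose:
  assumes "f differentiable (at x)" "h differentiable (at (f x))"
  shows "fderiv (\<lambda>y. h (f y)) x v = fderiv h (f x) (fderiv f x v)"
  using fderiv_eq[OF diff_chain_at[OF fderiv_works fderiv_works, OF assms], of v]
  by (simp add: comp_def)

lemma fderiv_lin: 
  assumes "f differentiable (at x)" shows "linear (fderiv f x)"
  using assms by (rule linear_frechet_derivative)

lemma differentiable_linear_comp:
  "bounded_linear h \<Longrightarrow> f differentiable (at x) \<Longrightarrow> (\<lambda>y. h (f y)) differentiable (at x)"
  unfolding differentiable_def using bounded_linear.has_derivative by blast

lemma Ck_on_Suc_diff: "Ck_on (Suc k) S f \<Longrightarrow> x \<in> S \<Longrightarrow> f differentiable (at x)"
  by simp

lemma Ck_on_mono: "Ck_on k S f \<Longrightarrow> S' \<subseteq> S \<Longrightarrow> Ck_on k S' f"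
  by (induction k arbitrary: f) (auto intro: continuous_on_subset)

lemma smooth_on_mono: "smooth_on S f \<Longrightarrow> S' \<subseteq> S \<Longrightarrow> smooth_on S' f"
  by (auto simp: smooth_on_def intro: Ck_on_mono)

text \<open>\<open>fderiv\<close> sees only the germ of a map; on an open set agreement is agreement
  of germs, so formulas for derivatives may be rewritten inside \<open>Ck_on\<close>.\<close>

lemma Ck_on_cong:
  assumes "open S" "\<And>y. y \<in> S \<Longrightarrow> f y = h y"
  shows "Ck_on k S f \<longleftrightarrow> Ck_on k S h"
  using assms(2)
proof (induction k arbitrary: f h)
  case 0 then show ?case by (auto intro: continuous_on_cong)
next
  case (Suc k)
  have "fderiv f x v = fderiv h x v" if "x \<in> S" for x v
    using fderiv_cong[OF assms(1) that, of f h] Suc.prems by auto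
  then have "Ck_on k S (\<lambda>x. fderiv f x v) \<longleftrightarrow> Ck_on k S (\<lambda>x. fderiv h x v)" for v
    by (rule Suc.IH)
  moreover have "f differentiable (at x) \<longleftrightarrow> h differentiable (at x)" if "x \<in> S" for x
    using differentiable_cong[OF assms(1) that, of f h] Suc.prems by auto
  ultimately show ?case by auto
qed

lemma Ck_on_Suc_imp:
  "Ck_on (Suc k) S f \<Longrightarrow> Ck_on k S f"
proof (induction k arbitrary: f)
  case 0 then show ?case
    by (auto intro!: continuous_at_imp_continuous_on differentiable_imp_continuous_within)
next
  case (Suc k) then show ?case by (metis Ck_on.simps(2))
qed

lemma smooth_on_differentiable: "smooth_on S f \<Longrightarrow> x \<in> S \<Longrightarrow> f differentiable (at x)"
  unfolding smooth_on_def using Ck_on_Suc_diff by blast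

lemma smooth_on_fderiv: "smooth_on S f \<Longrightarrow> smooth_on S (\<lambda>x. fderiv f x v)"
  unfolding smooth_on_def using Ck_on.simps(2) by blast

lemma Ck_on_const: "Ck_on k S (\<lambda>x. c)"
  by (induction k arbitrary: c) auto

lemma smooth_on_const: "smooth_on S (\<lambda>x. c)"
  by (simp add: smooth_on_def Ck_on_const)

lemma linear_expand:
  fixes v :: "'e::euclidean_space"
  assumes "linear h"
  shows "h v = (\<Sum>b\<in>Basis. (v \<bullet> b) *\<^sub>R h b)"
proof -
  have "h v = h (\<Sum>b\<in>Basis. (v \<bullet> b) *\<^sub>R b)" by (simp add: euclidean_representation)
  also have "\<dots> = (\<Sum>b\<in>Basis. (v \<bullet> b) *\<^sub>R h b)"
    using assms by (simp add: linear_sum linear_scale)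
  finally show ?thesis .
qed

section \<open>Smoothness under sums, products, evaluation and composition\<close>

context
  fixes S :: "'v::real_normed_vector set"
  assumes S: "open S"
begin

lemma Ck_on_linear_comp:
  assumes "bounded_linear h"
  shows "Ck_on k S f \<Longrightarrow> Ck_on k S (\<lambda>y. h (f y))"
proof (induction k arbitrary: f)
  case 0 then show ?case using assms by (auto intro: bounded_linear.continuous_on)
next
  case (Suc k)
  have "Ck_on k S (\<lambda>y. fderiv (\<lambda>y. h (f y)) y v)" for v
    using Suc.IH[of "\<lambda>y. fderiv f y v"] Suc.prems
    by (subst Ck_on_cong[OF S fderiv_linear_comp[OF assms]]) auto
  then show ?case using Suc.prems differentiable_linear_comp[OF assms] by auto
qed

lemma Ck_on_add: "Ck_on k S f \<Longrightarrow> Ck_on k S h \<Longrightarrow> Ck_on k S (\<lambda>y. f y + h y)"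
proof (induction k arbitrary: f h)
  case 0 then show ?case by (auto intro: continuous_on_add)
next
  case (Suc k)
  have "Ck_on k S (\<lambda>y. fderiv (\<lambda>y. f y + h y) y v)" for v
    using Suc.IH[of "\<lambda>y. fderiv f y v" "\<lambda>y. fderiv h y v"] Suc.prems
    by (subst Ck_on_cong[OF S fderiv_add]) auto
  then show ?case using Suc.prems by auto
qed

lemma Ck_on_sum: "(\<And>i. i \<in> I \<Longrightarrow> Ck_on k S (f i)) \<Longrightarrow> Ck_on k S (\<lambda>y. \<Sum>i\<in>I. f i y)"
  by (induction I rule: infinite_finite_induct) (auto intro: Ck_on_add simp: Ck_on_const)

lemma Ck_on_scaleR:
  fixes a :: "'v \<Rightarrow> real"
  shows "Ck_on k S a \<Longrightarrow> Ck_on k S f \<Longrightarrow> Ck_on k S (\<lambda>y. a y *\<^sub>R f y)"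
proof (induction k arbitrary: a f)
  case 0 then show ?case by (auto intro: continuous_on_scaleR)
next
  case (Suc k)
  have "Ck_on k S (\<lambda>y. fderiv (\<lambda>y. a y *\<^sub>R f y) y v)" for v
    using Suc.IH[of "\<lambda>y. fderiv a y v" f] Suc.IH[of a "\<lambda>y. fderiv f y v"] Suc.prems
      Ck_on_Suc_imp[OF Suc.prems(1)] Ck_on_Suc_imp[OF Suc.prems(2)]
    by (subst Ck_on_cong[OF S fderiv_scaleR]) (auto intro!: Ck_on_add)
  then show ?case using Suc.prems by auto
qed

lemma smooth_on_linear_comp:
  "bounded_linear h \<Longrightarrow> smooth_on S f \<Longrightarrow> smooth_on S (\<lambda>y. h (f y))"
  by (simp add: smooth_on_def Ck_on_linear_comp)

lemma smooth_on_add: "smooth_on S f \<Longrightarrow> smooth_on S h \<Longrightarrow> smooth_on S (\<lambda>y. f y + h y)"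
  by (simp add: smooth_on_def Ck_on_add)

lemma smooth_on_minus: "smooth_on S f \<Longrightarrow> smooth_on S (\<lambda>y. - f y)"
  by (rule smooth_on_linear_comp[OF bounded_linear_minus[OF bounded_linear_ident]])

lemma smooth_on_diff: "smooth_on S f \<Longrightarrow> smooth_on S h \<Longrightarrow> smooth_on S (\<lambda>y. f y - h y)"
  using smooth_on_add[of f "\<lambda>y. - h y"] smooth_on_minus[of h] by simp

lemma smooth_on_sum: "(\<And>i. i \<in> I \<Longrightarrow> smooth_on S (f i)) \<Longrightarrow> smooth_on S (\<lambda>y. \<Sum>i\<in>I. f i y)"
  by (simp add: smooth_on_def Ck_on_sum)

lemma smooth_on_scaleR:
  fixes a :: "'v \<Rightarrow> real"
  shows "smooth_on S a \<Longrightarrow> smooth_on S f \<Longrightarrow> smooth_on S (\<lambda>y. a y *\<^sub>R f y)"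
  by (simp add: smooth_on_def Ck_on_scaleR)

lemma smooth_on_cmult:
  fixes a :: "'v \<Rightarrow> real"
  shows "smooth_on S a \<Longrightarrow> smooth_on S (\<lambda>y. c * a y)"
  using smooth_on_linear_comp[OF bounded_linear_mult_right[of c]] by simp

text \<open>Tensor fields are given as smooth at each fixed argument only. Expanding the moving
  argument in \<open>Basis\<close> turns the evaluation into a finite sum of products of such
  functions.\<close>

lemma Ck_on_apply:
  fixes X :: "'v \<Rightarrow> 'e::euclidean_space"
  assumes "\<And>x. x \<in> S \<Longrightarrow> linear (A x)" "\<And>v. Ck_on k S (\<lambda>x. A x v)" "Ck_on k S X"
  shows "Ck_on k S (\<lambda>x. A x (X x))"
proof (subst Ck_on_cong[OF S])
  show "A x (X x) = (\<Sum>b\<in>Basis. (X x \<bullet> b) *\<^sub>R A x b)" if "x \<in> S" for x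
    by (rule linear_expand) (rule assms that)+
  show "Ck_on k S (\<lambda>x. \<Sum>b\<in>Basis. (X x \<bullet> b) *\<^sub>R A x b)"
    by (intro Ck_on_sum Ck_on_scaleR assms Ck_on_linear_comp[of "\<lambda>v. v \<bullet> b" for b] bounded_linear_inner_left)
qed

lemma smooth_on_apply:
  fixes X :: "'v \<Rightarrow> 'e::euclidean_space"
  assumes "\<And>x. x \<in> S \<Longrightarrow> linear (A x)" "\<And>v. smooth_on S (\<lambda>x. A x v)" "smooth_on S X"
  shows "smooth_on S (\<lambda>x. A x (X x))"
  using assms Ck_on_apply unfolding smooth_on_def by blast

text \<open>The Leibniz rule for a tensor field evaluated on a moving vector, by the same expansion.
  The last claim, linearity of the derivative in a frozen argument, is what makes
  \<open>koszul\<close> and \<open>curv\<close> multilinear.\<close>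

lemma differentiable_apply:
  fixes X :: "'v \<Rightarrow> 'e::euclidean_space"
  assumes "x \<in> S" "\<And>y. y \<in> S \<Longrightarrow> linear (A y)" "\<And>v. (\<lambda>y. A y v) differentiable (at x)"
     "X differentiable (at x)"
  shows "(\<lambda>y. A y (X y)) differentiable (at x)"
    and "fderiv (\<lambda>y. A y (X y)) x v = fderiv (\<lambda>y. A y (X x)) x v + A x (fderiv X x v)"
    and "linear (\<lambda>u. fderiv (\<lambda>y. A y u) x v)"
proof -
  have e: "A y w = (\<Sum>b\<in>Basis. (w \<bullet> b) *\<^sub>R A y b)" if "y \<in> S" for y w
    by (rule linear_expand) (rule assms that)+
  have dX: "(\<lambda>y. X y \<bullet> b) differentiable (at x)" for b
    by (rule differentiable_linear_comp[OF bounded_linear_inner_left assms(4)])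
  have fX: "fderiv (\<lambda>y. X y \<bullet> b) x v = fderiv X x v \<bullet> b" for b
    by (rule fderiv_linear_comp[OF bounded_linear_inner_left assms(4)])
  have "(\<lambda>y. \<Sum>b\<in>Basis. (X y \<bullet> b) *\<^sub>R A y b) differentiable (at x)"
    by (intro differentiable_sum differentiable_scaleR ballI dX assms finite_Basis)
  then show "(\<lambda>y. A y (X y)) differentiable (at x)"
    by (subst differentiable_cong[OF \<open>open S\<close> assms(1) e])
  have f1: "fderiv (\<lambda>y. A y w) x v = (\<Sum>b\<in>Basis. (w \<bullet> b) *\<^sub>R fderiv (\<lambda>y. A y b) x v)" for w
  proof -
    have "fderiv (\<lambda>y. A y w) x = fderiv (\<lambda>y. \<Sum>b\<in>Basis. (w \<bullet> b) *\<^sub>R A y b) x"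
      by (rule fderiv_cong[OF S assms(1)]) (rule e)
    then show ?thesis
      by (simp add: fderiv_sum differentiable_scaleR fderiv_scaleR assms(3))
  qed
  have "fderiv (\<lambda>y. A y (X y)) x v
      = (\<Sum>b\<in>Basis. (fderiv X x v \<bullet> b) *\<^sub>R A x b + (X x \<bullet> b) *\<^sub>R fderiv (\<lambda>y. A y b) x v)"
  proof -
    have "fderiv (\<lambda>y. A y (X y)) x = fderiv (\<lambda>y. \<Sum>b\<in>Basis. (X y \<bullet> b) *\<^sub>R A y b) x"
      by (rule fderiv_cong[OF S assms(1)]) (rule e)
    then show ?thesis
      by (simp add: fderiv_sum differentiable_scaleR dX fderiv_scaleR fX assms(3))
  qed
  also have "\<dots> = fderiv (\<lambda>y. A y (X x)) x v + A x (fderiv X x v)"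
    unfolding f1[of "X x"] e[OF assms(1), of "fderiv X x v"] by (simp add: sum.distrib)
  finally show "fderiv (\<lambda>y. A y (X y)) x v = fderiv (\<lambda>y. A y (X x)) x v + A x (fderiv X x v)" .
  show "linear (\<lambda>u. fderiv (\<lambda>y. A y u) x v)"
    by (subst ext[OF f1], intro linear_compose_sum ballI) (auto intro!: linearI simp: algebra_simps)
qed

text \<open>Induction with \<open>f\<close> fixed and \<open>h\<close> general: the chain rule
  presents the derivative as \<open>fderiv h (f y)\<close> evaluated on \<open>fderiv f y v\<close>.
  The induction hypothesis covers each \<open>fderiv h _ w\<close>, and \<open>Ck_on_apply\<close>
  the evaluation.\<close>

lemma Ck_on_compose:
  fixes f :: "'v \<Rightarrow> 'e::euclidean_space"
  assumes "\<And>x. x \<in> S \<Longrightarrow> f x \<in> R"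
  shows "Ck_on k S f \<Longrightarrow> Ck_on k R h \<Longrightarrow> Ck_on k S (\<lambda>y. h (f y))"
proof (induction k arbitrary: h)
  case 0 then show ?case using assms by (auto intro!: continuous_on_compose2[of R h S f])
next
  case (Suc k)
  have d: "f differentiable (at x)" "h differentiable (at (f x))" if "x \<in> S" for x
    using Suc.prems assms that by auto
  have "Ck_on k S (\<lambda>y. fderiv h (f y) (fderiv f y v))" for v
  proof (rule Ck_on_apply)
    show "linear (fderiv h (f x))" if "x \<in> S" for x by (rule fderiv_lin[OF d(2)[OF that]])
    show "Ck_on k S (\<lambda>x. fderiv h (f x) w)" for w
      using Suc.IH[OF Ck_on_Suc_imp[OF Suc.prems(1)], of "\<lambda>z. fderiv h z w"] Suc.prems(2) by simp
    show "Ck_on k S (\<lambda>x. fderiv f x v)" using Suc.prems(1) by simp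
  qed
  then have "Ck_on k S (\<lambda>y. fderiv (\<lambda>y. h (f y)) y v)" for v
    by (subst Ck_on_cong[OF S fderiv_compose]) (auto simp: d)
  moreover have "(\<lambda>y. h (f y)) differentiable (at x)" if "x \<in> S" for x
    using differentiable_chain_at[of f x h] d[OF that] by (auto simp: comp_def)
  ultimately show ?case by auto
qed

lemma smooth_on_compose:
  fixes f :: "'v \<Rightarrow> 'e::euclidean_space"
  assumes "\<And>x. x \<in> S \<Longrightarrow> f x \<in> R" "smooth_on S f" "smooth_on R h"
  shows "smooth_on S (\<lambda>y. h (f y))"
  using Ck_on_compose[of f R, OF assms(1)] assms(2,3) unfolding smooth_on_def by blast

end

text \<open>The mean value theorem, applied twice, expresses the second difference
  \<open>f(x+tu+tv) - f(x+tu) - f(x+tv) + f(x)\<close>, which is symmetric in \<open>u\<close> and \<open>v\<close>.\<close>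

lemma second_difference_mvt:
  fixes f :: "'v::real_normed_vector \<Rightarrow> real"
  assumes f: "Ck_on 2 S f" and t: "t > 0"
    and sub: "\<And>a b. 0 \<le> a \<Longrightarrow> a \<le> t \<Longrightarrow> 0 \<le> b \<Longrightarrow> b \<le> t \<Longrightarrow> x + a *\<^sub>R u + b *\<^sub>R v \<in> S"
  shows "\<exists>a b. 0 \<le> a \<and> a \<le> t \<and> 0 \<le> b \<and> b \<le> t \<and>
    f (x + t *\<^sub>R u + t *\<^sub>R v) - f (x + t *\<^sub>R u) - f (x + t *\<^sub>R v) + f x
      = t\<^sup>2 * fderiv (\<lambda>y. fderiv f y u) (x + a *\<^sub>R u + b *\<^sub>R v) v"
proof -
  have d1: "f differentiable (at y)" if "y \<in> S" for y
    using f that by (simp add: numeral_2_eq_2)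
  have d2: "(\<lambda>y. fderiv f y u) differentiable (at y)" if "y \<in> S" for y
    using f that by (simp add: numeral_2_eq_2)
  have line: "((\<lambda>r. h (y + r *\<^sub>R w)) has_real_derivative fderiv h (y + r *\<^sub>R w) w) (at r)"
    if "h differentiable (at (y + r *\<^sub>R w))" for h :: "'v \<Rightarrow> real" and y w r
  proof -
    have "((\<lambda>r. y + r *\<^sub>R w) has_derivative (\<lambda>r. r *\<^sub>R w)) (at r)"
      by (auto intro!: derivative_eq_intros)
    from diff_chain_at[OF this fderiv_works[OF that]]
    have "((\<lambda>r. h (y + r *\<^sub>R w)) has_derivative (\<lambda>q. fderiv h (y + r *\<^sub>R w) (q *\<^sub>R w))) (at r)"
      by (simp add: comp_def)
    then show ?thesis
      unfolding has_field_derivative_def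
      by (simp add: linear_scale[OF fderiv_lin[OF that]] mult.commute[of _ "fderiv h (y + r *\<^sub>R w) w"])
  qed
  define q where "q r = f ((x + t *\<^sub>R v) + r *\<^sub>R u) - f (x + r *\<^sub>R u)" for r
  have "\<exists>a. 0 < a \<and> a < t \<and> q t - q 0 = (t - 0) *
     (fderiv f ((x + t *\<^sub>R v) + a *\<^sub>R u) u - fderiv f (x + a *\<^sub>R u) u)"
  proof (rule MVT2[OF t])
    fix r assume r: "0 \<le> r" "r \<le> t"
    show "(q has_real_derivative fderiv f ((x + t *\<^sub>R v) + r *\<^sub>R u) u - fderiv f (x + r *\<^sub>R u) u) (at r)"
      unfolding q_def using r t sub[of r t] sub[of r 0]
      by (intro DERIV_diff line d1) (auto simp: algebra_simps)
  qed
  then obtain a where a: "0 < a" "a < t" "q t - q 0 = t *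
     (fderiv f ((x + t *\<^sub>R v) + a *\<^sub>R u) u - fderiv f (x + a *\<^sub>R u) u)" by auto
  have "\<exists>b. 0 < b \<and> b < t \<and> fderiv f ((x + a *\<^sub>R u) + t *\<^sub>R v) u - fderiv f ((x + a *\<^sub>R u) + 0 *\<^sub>R v) u
     = (t - 0) * fderiv (\<lambda>y. fderiv f y u) ((x + a *\<^sub>R u) + b *\<^sub>R v) v"
  proof (rule MVT2[OF t])
    fix r assume r: "0 \<le> r" "r \<le> t"
    show "((\<lambda>r. fderiv f ((x + a *\<^sub>R u) + r *\<^sub>R v) u) has_real_derivative
       fderiv (\<lambda>y. fderiv f y u) ((x + a *\<^sub>R u) + r *\<^sub>R v) v) (at r)"
      using r a sub[of a r] by (intro line d2) auto
  qed
  then obtain b where b: "0 < b" "b < t" "fderiv f ((x + a *\<^sub>R u) + t *\<^sub>R v) u - fderiv f (x + a *\<^sub>R u) u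
     = t * fderiv (\<lambda>y. fderiv f y u) ((x + a *\<^sub>R u) + b *\<^sub>R v) v" by auto
  have "f (x + t *\<^sub>R u + t *\<^sub>R v) - f (x + t *\<^sub>R u) - f (x + t *\<^sub>R v) + f x = q t - q 0"
    by (simp add: q_def add.commute add.left_commute)
  also have "\<dots> = t * (t * fderiv (\<lambda>y. fderiv f y u) ((x + a *\<^sub>R u) + b *\<^sub>R v) v)"
    using a(3) b(3) by (simp add: add.commute add.left_commute)
  finally show ?thesis using a b
    by (intro exI[of _ a] exI[of _ b]) (auto simp: power2_eq_square)
qed

text \<open>Divided by \<open>t^2\<close>, one and the same second difference equals either mixed
  derivative, each at some point within \<open>t * (norm u + norm v)\<close> of \<open>x\<close>. As
  \<open>t\<close> tends to 0, continuity of the second derivatives moves both points to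
  \<open>x\<close>.\<close>

lemma fderiv_symmetric_real:
  fixes f :: "'v::real_normed_vector \<Rightarrow> real"
  assumes S: "open S" "x \<in> S" and f: "Ck_on 2 S f"
  shows "fderiv (\<lambda>y. fderiv f y u) x v = fderiv (\<lambda>y. fderiv f y v) x u"
proof -
  let ?L = "\<lambda>u v y. fderiv (\<lambda>y. fderiv f y u) y v"
  obtain e where e: "e > 0" "ball x e \<subseteq> S" using S open_contains_ball by blast
  \<comment> \<open>The summand 1 keeps \<open>K\<close> positive when both vectors vanish and makes
    the bound \<open>tK\<close> strict, so that the parallelograms lie in the open ball.\<close>
  define K where "K = norm u + norm v + 1"
  have K: "K > 0" by (simp add: K_def add_nonneg_pos)
  define t where "t k = e / K * inverse (real (Suc k))" for k
  have t0: "t k > 0" for k using e K by (simp add: t_def)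
  have tlim: "t \<longlonglongrightarrow> 0" unfolding t_def by (rule tendsto_mult_right_zero[OF LIMSEQ_inverse_real_of_nat])
  have bd: "norm (a *\<^sub>R u + b *\<^sub>R v) \<le> t k * (norm u + norm v)"
    if "0 \<le> a" "a \<le> t k" "0 \<le> b" "b \<le> t k" for a b k u v
    using that norm_triangle_ineq[of "a *\<^sub>R u" "b *\<^sub>R v"]
      mult_right_mono[OF that(2) norm_ge_zero[of u]] mult_right_mono[OF that(4) norm_ge_zero[of v]]
    by (simp add: distrib_left)
  have tK: "t k * (norm u + norm v) < e" for k
  proof -
    have "t k \<le> e / K" unfolding t_def using e K by (simp add: divide_simps)
    then have "t k * K \<le> e" using K by (simp add: pos_le_divide_eq)
    moreover have "t k * (norm u + norm v) < t k * K" using t0 by (simp add: K_def)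
    ultimately show ?thesis by simp
  qed
  have inS: "x + a *\<^sub>R u + b *\<^sub>R v \<in> S" "x + a *\<^sub>R v + b *\<^sub>R u \<in> S"
    if "0 \<le> a" "a \<le> t k" "0 \<le> b" "b \<le> t k" for a b k
    using bd[OF that, of u v] bd[OF that, of v u] tK[of k] e(2) by (auto simp: dist_norm subset_eq add.assoc norm_minus_commute add.commute)
  have "\<exists>y z. y \<in> S \<and> z \<in> S \<and> norm (y - x) \<le> t k * (norm u + norm v) \<and> norm (z - x) \<le> t k * (norm u + norm v)
     \<and> ?L u v y = ?L v u z" for k
  proof -
    obtain a b where ab: "0 \<le> a" "a \<le> t k" "0 \<le> b" "b \<le> t k"
      "f (x + t k *\<^sub>R u + t k *\<^sub>R v) - f (x + t k *\<^sub>R u) - f (x + t k *\<^sub>R v) + f x = (t k)\<^sup>2 * ?L u v (x + a *\<^sub>R u + b *\<^sub>R v)"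
      using second_difference_mvt[OF f t0, of k x u v] inS by blast
    obtain c d where cd: "0 \<le> c" "c \<le> t k" "0 \<le> d" "d \<le> t k"
      "f (x + t k *\<^sub>R v + t k *\<^sub>R u) - f (x + t k *\<^sub>R v) - f (x + t k *\<^sub>R u) + f x = (t k)\<^sup>2 * ?L v u (x + c *\<^sub>R v + d *\<^sub>R u)"
      using second_difference_mvt[OF f t0, of k x v u] inS by blast
    have "(t k)\<^sup>2 * ?L u v (x + a *\<^sub>R u + b *\<^sub>R v) = (t k)\<^sup>2 * ?L v u (x + c *\<^sub>R v + d *\<^sub>R u)"
    proof -
      have "x + t k *\<^sub>R u + t k *\<^sub>R v = x + t k *\<^sub>R v + t k *\<^sub>R u" by simp
      then show ?thesis using ab(5) cd(5) by (simp only:)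
    qed
    then have "?L u v (x + a *\<^sub>R u + b *\<^sub>R v) = ?L v u (x + c *\<^sub>R v + d *\<^sub>R u)" using t0[of k] by simp
    moreover have "norm ((x + a *\<^sub>R u + b *\<^sub>R v) - x) \<le> t k * (norm u + norm v)"
      using bd[of a k b u v] ab by (simp add: algebra_simps)
    moreover have "norm ((x + c *\<^sub>R v + d *\<^sub>R u) - x) \<le> t k * (norm u + norm v)"
      using bd[of c k d v u] cd by (simp add: algebra_simps)
    ultimately show ?thesis using inS[of a k b] inS[of c k d] ab cd by blast
  qed
  then obtain y z where yz: "\<And>k. y k \<in> S" "\<And>k. z k \<in> S"
    "\<And>k. norm (y k - x) \<le> t k * (norm u + norm v)" "\<And>k. norm (z k - x) \<le> t k * (norm u + norm v)"
    "\<And>k. ?L u v (y k) = ?L v u (z k)" by metis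
  have lim0: "(\<lambda>k. t k * (norm u + norm v)) \<longlonglongrightarrow> 0" by (rule tendsto_mult_left_zero[OF tlim])
  have "y \<longlonglongrightarrow> x" "z \<longlonglongrightarrow> x"
    using Lim_null_comparison[OF _ lim0, of "\<lambda>k. y k - x"] Lim_null_comparison[OF _ lim0, of "\<lambda>k. z k - x"]
      yz(3,4) by (auto simp: LIM_zero_iff)
  moreover have "continuous_on S (?L u v)" "continuous_on S (?L v u)" using f by (auto simp: numeral_2_eq_2)
  ultimately have "(\<lambda>k. ?L u v (y k)) \<longlonglongrightarrow> ?L u v x" "(\<lambda>k. ?L v u (z k)) \<longlonglongrightarrow> ?L v u x"
    using yz S(2) unfolding continuous_on_sequentially comp_def by blast+
  then show ?thesis using yz(5) LIMSEQ_unique by simp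
qed

lemma fderiv_symmetric:
  fixes f :: "'v::real_normed_vector \<Rightarrow> 'w::euclidean_space"
  assumes S: "open S" "x \<in> S" and f: "smooth_on S f"
  shows "fderiv (\<lambda>y. fderiv f y u) x v = fderiv (\<lambda>y. fderiv f y v) x u"
proof (rule euclidean_eqI)
  fix b :: 'w assume "b \<in> Basis"
  have d: "f differentiable (at y)" "(\<lambda>y. fderiv f y w) differentiable (at y)" if "y \<in> S" for y w
    using that by (intro smooth_on_differentiable[of S] smooth_on_fderiv f; simp)+
  have "smooth_on S (\<lambda>y. f y \<bullet> b)"
    by (rule smooth_on_linear_comp[OF S(1) bounded_linear_inner_left f])
  then have "fderiv (\<lambda>y. fderiv (\<lambda>y. f y \<bullet> b) y u) x v = fderiv (\<lambda>y. fderiv (\<lambda>y. f y \<bullet> b) y v) x u"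
    by (intro fderiv_symmetric_real[OF S]) (simp add: smooth_on_def)
  moreover have "fderiv (\<lambda>y. fderiv (\<lambda>y. f y \<bullet> b) y u) x v = fderiv (\<lambda>y. fderiv f y u) x v \<bullet> b" for u v
  proof -
    have "fderiv (\<lambda>y. fderiv (\<lambda>y. f y \<bullet> b) y u) x v = fderiv (\<lambda>y. fderiv f y u \<bullet> b) x v"
      by (subst fderiv_cong[OF S, where h="\<lambda>y. fderiv f y u \<bullet> b"])
        (auto simp: fderiv_linear_comp[OF bounded_linear_inner_left d(1)])
    then show ?thesis by (simp add: fderiv_linear_comp[OF bounded_linear_inner_left d(2)[OF S(2)]])
  qed
  ultimately show "fderiv (\<lambda>y. fderiv f y u) x v \<bullet> b = fderiv (\<lambda>y. fderiv f y v) x u \<bullet> b" by simp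
qed

lemma bilinear_apply:
  fixes X :: "'v::real_normed_vector \<Rightarrow> 'e::euclidean_space" and Y :: "'v \<Rightarrow> 'f::euclidean_space"
  assumes S: "open S" "x \<in> S" and B: "\<And>y. y \<in> S \<Longrightarrow> bilinear (B y)"
    and d: "\<And>u v. (\<lambda>y. B y u v) differentiable (at x)"
    and X: "X differentiable (at x)" and Y: "Y differentiable (at x)"
  shows "(\<lambda>y. B y (X y) (Y y)) differentiable (at x)"
    and "fderiv (\<lambda>y. B y (X y) (Y y)) x v =
      fderiv (\<lambda>y. B y (X x) (Y x)) x v + B x (fderiv X x v) (Y x) + B x (X x) (fderiv Y x v)"
proof -
  have l1: "linear (\<lambda>u. B y u w)" and l2: "linear (B y u)" if "y \<in> S" for y u w
    using B[OF that] by (auto simp: bilinear_def)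
  note a1 = differentiable_apply[OF S, of "\<lambda>y u. B y u w" for w, OF l1 d X]
  note a2 = differentiable_apply[OF S, of "\<lambda>y. B y (X y)", OF l2 a1(1) Y]
  show "(\<lambda>y. B y (X y) (Y y)) differentiable (at x)" by (rule a2(1))
  show "fderiv (\<lambda>y. B y (X y) (Y y)) x v =
      fderiv (\<lambda>y. B y (X x) (Y x)) x v + B x (fderiv X x v) (Y x) + B x (X x) (fderiv Y x v)"
    using a1(2)[of "Y x" v] a2(2)[of v] by simp
qed

section \<open>Linear equations depending on a parameter\<close>

text \<open>Injectivity is an open condition. In finite dimension, continuity at each fixed vector
  is uniform on bounded sets, with error controlled by the sum \<open>e\<close> over the basis, and
  the lower bound \<open>B\<close> at \<open>a\<close> loses at most a half once
  \<open>e x < B / 2\<close>.\<close>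

lemma linear_family_bounded_below:
  fixes L :: "'v::real_normed_vector \<Rightarrow> 'e::euclidean_space \<Rightarrow> 'e"
  assumes S: "open S" "a \<in> S" and lin: "\<And>x. x \<in> S \<Longrightarrow> linear (L x)" and inj: "inj (L a)"
    and cont: "\<And>v. isCont (\<lambda>x. L x v) a"
  obtains c e where "c > 0" "(e \<longlongrightarrow> 0) (at a)"
    "\<forall>\<^sub>F x in at a. \<forall>v. c * norm v \<le> norm (L x v)"
    "\<forall>\<^sub>F x in at a. \<forall>v. norm (L x v - L a v) \<le> norm v * e x"
proof -
  obtain B where B: "B > 0" "\<And>v. B * norm v \<le> norm (L a v)"
    using linear_inj_bounded_below_pos[OF lin[OF S(2)] inj] by blast
  define e where "e x = (\<Sum>b\<in>Basis. norm (L x b - L a b))" for x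
  have "(e \<longlongrightarrow> (\<Sum>b\<in>Basis. norm (L a b - L a b))) (at a)"
    unfolding e_def using cont by (intro tendsto_intros) (simp add: isCont_def)
  then have e0: "(e \<longlongrightarrow> 0) (at a)" by simp
  have inS: "\<forall>\<^sub>F x in at a. x \<in> S" using S by (rule eventually_at_in_open')
  have eb: "norm (L x v - L a v) \<le> norm v * e x" if "x \<in> S" for x v
  proof -
    have "L x v - L a v = (\<Sum>b\<in>Basis. (v \<bullet> b) *\<^sub>R (L x b - L a b))"
      unfolding linear_expand[OF lin[OF that], of v] linear_expand[OF lin[OF S(2)], of v]
      by (simp add: sum_subtractf algebra_simps)
    also have "norm \<dots> \<le> (\<Sum>b\<in>Basis. norm v * norm (L x b - L a b))"
      by (intro sum_norm_le) (simp add: mult_right_mono Basis_le_norm)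
    finally show ?thesis by (simp add: e_def sum_distrib_left)
  qed
  have small: "\<forall>\<^sub>F x in at a. e x < B / 2"
    using order_tendstoD(2)[OF e0, of "B / 2"] B by simp
  show ?thesis
  proof (rule that)
    show "B / 2 > 0" using B by simp
    show "(e \<longlongrightarrow> 0) (at a)" by (rule e0)
    show "\<forall>\<^sub>F x in at a. \<forall>v. norm (L x v - L a v) \<le> norm v * e x"
      using inS by eventually_elim (use eb in auto)
    show "\<forall>\<^sub>F x in at a. \<forall>v. B / 2 * norm v \<le> norm (L x v)"
      using inS small
    proof eventually_elim
      case (elim x)
      show ?case
      proof
        fix v :: 'e
        have "norm v * e x \<le> norm v * (B / 2)" using elim by (intro mult_left_mono) auto
        moreover have "norm (L a v) \<le> norm (L x v) + norm (L x v - L a v)"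
          by (metis norm_minus_commute norm_triangle_sub)
        ultimately show "B / 2 * norm v \<le> norm (L x v)"
          using B(2)[of v] eb[OF elim(1), of v] by (simp add: algebra_simps)
      qed
    qed
  qed
qed

text \<open>In \<open>L x (z x - z a) = l x - L x (z a)\<close> the right-hand side tends to 0, and
  the uniform lower bound passes this on to \<open>z x - z a\<close>.\<close>

lemma linear_family_solution_continuous:
  fixes L :: "'v::real_normed_vector \<Rightarrow> 'e::euclidean_space \<Rightarrow> 'e"
  assumes S: "open S" "a \<in> S" and lin: "\<And>x. x \<in> S \<Longrightarrow> linear (L x)" and inj: "inj (L a)"
    and cont: "\<And>v. isCont (\<lambda>x. L x v) a" and l: "isCont l a"
    and eq: "\<And>x. x \<in> S \<Longrightarrow> L x (z x) = l x"
  shows "isCont z a"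
proof -
  obtain c where c: "c > 0" and bd: "\<forall>\<^sub>F x in at a. \<forall>v. c * norm v \<le> norm (L x v)"
    by (rule linear_family_bounded_below[OF S lin inj cont], assumption) (rule that)
  have inS: "\<forall>\<^sub>F x in at a. x \<in> S" using S by (rule eventually_at_in_open')
  have "\<forall>\<^sub>F x in at a. norm (z x - z a) \<le> norm (l x - L x (z a)) / c"
    using bd inS
  proof eventually_elim
    case (elim x)
    then have "c * norm (z x - z a) \<le> norm (L x (z x - z a))" by simp
    also have "L x (z x - z a) = l x - L x (z a)" using elim by (simp add: linear_diff[OF lin] eq)
    finally show ?case using c by (simp add: pos_le_divide_eq mult.commute)
  qed
  moreover have "((\<lambda>x. norm (l x - L x (z a)) / c) \<longlongrightarrow> norm (l a - L a (z a)) / c) (at a)"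
    using l cont[of "z a"] c by (intro tendsto_intros) (auto simp: isCont_def)
  moreover have "norm (l a - L a (z a)) / c = 0" using eq[OF S(2)] by simp
  ultimately have "((\<lambda>x. z x - z a) \<longlongrightarrow> 0) (at a)"
    by (metis Lim_null_comparison)
  then show ?thesis by (simp add: isCont_def LIM_zero_iff)
qed

text \<open>The increment \<open>z x - z a\<close> solves the equation with right-hand side
  \<open>h x = l x - L x (z a)\<close>, whose differentiability is known. Replacing
  \<open>L x\<close> by \<open>L a\<close> suggests the derivative \<open>D\<close>, the inverse of
  \<open>L a\<close> after the derivative of \<open>h\<close>; the replacement costs at most a
  multiple of \<open>e x * norm (x - a)\<close>, which is negligible.\<close>

lemma linear_family_solution_differentiable:
  fixes L :: "'v::real_normed_vector \<Rightarrow> 'e::euclidean_space \<Rightarrow> 'e"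
  assumes S: "open S" "a \<in> S" and lin: "\<And>x. x \<in> S \<Longrightarrow> linear (L x)" and inj: "inj (L a)"
    and dL: "\<And>v. (\<lambda>x. L x v) differentiable (at a)" and l: "l differentiable (at a)"
    and eq: "\<And>x. x \<in> S \<Longrightarrow> L x (z x) = l x"
  shows "z differentiable (at a)"
proof -
  have cont: "isCont (\<lambda>x. L x v) a" for v by (rule differentiable_imp_continuous_within[OF dL])
  obtain c e where c: "c > 0" and e: "(e \<longlongrightarrow> 0) (at a)"
    and bd: "\<forall>\<^sub>F x in at a. \<forall>v. c * norm v \<le> norm (L x v)"
    and ebd: "\<forall>\<^sub>F x in at a. \<forall>v. norm (L x v - L a v) \<le> norm v * e x"
    by (rule linear_family_bounded_below[OF S lin inj cont], assumption) (rule that)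
  have inS: "\<forall>\<^sub>F x in at a. x \<in> S" using S by (rule eventually_at_in_open')
  define h where "h x = l x - L x (z a)" for x
  have "h differentiable (at a)" unfolding h_def by (intro differentiable_diff l dL)
  then obtain H where H: "(h has_derivative H) (at a)" by (auto simp: differentiable_def)
  have h0: "h a = 0" using eq[OF S(2)] by (simp add: h_def)
  obtain K where K: "linear K" "\<And>v. L a (K v) = v"
    using linear_injective_isomorphism[OF lin[OF S(2)] inj] by metis
  define D where "D v = K (H v)" for v
  have bD: "bounded_linear D"
    unfolding D_def using bounded_linear_compose[of K H] K(1) H
    by (auto simp: linear_conv_bounded_linear comp_def intro: has_derivative_bounded_linear)
  have est: "\<forall>\<^sub>F x in at a. norm ((z x - z a) - D (x - a)) / norm (x - a)
      \<le> (norm ((h x - h a) - H (x - a)) / norm (x - a) + onorm D * \<bar>e x\<bar>) / c"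
    using bd ebd inS
  proof eventually_elim
    case (elim x)
    have "c * norm ((z x - z a) - D (x - a)) \<le> norm (L x ((z x - z a) - D (x - a)))" using elim by blast
    also have "L x ((z x - z a) - D (x - a)) = (h x - h a - H (x - a)) - (L x (D (x - a)) - L a (D (x - a)))"
      using elim by (simp add: linear_diff[OF lin] eq h_def eq[OF S(2)] D_def K(2))
    also have "norm \<dots> \<le> norm (h x - h a - H (x - a)) + norm (L x (D (x - a)) - L a (D (x - a)))"
      by (rule norm_triangle_ineq4)
    also have "norm (L x (D (x - a)) - L a (D (x - a))) \<le> norm (D (x - a)) * e x" using elim by blast
    also have "\<dots> \<le> (onorm D * norm (x - a)) * \<bar>e x\<bar>"
      using onorm[OF bD, of "x - a"] by (intro order_trans[OF mult_left_mono mult_right_mono]) auto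
    finally have *: "c * norm ((z x - z a) - D (x - a)) \<le>
      norm (h x - h a - H (x - a)) + onorm D * norm (x - a) * \<bar>e x\<bar>" by simp
    show ?case
    proof (cases "x = a")
      case True then show ?thesis using c by (simp add: onorm_pos_le[OF bD])
    next
      case False
      have "norm ((z x - z a) - D (x - a)) \<le>
          (norm (h x - h a - H (x - a)) + onorm D * norm (x - a) * \<bar>e x\<bar>) / c"
        using c * by (simp add: pos_le_divide_eq mult.commute)
      then have "norm ((z x - z a) - D (x - a)) / norm (x - a) \<le>
          (norm (h x - h a - H (x - a)) + onorm D * norm (x - a) * \<bar>e x\<bar>) / c / norm (x - a)"
        by (rule divide_right_mono) simp
      also have "\<dots> = (norm ((h x - h a) - H (x - a)) / norm (x - a) + onorm D * \<bar>e x\<bar>) / c"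
        using False by (simp add: add_divide_distrib)
      finally show ?thesis .
    qed
  qed
  have "((\<lambda>x. (norm ((h x - h a) - H (x - a)) / norm (x - a) + onorm D * \<bar>e x\<bar>) / c) \<longlongrightarrow> (0 + onorm D * \<bar>0\<bar>) / c) (at a)"
    using H e c by (intro tendsto_intros) (auto simp: has_derivative_iff_norm)
  then have lim: "((\<lambda>x. (norm ((h x - h a) - H (x - a)) / norm (x - a) + onorm D * \<bar>e x\<bar>) / c) \<longlongrightarrow> 0) (at a)"
    by simp
  have "((\<lambda>x. norm ((z x - z a) - D (x - a)) / norm (x - a)) \<longlongrightarrow> 0) (at a)"
    by (rule tendsto_sandwich[OF _ est tendsto_const lim]) simp
  then have "(z has_derivative D) (at a)" using bD by (simp add: has_derivative_iff_norm)
  then show ?thesis by (auto simp: differentiable_def)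
qed

text \<open>Differentiating \<open>L x (z x) = l x\<close> shows that a directional derivative of
  \<open>z\<close> solves a system with the same \<open>L\<close> and right-hand side
  \<open>l' - L'(z)\<close>. This is of class k as soon as \<open>z\<close> is, so an induction over
  all \<open>l\<close> and \<open>z\<close> climbs to every order.\<close>

lemma smooth_on_linear_solution:
  fixes L :: "'v::real_normed_vector \<Rightarrow> 'e::euclidean_space \<Rightarrow> 'e"
  assumes S: "open S" and lin: "\<And>x. x \<in> S \<Longrightarrow> linear (L x)" and inj: "\<And>x. x \<in> S \<Longrightarrow> inj (L x)"
    and sL: "\<And>v. smooth_on S (\<lambda>x. L x v)" and sl: "smooth_on S l"
    and eq: "\<And>x. x \<in> S \<Longrightarrow> L x (z x) = l x"
  shows "smooth_on S z"
proof -
  have d: "(\<lambda>x. L x v) differentiable (at x)" if "x \<in> S" for x v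
    using smooth_on_differentiable[OF sL that] .
  have "Ck_on k S z" if "Ck_on k S l" "\<And>x. x \<in> S \<Longrightarrow> L x (z x) = l x" for k z l
    using that
  proof (induction k arbitrary: z l)
    case 0
    show ?case
      unfolding Ck_on.simps
    proof (intro continuous_at_imp_continuous_on ballI)
      fix a assume a: "a \<in> S"
      show "isCont z a"
      proof (rule linear_family_solution_continuous[where L=L and l=l and z=z, OF S a lin inj[OF a] _ _ 0(2)])
        show "isCont (\<lambda>x. L x v) a" for v
          by (rule differentiable_imp_continuous_within[OF d[OF a]])
        show "isCont l a" using 0(1) S a by (simp add: continuous_on_eq_continuous_at)
      qed
    qed
  next
    case (Suc k)
    have dl: "l differentiable (at x)" if "x \<in> S" for x using Suc.prems(1) that by simp
    have dz: "z differentiable (at x)" if "x \<in> S" for x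
      by (rule linear_family_solution_differentiable[OF S that lin inj[OF that] d[OF that] dl[OF that] Suc.prems(2)])
    have z: "Ck_on k S z" using Suc.IH[OF Ck_on_Suc_imp[OF Suc.prems(1)] Suc.prems(2)] .
    have "Ck_on k S (\<lambda>x. fderiv z x v)" for v
    proof (rule Suc.IH)
      fix x assume x: "x \<in> S"
      have "fderiv (\<lambda>y. L y (z y)) x v = fderiv l x v"
        using fderiv_cong[OF S x, of "\<lambda>y. L y (z y)" l] Suc.prems(2) by auto
      then show "L x (fderiv z x v) = fderiv l x v + (-1) *\<^sub>R fderiv (\<lambda>y. L y (z x)) x v"
        using differentiable_apply(2)[OF S x lin d[OF x] dz[OF x], of v] by (simp add: algebra_simps)
    next
      have "Ck_on k S (\<lambda>x. fderiv (\<lambda>y. L y (z x)) x v)"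
      proof (rule Ck_on_apply[OF S _ _ z])
        show "linear (\<lambda>w. fderiv (\<lambda>y. L y w) x v)" if "x \<in> S" for x
          by (rule differentiable_apply(3)[OF S that lin d[OF that] dz[OF that]])
        show "Ck_on k S (\<lambda>x. fderiv (\<lambda>y. L y w) x v)" for w
          using smooth_on_fderiv[OF sL] by (simp add: smooth_on_def)
      qed
      then show "Ck_on k S (\<lambda>x. fderiv l x v + (-1) *\<^sub>R fderiv (\<lambda>y. L y (z x)) x v)"
        using Suc.prems(1) by (intro Ck_on_add[OF S] Ck_on_scaleR[OF S] Ck_on_const) auto
    qed
    then show ?case using dz by simp
  qed
  then show ?thesis using sl eq unfolding smooth_on_def by blast
qed

section \<open>Levi-Civita connection and curvature in a coordinate domain\<close>

locale riemannian_domain =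
  fixes S :: "'e::euclidean_space set" and g :: "'e \<Rightarrow> 'e \<Rightarrow> 'e \<Rightarrow> real"
  assumes open_S: "open S"
    and bilinear: "x \<in> S \<Longrightarrow> bilinear (g x)"
    and symmetric: "x \<in> S \<Longrightarrow> g x u v = g x v u"
    and positive: "x \<in> S \<Longrightarrow> v \<noteq> 0 \<Longrightarrow> g x v v > 0"
    and smooth: "smooth_on S (\<lambda>x. g x u v)"
begin

abbreviation \<Gamma> where "\<Gamma> \<equiv> christoffel g"

lemma lin: "x \<in> S \<Longrightarrow> linear (g x u)" "x \<in> S \<Longrightarrow> linear (\<lambda>u. g x u v)"
  using bilinear by (auto simp: bilinear_def)

lemma diff_g: "x \<in> S \<Longrightarrow> (\<lambda>x. g x u v) differentiable (at x)"
  using smooth_on_differentiable[OF smooth] .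

lemma nondegenerate:
  assumes "x \<in> S" "\<And>w. g x u w = g x v w" shows "u = v"
proof -
  have "g x (u - v) (u - v) = 0" using assms by (simp add: linear_diff[OF lin(2)])
  then show ?thesis using positive[OF assms(1), of "u - v"] by auto
qed

text \<open>The musical isomorphism "flat", with covectors identified with vectors by the Euclidean
  inner product; an equation between covectors thereby becomes a linear system in
  \<open>'e\<close>.\<close>

definition lower :: "'e \<Rightarrow> 'e \<Rightarrow> 'e"
  where "lower x z = (\<Sum>b\<in>Basis. g x z b *\<^sub>R b)"

lemma lower_inner: "x \<in> S \<Longrightarrow> lower x z \<bullet> w = g x z w"
  using linear_expand[OF lin(1), of x z w]
  by (simp add: lower_def inner_sum_left inner_commute[of w] mult.commute)

lemma lower_linear: "x \<in> S \<Longrightarrow> linear (lower x)"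
  unfolding lower_def
  by (intro linear_compose_sum ballI linearI)
    (auto simp: linear_add[OF lin(2)] linear_scale[OF lin(2)] scaleR_add_left)

lemma lower_inj: "x \<in> S \<Longrightarrow> inj (lower x)"
  using nondegenerate lower_inner by (metis injI)

text \<open>Gives meaning to the definite descriptions in \<open>christoffel\<close> and, later, in
  \<open>lift\<close>.\<close>

lemma riesz:
  assumes x: "x \<in> S" and l: "linear l"
  shows "\<exists>!z. \<forall>w. g x z w = l w"
proof -
  have "surj (lower x)" by (rule linear_injective_imp_surjective[OF lower_linear[OF x] lower_inj[OF x]]) simp
  then obtain z where z: "lower x z = (\<Sum>b\<in>Basis. l b *\<^sub>R b)" by (metis surjD)
  have "g x z w = l w" for w
    unfolding lower_inner[OF x, symmetric] z using linear_expand[OF l, of w]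
    by (simp add: inner_sum_left inner_commute[of w] mult.commute)
  then show ?thesis using nondegenerate[OF x] by metis
qed

lemma riesz_smooth:
  assumes l: "\<And>w. smooth_on S (\<lambda>x. l x w)" and z: "\<And>x w. x \<in> S \<Longrightarrow> g x (z x) w = l x w"
  shows "smooth_on S z"
proof (rule smooth_on_linear_solution[OF open_S, where L=lower])
  show "lower x (z x) = (\<Sum>b\<in>Basis. l x b *\<^sub>R b)" if "x \<in> S" for x
    using z[OF that] by (simp add: lower_def)
  show "smooth_on S (\<lambda>x. \<Sum>b\<in>Basis. l x b *\<^sub>R b)"
    by (intro smooth_on_sum[OF open_S] smooth_on_scaleR[OF open_S] l smooth_on_const)
  show "smooth_on S (\<lambda>x. lower x v)" for v unfolding lower_def
    by (intro smooth_on_sum[OF open_S] smooth_on_scaleR[OF open_S] smooth smooth_on_const)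
qed (simp_all add: lower_linear lower_inj)

lemma fderiv_g_linear:
  assumes "x \<in> S"
  shows "linear (fderiv (\<lambda>y. g y v w) x)" "linear (\<lambda>v. fderiv (\<lambda>y. g y v w) x u)"
    "linear (\<lambda>w. fderiv (\<lambda>y. g y v w) x u)"
  using fderiv_lin[OF diff_g[OF assms]]
    differentiable_apply(3)[OF open_S assms, of "\<lambda>y v. g y v w", OF lin(2) diff_g[OF assms] differentiable_ident]
    differentiable_apply(3)[OF open_S assms, of "\<lambda>y. g y v", OF lin(1) diff_g[OF assms] differentiable_ident]
  by auto

text \<open>The Christoffel symbols of the first kind.\<close>

definition koszul :: "'e \<Rightarrow> 'e \<Rightarrow> 'e \<Rightarrow> 'e \<Rightarrow> real" where
  "koszul x u v w =
    (fderiv (\<lambda>y. g y v w) x u + fderiv (\<lambda>y. g y u w) x v - fderiv (\<lambda>y. g y u v) x w) / 2"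

lemma koszul_linear:
  assumes "x \<in> S"
  shows "linear (koszul x u v)" "linear (\<lambda>v. koszul x u v w)" "linear (\<lambda>u. koszul x u v w)"
proof -
  note d = fderiv_g_linear[OF assms]
  show "linear (koszul x u v)" "linear (\<lambda>v. koszul x u v w)" "linear (\<lambda>u. koszul x u v w)"
    unfolding koszul_def
    by (auto intro!: linearI simp: linear_add[OF d(1)] linear_add[OF d(2)] linear_add[OF d(3)]
        linear_scale[OF d(1)] linear_scale[OF d(2)] linear_scale[OF d(3)] field_simps)
qed

lemma christoffel_koszul: "x \<in> S \<Longrightarrow> g x (\<Gamma> x u v) w = koszul x u v w"
proof -
  assume x: "x \<in> S"
  have "\<Gamma> x u v = (THE z. \<forall>w. g x z w = koszul x u v w)"
    unfolding christoffel_def koszul_def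
    by (rule arg_cong[of _ _ The]) (simp add: eq_divide_eq mult.commute)
  then show ?thesis using theI'[OF riesz[OF x koszul_linear(1)[OF x]]] by simp
qed

lemma christoffel_sym: "x \<in> S \<Longrightarrow> \<Gamma> x u v = \<Gamma> x v u"
proof -
  assume x: "x \<in> S"
  have "fderiv (\<lambda>y. g y u v) x = fderiv (\<lambda>y. g y v u) x"
    by (rule fderiv_cong[OF open_S x]) (rule symmetric)
  then show ?thesis
    by (intro nondegenerate[OF x]) (simp add: christoffel_koszul[OF x], simp add: koszul_def)
qed

lemma christoffel_linear:
  assumes "x \<in> S" shows "linear (\<Gamma> x u)" "linear (\<lambda>u. \<Gamma> x u v)"
proof -
  note k = koszul_linear[OF assms] and l = lin(2)[OF assms]
  show "linear (\<Gamma> x u)" "linear (\<lambda>u. \<Gamma> x u v)"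
    by (auto intro!: linearI nondegenerate[OF assms] simp: christoffel_koszul[OF assms]
      linear_add[OF l] linear_scale[OF l] linear_add[OF k(2)] linear_add[OF k(3)]
      linear_scale[OF k(2)] linear_scale[OF k(3)])
qed

lemma christoffel_bilinear: "x \<in> S \<Longrightarrow> bilinear (\<Gamma> x)"
  by (simp add: bilinear_def christoffel_linear)

lemma christoffel_smooth: "smooth_on S (\<lambda>x. \<Gamma> x u v)"
proof (rule riesz_smooth)
  show "g x (\<Gamma> x u v) w = koszul x u v w" if "x \<in> S" for x w by (rule christoffel_koszul[OF that])
  have "smooth_on S (\<lambda>x. (1/2) * (fderiv (\<lambda>y. g y v w) x u + fderiv (\<lambda>y. g y u w) x v - fderiv (\<lambda>y. g y u v) x w))" for w
    by (intro smooth_on_cmult[OF open_S] smooth_on_diff[OF open_S] smooth_on_add[OF open_S] smooth_on_fderiv smooth)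
  then show "smooth_on S (\<lambda>x. koszul x u v w)" for w by (simp add: koszul_def)
qed

lemma christoffel_diff: "x \<in> S \<Longrightarrow> (\<lambda>x. \<Gamma> x u v) differentiable (at x)"
  using smooth_on_differentiable[OF christoffel_smooth] .

text \<open>Metric compatibility of the connection: in the sum of the Koszul expressions for (u,v,w)
  and (u,w,v) only the derivative along \<open>u\<close> is left.\<close>

lemma christoffel_metric:
  assumes x: "x \<in> S"
  shows "fderiv (\<lambda>y. g y v w) x u = g x (\<Gamma> x u v) w + g x v (\<Gamma> x u w)"
proof -
  have s: "fderiv (\<lambda>y. g y a b) x c = fderiv (\<lambda>y. g y b a) x c" for a b c
    by (rule fun_cong[OF fderiv_cong[OF open_S x]]) (rule symmetric)
  show ?thesis
    unfolding symmetric[OF x, of v] christoffel_koszul[OF x] koszul_def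
    using s[of u v w] s[of u w v] s[of v w u] by (simp add: field_simps)
qed

lemma g_apply:
  assumes x: "x \<in> S" and "X differentiable (at x)" "Y differentiable (at x)"
  shows "(\<lambda>y. g y (X y) (Y y)) differentiable (at x)"
   "fderiv (\<lambda>y. g y (X y) (Y y)) x v =
      fderiv (\<lambda>y. g y (X x) (Y x)) x v + g x (fderiv X x v) (Y x) + g x (X x) (fderiv Y x v)"
  using bilinear_apply[OF open_S x, of g, OF bilinear diff_g[OF x] assms(2,3)] by auto

text \<open>Needed for fields that do not commute, such as the lifted ones. The derivatives of the
  fields that the product rule creates combine into the bracket terms.\<close>

lemma koszul_formula:
  assumes x: "x \<in> S" and X: "X differentiable (at x)" and Y: "Y differentiable (at x)" and Z: "Z differentiable (at x)"
  shows "2 * g x (levi_civita g X Y x) (Z x) =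
      fderiv (\<lambda>y. g y (Y y) (Z y)) x (X x) + fderiv (\<lambda>y. g y (X y) (Z y)) x (Y x)
    - fderiv (\<lambda>y. g y (X y) (Y y)) x (Z x) + g x (lie_bracket X Y x) (Z x)
    - g x (lie_bracket X Z x) (Y x) - g x (lie_bracket Y Z x) (X x)"
  unfolding g_apply(2)[OF x Y Z] g_apply(2)[OF x X Z] g_apply(2)[OF x X Y] levi_civita_def lie_bracket_def
  by (simp add: linear_add[OF lin(2)[OF x]] linear_diff[OF lin(2)[OF x]] christoffel_koszul[OF x] koszul_def
     symmetric[OF x, of "X x"] symmetric[OF x, of "Y x"] field_simps)

lemma lc_add:
  assumes "x \<in> S" "Y differentiable (at x)" "Z differentiable (at x)"
  shows "levi_civita g X (\<lambda>y. Y y + Z y) x = levi_civita g X Y x + levi_civita g X Z x"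
  using assms by (simp add: levi_civita_def fderiv_add linear_add[OF christoffel_linear(1)])

lemma lc_scale:
  assumes "x \<in> S" "h differentiable (at x)" "Y differentiable (at x)"
  shows "levi_civita g X (\<lambda>y. h y *\<^sub>R Y y) x = fderiv h x (X x) *\<^sub>R Y x + h x *\<^sub>R levi_civita g X Y x"
  using assms by (simp add: levi_civita_def fderiv_scaleR linear_scale[OF christoffel_linear(1)] algebra_simps)

lemma lc_cong:
  assumes "x \<in> S" "X x = X' x" "\<And>y. y \<in> S \<Longrightarrow> Y y = Y' y"
  shows "levi_civita g X Y x = levi_civita g X' Y' x"
  using assms fderiv_cong[OF open_S assms(1), of Y Y'] by (simp add: levi_civita_def)

definition curv :: "'e \<Rightarrow> 'e \<Rightarrow> 'e \<Rightarrow> 'e \<Rightarrow> 'e" where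
  "curv x u v w = fderiv (\<lambda>y. \<Gamma> y v w) x u - fderiv (\<lambda>y. \<Gamma> y u w) x v
     + \<Gamma> x u (\<Gamma> x v w) - \<Gamma> x v (\<Gamma> x u w)"

lemma riemann_const: "x \<in> S \<Longrightarrow> riemann g (\<lambda>_. u) (\<lambda>_. v) (\<lambda>_. w) x = curv x u v w"
  by (simp add: riemann_def levi_civita_def[abs_def] lie_bracket_def curv_def linear_0[OF christoffel_linear(2)])

text \<open>Derivatives of \<open>X\<close> and \<open>Y\<close> are absorbed by the bracket term
  and second derivatives of \<open>Z\<close> cancel by symmetry. This transfers
  \<open>ricci\<close>, defined on constant fields, to a frame adapted to the submersion.\<close>

lemma riemann_tensorial:
  assumes x: "x \<in> S" and X: "X differentiable (at x)" and Y: "Y differentiable (at x)" and Z: "smooth_on S Z"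
  shows "riemann g X Y Z x = curv x (X x) (Y x) (Z x)"
proof -
  have dZ: "Z differentiable (at x)" "(\<lambda>y. fderiv Z y v) differentiable (at x)" for v
    by (rule smooth_on_differentiable[OF _ x] smooth_on_fderiv Z)+
  have lZ: "linear (fderiv Z y)" if "y \<in> S" for y
    by (rule fderiv_lin[OF smooth_on_differentiable[OF Z that]])
  note c = christoffel_linear[OF x]
  have A: "levi_civita g X (levi_civita g Y Z) x =
      fderiv (\<lambda>y. fderiv Z y (Y x)) x (X x) + fderiv Z x (fderiv Y x (X x))
     + fderiv (\<lambda>y. \<Gamma> y (Y x) (Z x)) x (X x) + \<Gamma> x (fderiv Y x (X x)) (Z x) + \<Gamma> x (Y x) (fderiv Z x (X x))
     + \<Gamma> x (X x) (fderiv Z x (Y x)) + \<Gamma> x (X x) (\<Gamma> x (Y x) (Z x))"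
    if Y: "Y differentiable (at x)" for X Y
  proof -
    note a = differentiable_apply[OF open_S x, of "fderiv Z", OF lZ dZ(2) Y]
    note b = bilinear_apply[OF open_S x, of \<Gamma>, OF christoffel_bilinear christoffel_diff[OF x] Y dZ(1)]
    show ?thesis
      by (simp add: levi_civita_def[of g X] levi_civita_def[of g Y, abs_def] fderiv_add a(1,2) b linear_add[OF c(1)])
  qed
  have s: "fderiv (\<lambda>y. fderiv Z y (Y x)) x (X x) = fderiv (\<lambda>y. fderiv Z y (X x)) x (Y x)"
    by (rule fderiv_symmetric[OF open_S x Z])
  show ?thesis
    unfolding riemann_def A[OF Y] A[OF X] s curv_def
    by (simp add: levi_civita_def lie_bracket_def linear_diff[OF c(2)] linear_diff[OF lZ[OF x]])
qed

lemma curv_linear: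
  assumes x: "x \<in> S"
  shows "linear (\<lambda>u. curv x u v w)" "linear (\<lambda>v. curv x u v w)" "linear (\<lambda>w. curv x u v w)"
proof -
  note c = christoffel_linear[OF x]
  have d: "linear (fderiv (\<lambda>y. \<Gamma> y v w) x)" "linear (\<lambda>v. fderiv (\<lambda>y. \<Gamma> y v w) x u)"
    "linear (\<lambda>w. fderiv (\<lambda>y. \<Gamma> y v w) x u)" for u v w
    using fderiv_lin[OF christoffel_diff[OF x]]
      differentiable_apply(3)[OF open_S x, of "\<lambda>y v. \<Gamma> y v w", OF christoffel_linear(2) christoffel_diff[OF x] differentiable_ident]
      differentiable_apply(3)[OF open_S x, of "\<lambda>y. \<Gamma> y v", OF christoffel_linear(1) christoffel_diff[OF x] differentiable_ident]
    by auto
  show "linear (\<lambda>u. curv x u v w)" "linear (\<lambda>v. curv x u v w)" "linear (\<lambda>w. curv x u v w)"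
    unfolding curv_def
    by (auto intro!: linearI simp: linear_add[OF c(1)] linear_add[OF c(2)] linear_scale[OF c(1)] linear_scale[OF c(2)]
        linear_add[OF d(1)] linear_add[OF d(2)] linear_add[OF d(3)]
        linear_scale[OF d(1)] linear_scale[OF d(2)] linear_scale[OF d(3)] algebra_simps)
qed

lemma ricci_curv: "x \<in> S \<Longrightarrow> ricci g x u v = (\<Sum>b\<in>Basis. curv x b u v \<bullet> b)"
  by (simp add: ricci_def riemann_const)

end

section \<open>Tensoriality\<close>

text \<open>The derivatives of \<open>X\<close> and \<open>Y\<close> cancel against the bracket.
  Together with the next results, this allows the conditions on an S-manifold to be used, and those
  on a Kaehler manifold to be checked, on constant fields.\<close>

lemma d_one_form_tensorial:
  fixes X Y :: "'e::euclidean_space \<Rightarrow> 'e"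
  assumes S: "open S" "x \<in> S" and l: "\<And>y. y \<in> S \<Longrightarrow> linear (\<eta> y)"
    and d: "\<And>v. (\<lambda>y. \<eta> y v) differentiable (at x)"
    and X: "X differentiable (at x)" and Y: "Y differentiable (at x)"
  shows "d_one_form \<eta> X Y x = fderiv (\<lambda>y. \<eta> y (Y x)) x (X x) - fderiv (\<lambda>y. \<eta> y (X x)) x (Y x)"
  using differentiable_apply(2)[OF S, of \<eta>, OF l d X] differentiable_apply(2)[OF S, of \<eta>, OF l d Y]
  by (simp add: d_one_form_def lie_bracket_def linear_diff[OF l[OF S(2)]])

lemma d_two_form_tensorial:
  fixes X Y :: "'e::euclidean_space \<Rightarrow> 'e"
  assumes S: "open S" "x \<in> S" and l: "\<And>y. y \<in> S \<Longrightarrow> bilinear (\<omega> y)"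
    and sk: "\<And>u v. \<omega> x u v = - \<omega> x v u"
    and d: "\<And>u v. (\<lambda>y. \<omega> y u v) differentiable (at x)"
    and X: "X differentiable (at x)" and Y: "Y differentiable (at x)" and Z: "Z differentiable (at x)"
  shows "d_two_form \<omega> X Y Z x = fderiv (\<lambda>y. \<omega> y (Y x) (Z x)) x (X x)
     + fderiv (\<lambda>y. \<omega> y (Z x) (X x)) x (Y x) + fderiv (\<lambda>y. \<omega> y (X x) (Y x)) x (Z x)"
proof -
  have l2: "linear (\<lambda>u. \<omega> x u v)" for v using l[OF S(2)] by (simp add: bilinear_def)
  have b: "fderiv (\<lambda>y. \<omega> y (P y) (Q y)) x v =
      fderiv (\<lambda>y. \<omega> y (P x) (Q x)) x v + \<omega> x (fderiv P x v) (Q x) + \<omega> x (P x) (fderiv Q x v)"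
    if "P differentiable (at x)" "Q differentiable (at x)" for P Q v
    using that by (intro bilinear_apply(2)[OF S] l d)
  show ?thesis
    unfolding d_two_form_def lie_bracket_def b[OF Y Z] b[OF Z X] b[OF X Y] linear_diff[OF l2]
    using sk[of "Y x" "fderiv Z x (X x)"] sk[of "Z x" "fderiv X x (Y x)"] sk[of "X x" "fderiv Y x (Z x)"]
    by simp
qed

text \<open>The Nijenhuis tensor on coordinate-constant fields, whose bracket vanishes.\<close>

definition nijenhuis_at :: "('e::real_normed_vector \<Rightarrow> 'e \<Rightarrow> 'e) \<Rightarrow> 'e \<Rightarrow> 'e \<Rightarrow> 'e \<Rightarrow> 'e" where
  "nijenhuis_at \<phi> x u v = fderiv (\<lambda>y. \<phi> y v) x (\<phi> x u) - fderiv (\<lambda>y. \<phi> y u) x (\<phi> x v)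
     - \<phi> x (fderiv (\<lambda>y. \<phi> y v) x u) + \<phi> x (fderiv (\<lambda>y. \<phi> y u) x v)"

lemma nijenhuis_tensorial:
  fixes X Y :: "'e::euclidean_space \<Rightarrow> 'e"
  assumes S: "open S" "x \<in> S" and l: "\<And>y. y \<in> S \<Longrightarrow> linear (\<phi> y)"
    and d: "\<And>v. (\<lambda>y. \<phi> y v) differentiable (at x)"
    and X: "X differentiable (at x)" and Y: "Y differentiable (at x)"
  shows "nijenhuis \<phi> X Y x = nijenhuis_at \<phi> x (X x) (Y x)"
  using differentiable_apply(2)[OF S, of \<phi>, OF l d X] differentiable_apply(2)[OF S, of \<phi>, OF l d Y]
  by (simp add: nijenhuis_def nijenhuis_at_def lie_bracket_def linear_diff[OF l[OF S(2)]] linear_add[OF l[OF S(2)]])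

text \<open>Inserting the expansion of each \<open>b\<close> and exchanging sums expresses the trace
  by frame and coframe. Two families occur because the frame upstairs has a horizontal part indexed
  by the basis of the base and a vertical part indexed by numbers.\<close>

lemma trace_two_frames:
  fixes L :: "'e::euclidean_space \<Rightarrow> 'e" and e1 :: "'i \<Rightarrow> 'e" and e2 :: "'j \<Rightarrow> 'e"
  assumes L: "linear L" and I: "\<And>i. i \<in> I \<Longrightarrow> linear (\<theta>1 i)" and J: "\<And>j. j \<in> J \<Longrightarrow> linear (\<theta>2 j)"
    and frame: "\<And>w. w = (\<Sum>i\<in>I. \<theta>1 i w *\<^sub>R e1 i) + (\<Sum>j\<in>J. \<theta>2 j w *\<^sub>R e2 j)"
  shows "(\<Sum>b\<in>Basis. L b \<bullet> b) = (\<Sum>i\<in>I. \<theta>1 i (L (e1 i))) + (\<Sum>j\<in>J. \<theta>2 j (L (e2 j)))"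
proof -
  have half: "(\<Sum>b\<in>Basis. (\<Sum>i\<in>I. \<theta> i b *\<^sub>R L (e i)) \<bullet> b) = (\<Sum>i\<in>I. \<theta> i (L (e i)))"
    if "\<And>i. i \<in> I \<Longrightarrow> linear (\<theta> i)" for I :: "'k set" and \<theta> :: "'k \<Rightarrow> 'e \<Rightarrow> real" and e :: "'k \<Rightarrow> 'e"
  proof -
    have "(\<Sum>b\<in>Basis. (\<Sum>i\<in>I. \<theta> i b *\<^sub>R L (e i)) \<bullet> b) = (\<Sum>i\<in>I. \<Sum>b\<in>Basis. \<theta> i b * (L (e i) \<bullet> b))"
      by (simp add: inner_sum_left) (rule sum.swap)
    also have "\<dots> = (\<Sum>i\<in>I. \<theta> i (L (e i)))"
      by (rule sum.cong[OF refl]) (simp add: linear_expand[OF that, of _ "L (e _)"] mult.commute)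
    finally show ?thesis .
  qed
  have "L b = (\<Sum>i\<in>I. \<theta>1 i b *\<^sub>R L (e1 i)) + (\<Sum>j\<in>J. \<theta>2 j b *\<^sub>R L (e2 j))" for b
    using arg_cong[OF frame[of b], of L] by (simp add: linear_add[OF L] linear_sum[OF L] linear_scale[OF L])
  then have "(\<Sum>b\<in>Basis. L b \<bullet> b) =
     (\<Sum>b\<in>Basis. ((\<Sum>i\<in>I. \<theta>1 i b *\<^sub>R L (e1 i)) + (\<Sum>j\<in>J. \<theta>2 j b *\<^sub>R L (e2 j))) \<bullet> b)"
    by (intro sum.cong refl arg_cong2[of _ _ _ _ inner])
  also have "\<dots> = (\<Sum>i\<in>I. \<theta>1 i (L (e1 i))) + (\<Sum>j\<in>J. \<theta>2 j (L (e2 j)))"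
    by (simp add: inner_add_left sum.distrib half[OF I] half[OF J])
  finally show ?thesis .
qed

section \<open>The complex structure of a Kaehler manifold is parallel\<close>

locale hermitian_domain = riemannian_domain S g
  for S :: "'e::euclidean_space set" and g +
  fixes J :: "'e \<Rightarrow> 'e \<Rightarrow> 'e"
  assumes J_linear: "x \<in> S \<Longrightarrow> linear (J x)"
    and J_smooth: "smooth_on S (\<lambda>x. J x v)"
    and J_J: "x \<in> S \<Longrightarrow> J x (J x v) = - v"
    and g_J_J: "x \<in> S \<Longrightarrow> g x (J x u) (J x v) = g x u v"
begin

lemma J_diff: "x \<in> S \<Longrightarrow> (\<lambda>x. J x v) differentiable (at x)"
  using smooth_on_differentiable[OF J_smooth] .

lemma g_J_left: "x \<in> S \<Longrightarrow> g x (J x u) v = - g x u (J x v)"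
  using g_J_J[of x u "J x v"] by (simp add: J_J linear_neg[OF lin(1)])

text \<open>The covariant derivative of the tensor \<open>J\<close> along \<open>u\<close>, applied
  to \<open>v\<close>.\<close>

definition nabla_J :: "'e \<Rightarrow> 'e \<Rightarrow> 'e \<Rightarrow> 'e" where
  "nabla_J x u v = fderiv (\<lambda>y. J y v) x u + \<Gamma> x u (J x v) - J x (\<Gamma> x u v)"

definition d\<Omega> :: "'e \<Rightarrow> 'e \<Rightarrow> 'e \<Rightarrow> 'e \<Rightarrow> real" where
  "d\<Omega> x a b c = fderiv (\<lambda>y. g y b (J y c)) x a + fderiv (\<lambda>y. g y c (J y a)) x b
      + fderiv (\<lambda>y. g y a (J y b)) x c"

text \<open>Splits off the Christoffel terms, which cancel in the cyclic sum
  \<open>d\<Omega>\<close> because \<open>\<Gamma>\<close> is symmetric; only the covariant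
  derivative of \<open>J\<close> remains there.\<close>

lemma fderiv_\<Omega>:
  assumes x: "x \<in> S"
  shows "fderiv (\<lambda>y. g y b (J y c)) x a = g x (\<Gamma> x a b) (J x c) - g x (\<Gamma> x a c) (J x b) + g x (nabla_J x a c) b"
proof -
  have "fderiv (\<lambda>y. g y b (J y c)) x a = g x (\<Gamma> x a b) (J x c) + g x b (\<Gamma> x a (J x c)) + g x b (fderiv (\<lambda>y. J y c) x a)"
    using g_apply(2)[OF x, of "\<lambda>_. b" "\<lambda>y. J y c" a] J_diff[OF x]
    by (simp add: christoffel_metric[OF x] linear_0[OF lin(2)[OF x]])
  then show ?thesis
    by (simp add: nabla_J_def symmetric[OF x, of b] linear_add[OF lin(2)[OF x]] linear_diff[OF lin(2)[OF x]] g_J_left[OF x])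
qed

text \<open>The derivative of the skew-symmetry of the Kaehler form.\<close>

lemma nabla_J_skew:
  assumes x: "x \<in> S"
  shows "g x (nabla_J x a b) c = - g x (nabla_J x a c) b"
proof -
  have "fderiv (\<lambda>y. g y b (J y c)) x a = fderiv (\<lambda>y. - g y c (J y b)) x a"
    by (rule fun_cong[OF fderiv_cong[OF open_S x]]) (metis g_J_left symmetric)
  also have "\<dots> = - fderiv (\<lambda>y. g y c (J y b)) x a"
    using g_apply(1)[OF x, of "\<lambda>_. c" "\<lambda>y. J y b"] J_diff[OF x] by (intro fderiv_minus) auto
  finally show ?thesis unfolding fderiv_\<Omega>[OF x] by simp
qed

text \<open>The derivative of \<open>J^2 = -1\<close>.\<close>

lemma nabla_J_anticommute:
  assumes x: "x \<in> S"
  shows "nabla_J x a (J x b) = - J x (nabla_J x a b)"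
proof -
  have "fderiv (\<lambda>y. J y (J y b)) x a = fderiv (\<lambda>y. - b) x a"
    by (rule fun_cong[OF fderiv_cong[OF open_S x]]) (rule J_J)
  then have "fderiv (\<lambda>y. J y (J x b)) x a + J x (fderiv (\<lambda>y. J y b) x a) = 0"
    using differentiable_apply(2)[OF open_S x, of J, OF J_linear J_diff[OF x] J_diff[OF x]] by simp
  then have "fderiv (\<lambda>y. J y (J x b)) x a = - J x (fderiv (\<lambda>y. J y b) x a)" by (simp add: eq_neg_iff_add_eq_0)
  then show ?thesis
    by (simp add: nabla_J_def J_J[OF x] linear_add[OF J_linear[OF x]] linear_diff[OF J_linear[OF x]]
        linear_neg[OF christoffel_linear(1)[OF x]])
qed

text \<open>As the connection is torsion-free, covariant derivatives may replace the partial ones in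
  the Nijenhuis tensor.\<close>

lemma nijenhuis_nabla_J:
  assumes x: "x \<in> S"
  shows "nijenhuis_at J x a b =
    nabla_J x (J x a) b - nabla_J x (J x b) a - J x (nabla_J x a b) + J x (nabla_J x b a)"
  unfolding nabla_J_def nijenhuis_at_def
  by (simp add: J_J[OF x] linear_add[OF J_linear[OF x]] linear_diff[OF J_linear[OF x]]
      christoffel_sym[OF x, of b] christoffel_sym[OF x, of "J x b"])

text \<open>With \<open>T(a,b,c) = g((\<nabla>\<^sub>aJ)b,c)\<close>, subtracting \<open>d\<Omega>(a,Jb,Jc)\<close> from \<open>d\<Omega>(a,b,c)\<close> gives \<open>2T(a,b,c)\<close> up to
  a term in the Nijenhuis tensor.\<close>

lemma nabla_J_zero:
  assumes x: "x \<in> S" and N: "\<And>a b. nijenhuis_at J x a b = 0" and d: "\<And>a b c. d\<Omega> x a b c = 0"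
  shows "nabla_J x a b = 0"
proof (rule nondegenerate[OF x])
  fix c
  define T where "T a b c = g x (nabla_J x a b) c" for a b c
  have skew: "T a b c = - T a c b" for a b c unfolding T_def by (rule nabla_J_skew[OF x])
  have J2: "T a (J x b) c = T a b (J x c)" for a b c
    unfolding T_def nabla_J_anticommute[OF x] using g_J_left[OF x] by (simp add: linear_neg[OF lin(2)[OF x]])
  have "g x (nijenhuis_at J x a b) c = T (J x a) b c - T (J x b) a c + T a b (J x c) - T b a (J x c)" for a b c
    unfolding nijenhuis_nabla_J[OF x] T_def
    by (simp add: linear_add[OF lin(2)[OF x]] linear_diff[OF lin(2)[OF x]] g_J_left[OF x])
  then have N': "T (J x a) b c - T (J x b) a c + T a b (J x c) - T b a (J x c) = 0" for a b c
    using N by (simp add: linear_0[OF lin(2)[OF x]])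
  have cyc: "T a b c + T b c a + T c a b = 0" for a b c
    using d[of a b c] skew[of a b c] skew[of b c a] skew[of c a b]
    unfolding d\<Omega>_def fderiv_\<Omega>[OF x] T_def[symmetric]
      christoffel_sym[OF x, of b a] christoffel_sym[OF x, of c a] christoffel_sym[OF x, of c b]
    by linarith
  have neg: "T a b (- c) = - T a b c" for a b c by (simp add: T_def linear_neg[OF lin(1)[OF x]])
  have "T a (J x b) (J x c) = - T a b c" by (simp add: J2 J_J[OF x] neg)
  moreover have "T (J x b) (J x c) a = T (J x b) c (J x a)" by (rule J2)
  moreover have "T (J x c) a (J x b) = - T (J x c) b (J x a)"
    using skew[of "J x c" a "J x b"] J2[of "J x c" b a] by simp
  moreover have "T b c (J x (J x a)) = - T b c a" "T c b (J x (J x a)) = - T c b a" by (simp_all add: J_J[OF x] neg)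
  ultimately have "T a b c = 0"
    using cyc[of a b c] cyc[of a "J x b" "J x c"] N'[of b c "J x a"] skew[of c a b] by linarith
  then show "g x (nabla_J x a b) c = g x 0 c" by (simp add: T_def linear_0[OF lin(2)[OF x]])
qed

text \<open>The metric adjoint of \<open>J\<close> is \<open>-J\<close>, and adjoint maps have the
  same trace. The result removes the term with \<open>g a (J b)\<close> times the trace of
  \<open>J\<close> from the Ricci contraction.\<close>

lemma trace_J: assumes x: "x \<in> S" shows "(\<Sum>e\<in>Basis. J x e \<bullet> e) = 0"
proof -
  obtain K where K: "linear K" "\<And>v. lower x (K v) = v" "\<And>v. K (lower x v) = v"
    using linear_injective_isomorphism[OF lower_linear[OF x] lower_inj[OF x]] by metis
  \<comment> \<open>The trace is taken in the frame \<open>K e\<close>, whose coframe is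
    \<open>lower x _ \<bullet> e\<close>; the second family is an empty placeholder.\<close>
  have "(\<Sum>e\<in>Basis. J x e \<bullet> e) = (\<Sum>e\<in>Basis. lower x (J x (K e)) \<bullet> e) + (\<Sum>e\<in>({}::unit set). 0)"
  proof (rule trace_two_frames[where ?\<theta>2.0="\<lambda>_ _. 0" and ?e2.0="\<lambda>_. 0", OF J_linear[OF x]])
    show "linear (\<lambda>w. lower x w \<bullet> i)" for i
      by (rule linear_compose[OF lower_linear[OF x], unfolded comp_def]) (intro bounded_linear.linear bounded_linear_inner_left)
    show "w = (\<Sum>e\<in>Basis. (lower x w \<bullet> e) *\<^sub>R K e) + (\<Sum>j\<in>({}::unit set). 0 *\<^sub>R 0)" for w
      using linear_expand[OF K(1), of "lower x w"] K(3) by simp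
  qed auto
  also have "\<dots> = (\<Sum>e\<in>Basis. g x (J x (K e)) e)" by (simp add: lower_inner[OF x])
  also have "\<dots> = (\<Sum>e\<in>Basis. - (lower x (K e) \<bullet> J x e))"
    by (simp only: g_J_left[OF x] lower_inner[OF x])
  also have "\<dots> = - (\<Sum>e\<in>Basis. J x e \<bullet> e)" by (simp only: K(2) sum_negf inner_commute)
  finally show ?thesis by simp
qed

end

section \<open>The canonical submersion in coordinates\<close>

text \<open>The situation in one chart of the total space and one of the base, with \<open>f\<close>
  the leaf projection in coordinates. The differential conditions are stated on constant fields, and
  in the normality condition each \<open>d\<eta>_i\<close> is already replaced by 2F. Of
  \<open>J\<close> only linearity, smoothness and its relation to \<open>\<phi>\<close> are assumed;
  its Kaehler properties are consequences.\<close>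

locale f_submersion = M: riemannian_domain V g + N: riemannian_domain W g'
  for V :: "'e::euclidean_space set" and g and W :: "'f::euclidean_space set" and g' +
  fixes f :: "'e \<Rightarrow> 'f" and \<phi> :: "'e \<Rightarrow> 'e \<Rightarrow> 'e" and \<xi> :: "nat \<Rightarrow> 'e \<Rightarrow> 'e"
    and \<eta> :: "nat \<Rightarrow> 'e \<Rightarrow> 'e \<Rightarrow> real" and J :: "'f \<Rightarrow> 'f \<Rightarrow> 'f" and n s :: nat
  assumes f_maps: "x \<in> V \<Longrightarrow> f x \<in> W"
    and f_smooth: "smooth_on V f"
    and dim_base: "DIM('f) = 2 * n"
    and s_pos: "s \<ge> 1"
    and \<phi>_linear: "x \<in> V \<Longrightarrow> linear (\<phi> x)"
    and \<phi>_smooth: "smooth_on V (\<lambda>x. \<phi> x v)"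
    and base_J_linear: "y \<in> W \<Longrightarrow> linear (J y)"
    and base_J_smooth: "smooth_on W (\<lambda>y. J y a)"
    and \<xi>_smooth: "i < s \<Longrightarrow> smooth_on V (\<xi> i)"
    and \<eta>_linear: "i < s \<Longrightarrow> x \<in> V \<Longrightarrow> linear (\<eta> i x)"
    and \<eta>_smooth: "i < s \<Longrightarrow> smooth_on V (\<lambda>x. \<eta> i x v)"
    and \<eta>_\<xi>: "x \<in> V \<Longrightarrow> i < s \<Longrightarrow> j < s \<Longrightarrow> \<eta> i x (\<xi> j x) = (if i = j then 1 else 0)"
    and \<eta>_\<phi>: "x \<in> V \<Longrightarrow> i < s \<Longrightarrow> \<eta> i x (\<phi> x v) = 0"
    and \<phi>_\<xi>: "x \<in> V \<Longrightarrow> i < s \<Longrightarrow> \<phi> x (\<xi> i x) = 0"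
    and \<phi>_\<phi>: "x \<in> V \<Longrightarrow> \<phi> x (\<phi> x v) = - v + (\<Sum>i<s. \<eta> i x v *\<^sub>R \<xi> i x)"
    and g_\<phi>_\<phi>: "x \<in> V \<Longrightarrow> g x (\<phi> x u) (\<phi> x v) = g x u v - (\<Sum>i<s. \<eta> i x u * \<eta> i x v)"
    and contact: "x \<in> V \<Longrightarrow> i < s \<Longrightarrow>
      2 * g x u (\<phi> x v) = fderiv (\<lambda>y. \<eta> i y v) x u - fderiv (\<lambda>y. \<eta> i y u) x v"
    and normal: "x \<in> V \<Longrightarrow> nijenhuis_at \<phi> x u v + (\<Sum>i<s. (2 * g x u (\<phi> x v)) *\<^sub>R \<xi> i x) = 0"
    and submersion: "x \<in> V \<Longrightarrow> surj (fderiv f x)"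
    and vertical: "x \<in> V \<Longrightarrow> fderiv f x v = 0 \<longleftrightarrow> \<phi> x v = 0"
    and isometry: "x \<in> V \<Longrightarrow> g' (f x) (fderiv f x (\<phi> x u)) (fderiv f x (\<phi> x v)) = g x (\<phi> x u) (\<phi> x v)"
    and projectable: "x \<in> V \<Longrightarrow> J (f x) (fderiv f x (\<phi> x v)) = fderiv f x (\<phi> x (\<phi> x v))"
begin

lemma f_diff: "x \<in> V \<Longrightarrow> f differentiable (at x)"
  using smooth_on_differentiable[OF f_smooth] .

lemma f_diff2: "x \<in> V \<Longrightarrow> (\<lambda>y. fderiv f y v) differentiable (at x)"
  using smooth_on_differentiable[OF smooth_on_fderiv[OF f_smooth]] .

lemma D_linear: "x \<in> V \<Longrightarrow> linear (fderiv f x)"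
  by (rule fderiv_lin[OF f_diff])

lemma \<phi>_diff: "x \<in> V \<Longrightarrow> (\<lambda>y. \<phi> y v) differentiable (at x)"
  using smooth_on_differentiable[OF \<phi>_smooth] .

lemma \<eta>_diff: "i < s \<Longrightarrow> x \<in> V \<Longrightarrow> (\<lambda>y. \<eta> i y v) differentiable (at x)"
  using smooth_on_differentiable[OF \<eta>_smooth] .

lemma base_J_diff: "y \<in> W \<Longrightarrow> (\<lambda>y. J y a) differentiable (at y)"
  using smooth_on_differentiable[OF base_J_smooth] .

lemma D_\<xi>: "x \<in> V \<Longrightarrow> i < s \<Longrightarrow> fderiv f x (\<xi> i x) = 0"
  by (simp add: vertical \<phi>_\<xi>)

lemma D_sum_\<xi>: "x \<in> V \<Longrightarrow> fderiv f x (\<Sum>i<s. c i *\<^sub>R \<xi> i x) = 0"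
  by (simp add: linear_sum[OF D_linear] linear_scale[OF D_linear] D_\<xi>)

lemma \<phi>_sum_\<xi>: "x \<in> V \<Longrightarrow> \<phi> x (\<Sum>i<s. c i *\<^sub>R \<xi> i x) = 0"
  by (simp add: linear_sum[OF \<phi>_linear] linear_scale[OF \<phi>_linear] \<phi>_\<xi>)

lemma \<eta>_sum_\<xi>: "x \<in> V \<Longrightarrow> j < s \<Longrightarrow> \<eta> j x (\<Sum>i<s. c i *\<^sub>R \<xi> i x) = c j"
  by (simp add: linear_sum[OF \<eta>_linear] linear_scale[OF \<eta>_linear] \<eta>_\<xi> if_distrib[of "(*) _"] cong: if_cong)

lemma g_\<xi>: "x \<in> V \<Longrightarrow> i < s \<Longrightarrow> g x (\<xi> i x) v = \<eta> i x v"
  using g_\<phi>_\<phi>[of x "\<xi> i x" v]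
  by (simp add: \<phi>_\<xi> \<eta>_\<xi> linear_0[OF M.lin(2)] if_distrib[of "\<lambda>t. t * _"] cong: if_cong)

lemma g_sum_\<xi>: "x \<in> V \<Longrightarrow> g x (\<Sum>i<s. c i *\<^sub>R \<xi> i x) v = (\<Sum>i<s. c i * \<eta> i x v)"
  by (simp add: linear_sum[OF M.lin(2)] linear_scale[OF M.lin(2)] g_\<xi>)

text \<open>The map \<open>- \<phi> x (\<phi> x v)\<close> is the projection onto the horizontal
  space; it is written as a value of \<open>\<phi> x\<close> because \<open>isometry\<close> and
  \<open>projectable\<close> speak of such values.\<close>

lemma horizontal_part: "x \<in> V \<Longrightarrow> v = \<phi> x (- \<phi> x v) + (\<Sum>i<s. \<eta> i x v *\<^sub>R \<xi> i x)"
  by (simp add: linear_neg[OF \<phi>_linear] \<phi>_\<phi>)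

lemma D_horizontal: "x \<in> V \<Longrightarrow> fderiv f x v = fderiv f x (\<phi> x (- \<phi> x v))"
  using arg_cong[OF horizontal_part[of x v], of "fderiv f x"] by (simp add: linear_add[OF D_linear] D_sum_\<xi>)

lemma J_D: "x \<in> V \<Longrightarrow> J (f x) (fderiv f x v) = fderiv f x (\<phi> x v)"
  using arg_cong[OF horizontal_part[of x v], of "\<phi> x"]
  by (subst D_horizontal) (simp_all add: projectable linear_add[OF \<phi>_linear] \<phi>_sum_\<xi>)

lemma g_\<phi>_\<phi>_\<phi>: "x \<in> V \<Longrightarrow> g x (\<phi> x (\<phi> x u)) (\<phi> x (\<phi> x v)) = g x (\<phi> x u) (\<phi> x v)"
  by (simp add: g_\<phi>_\<phi>[of x "\<phi> x u"] \<eta>_\<phi>)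

text \<open>Passing to horizontal parts frees \<open>isometry\<close> from its restriction to the
  range of \<open>\<phi>\<close>.\<close>

lemma base_metric: "x \<in> V \<Longrightarrow>
    g' (f x) (fderiv f x u) (fderiv f x v) = g x u v - (\<Sum>i<s. \<eta> i x u * \<eta> i x v)"
  using isometry[of x "- \<phi> x u" "- \<phi> x v"] D_horizontal[of x u] D_horizontal[of x v]
  by (simp add: linear_neg[OF \<phi>_linear] linear_neg[OF M.lin(1)] linear_neg[OF M.lin(2)] g_\<phi>_\<phi>_\<phi> g_\<phi>_\<phi> \<eta>_\<phi>)

lemma base_J_J: "x \<in> V \<Longrightarrow> J (f x) (J (f x) a) = - a"
proof -
  assume x: "x \<in> V"
  obtain v where v: "a = fderiv f x v" using submersion[OF x] by (metis surjD)
  show ?thesis unfolding v J_D[OF x] \<phi>_\<phi>[OF x] linear_add[OF D_linear[OF x]] D_sum_\<xi>[OF x]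
    by (simp add: linear_neg[OF D_linear[OF x]])
qed

lemma base_J_isometry: "x \<in> V \<Longrightarrow> g' (f x) (J (f x) a) (J (f x) b) = g' (f x) a b"
proof -
  assume x: "x \<in> V"
  obtain u v where uv: "a = fderiv f x u" "b = fderiv f x v" using submersion[OF x] by (metis surjD)
  show ?thesis unfolding uv J_D[OF x] base_metric[OF x] g_\<phi>_\<phi>[OF x] using \<eta>_\<phi>[OF x] by simp
qed

lemma base_J_skew: "x \<in> V \<Longrightarrow> g' (f x) (J (f x) a) b = - g' (f x) a (J (f x) b)"
  using base_J_isometry[of x a "J (f x) b"] f_maps[of x] by (simp add: base_J_J linear_neg[OF N.lin(1)])

lemma compose_diff: "x \<in> V \<Longrightarrow> h differentiable (at (f x)) \<Longrightarrow> (\<lambda>y. h (f y)) differentiable (at x)"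
  using differentiable_chain_at[OF f_diff, of x h] by (simp add: comp_def)

lemma fderiv_f_compose: "x \<in> V \<Longrightarrow> h differentiable (at (f x)) \<Longrightarrow>
   fderiv (\<lambda>y. h (f y)) x v = fderiv h (f x) (fderiv f x v)"
  by (rule fderiv_compose[OF f_diff])

lemma D2_sym: "x \<in> V \<Longrightarrow> fderiv (\<lambda>y. fderiv f y u) x v = fderiv (\<lambda>y. fderiv f y v) x u"
  by (rule fderiv_symmetric[OF M.open_S _ f_smooth])

text \<open>The derivative of the relation \<open>J_D\<close>, in which also \<open>fderiv f\<close>
  varies. The second derivatives of \<open>f\<close> that enter are symmetric and drop out of the
  Nijenhuis tensor.\<close>

lemma D_fderiv_\<phi>:
  assumes x: "x \<in> V"
  shows "fderiv f x (fderiv (\<lambda>y. \<phi> y w) x u) = fderiv (\<lambda>y. J y (fderiv f x w)) (f x) (fderiv f x u)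
    + J (f x) (fderiv (\<lambda>y. fderiv f y w) x u) - fderiv (\<lambda>y. fderiv f y (\<phi> x w)) x u"
proof -
  have "fderiv (\<lambda>y. J (f y) (fderiv f y w)) x u = fderiv (\<lambda>y. fderiv f y (\<phi> y w)) x u"
    by (rule fun_cong[OF fderiv_cong[OF M.open_S x J_D]])
  moreover have "fderiv (\<lambda>y. J (f y) (fderiv f y w)) x u =
     fderiv (\<lambda>y. J (f y) (fderiv f x w)) x u + J (f x) (fderiv (\<lambda>y. fderiv f y w) x u)"
    by (rule differentiable_apply(2)[OF M.open_S x])
      (auto intro!: base_J_linear f_maps compose_diff[OF x] base_J_diff f_diff2 x)
  moreover have "fderiv (\<lambda>y. J (f y) (fderiv f x w)) x u = fderiv (\<lambda>y. J y (fderiv f x w)) (f x) (fderiv f x u)"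
    by (rule fderiv_f_compose[OF x base_J_diff[OF f_maps[OF x]]])
  moreover have "fderiv (\<lambda>y. fderiv f y (\<phi> y w)) x u =
     fderiv (\<lambda>y. fderiv f y (\<phi> x w)) x u + fderiv f x (fderiv (\<lambda>y. \<phi> y w) x u)"
    by (rule differentiable_apply(2)[OF M.open_S x]) (auto intro!: D_linear f_diff2 \<phi>_diff x)
  ultimately show ?thesis by simp
qed

lemma base_nijenhuis:
  assumes x: "x \<in> V" shows "nijenhuis_at J (f x) a b = 0"
proof -
  obtain u v where uv: "a = fderiv f x u" "b = fderiv f x v" using submersion[OF x] by (metis surjD)
  note lD = linear_add[OF D_linear[OF x]] linear_diff[OF D_linear[OF x]]
  note lJ = linear_add[OF base_J_linear[OF f_maps[OF x]]] linear_diff[OF base_J_linear[OF f_maps[OF x]]]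
  have "fderiv f x (nijenhuis_at \<phi> x u v) = nijenhuis_at J (f x) a b"
    unfolding nijenhuis_at_def lD J_D[OF x, symmetric] D_fderiv_\<phi>[OF x] uv
    by (simp add: lJ base_J_J[OF x] D2_sym[OF x, of v] D2_sym[OF x, of "\<phi> x v"])
  moreover have "nijenhuis_at \<phi> x u v = - (\<Sum>i<s. (2 * g x u (\<phi> x v)) *\<^sub>R \<xi> i x)"
    using normal[OF x, of u v] by (simp add: eq_neg_iff_add_eq_0)
  ultimately show ?thesis by (simp only: linear_neg[OF D_linear[OF x]] D_sum_\<xi>[OF x] minus_zero)
qed

text \<open>The pull-back of the Kaehler form is half the exact form \<open>d\<eta>\<^sub>i\<close>.\<close>

lemma base_d\<Omega>:
  assumes x: "x \<in> V"
  shows "fderiv (\<lambda>y. g' y b (J y c)) (f x) a + fderiv (\<lambda>y. g' y c (J y a)) (f x) b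
      + fderiv (\<lambda>y. g' y a (J y b)) (f x) c = 0"
proof -
  obtain u v w where uvw: "a = fderiv f x u" "b = fderiv f x v" "c = fderiv f x w"
    using submersion[OF x] by (metis surjD)
  have s0: "0 < s" using s_pos by simp
  define \<omega> where "\<omega> v w y = g y v (\<phi> y w)" for v w y
  define D2 where "D2 u v = fderiv (\<lambda>y. fderiv f y v) x u" for u v
  have D2: "D2 u v = D2 v u" for u v unfolding D2_def by (rule D2_sym[OF x])
  have bil: "bilinear (\<lambda>a b. g' (f y) a (J (f y) b))" if "y \<in> V" for y
    using N.lin[OF f_maps[OF that]] base_J_linear[OF f_maps[OF that]]
    by (auto simp: bilinear_def linear_iff)
  have base_diff: "(\<lambda>y. g' y a (J y b)) differentiable (at (f x))" for a b
    by (rule N.g_apply(1)[OF f_maps[OF x] differentiable_const base_J_diff[OF f_maps[OF x]]])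
  \<comment> \<open>The terms with \<open>D2\<close> cancel in the cyclic sum, since
    \<open>D2\<close> is symmetric and the form on the base is skew.\<close>
  have \<omega>_deriv: "fderiv (\<omega> v w) x u = fderiv (\<lambda>y. g' y (fderiv f x v) (J y (fderiv f x w))) (f x) (fderiv f x u)
     + g' (f x) (D2 u v) (J (f x) (fderiv f x w)) + g' (f x) (fderiv f x v) (J (f x) (D2 u w))" for u v w
  proof -
    have "fderiv (\<omega> v w) x u = fderiv (\<lambda>y. g' (f y) (fderiv f y v) (J (f y) (fderiv f y w))) x u"
      by (rule fun_cong[OF fderiv_cong[OF M.open_S x]]) (simp add: \<omega>_def J_D base_metric \<eta>_\<phi>)
    also have "\<dots> = fderiv (\<lambda>y. g' (f y) (fderiv f x v) (J (f y) (fderiv f x w))) x u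
       + g' (f x) (D2 u v) (J (f x) (fderiv f x w)) + g' (f x) (fderiv f x v) (J (f x) (D2 u w))"
      unfolding D2_def
      by (rule bilinear_apply(2)[OF M.open_S x, of "\<lambda>y a b. g' (f y) a (J (f y) b)"])
        (auto intro!: bil compose_diff[OF x] base_diff f_diff2 x)
    also have "fderiv (\<lambda>y. g' (f y) (fderiv f x v) (J (f y) (fderiv f x w))) x u =
       fderiv (\<lambda>y. g' y (fderiv f x v) (J y (fderiv f x w))) (f x) (fderiv f x u)"
      by (rule fderiv_f_compose[OF x base_diff])
    finally show ?thesis .
  qed
  \<comment> \<open>Second derivatives of the components of \<open>\<eta> 0\<close>, an index
    available since \<open>s \<ge> 1\<close>. Their symmetry in the first two arguments makes the
    cyclic sum vanish, which is the identity d d = 0.\<close>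
  define H where "H u v w = fderiv (\<lambda>y. fderiv (\<lambda>y. \<eta> 0 y w) y v) x u" for u v w
  have Hsym: "H u v w = H v u w" for u v w
    unfolding H_def by (rule fderiv_symmetric[OF M.open_S x \<eta>_smooth[OF s0]])
  have \<omega>_\<eta>: "2 * fderiv (\<omega> v w) x u = H u v w - H u w v" for u v w
  proof -
    have d: "\<omega> v w differentiable (at x)"
      unfolding \<omega>_def by (rule M.g_apply(1)[OF x differentiable_const \<phi>_diff[OF x]])
    have d2: "(\<lambda>y. fderiv (\<lambda>y. \<eta> 0 y w) y v) differentiable (at x)" for v w
      by (rule smooth_on_differentiable[OF smooth_on_fderiv[OF \<eta>_smooth[OF s0]] x])
    have "2 * fderiv (\<omega> v w) x u = fderiv (\<lambda>y. 2 * \<omega> v w y) x u" by (rule fderiv_cmult[OF d, symmetric])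
    also have "\<dots> = fderiv (\<lambda>y. fderiv (\<lambda>y. \<eta> 0 y w) y v - fderiv (\<lambda>y. \<eta> 0 y v) y w) x u"
      by (rule fun_cong[OF fderiv_cong[OF M.open_S x]]) (simp add: \<omega>_def contact[OF _ s0])
    finally show ?thesis unfolding H_def by (simp add: fderiv_diff d2)
  qed
  have sk: "g' (f x) a (J (f x) b) = - g' (f x) b (J (f x) a)" for a b
    using base_J_skew[OF x, of b a] N.symmetric[OF f_maps[OF x]] by simp
  have "2 * (fderiv (\<omega> v w) x u + fderiv (\<omega> w u) x v + fderiv (\<omega> u v) x w) = 0"
    unfolding distrib_left \<omega>_\<eta> using Hsym[of u v w] Hsym[of u w v] Hsym[of v w u] by linarith
  then have "fderiv (\<omega> v w) x u + fderiv (\<omega> w u) x v + fderiv (\<omega> u v) x w = 0" by simp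
  then show ?thesis
    unfolding \<omega>_deriv uvw D2[of v u] D2[of w u] D2[of w v]
    using sk[of "D2 u v" "fderiv f x w"] sk[of "D2 u w" "fderiv f x v"] sk[of "D2 v w" "fderiv f x u"]
    by linarith
qed

end

section \<open>Horizontal lifts and the connection in the adapted frame\<close>

context f_submersion
begin

text \<open>Encoded as the adjoint of \<open>fderiv f x\<close> for the two metrics, which for a
  Riemannian submersion is the horizontal right inverse of the differential. Existence and
  smoothness then come from \<open>riesz\<close> and \<open>riesz_smooth\<close>, without inverting
  the differential on a moving subspace.\<close>

definition lift :: "'e \<Rightarrow> 'f \<Rightarrow> 'e" where
  "lift x a = (THE z. \<forall>w. g x z w = g' (f x) a (fderiv f x w))"

lemma g_lift: "x \<in> V \<Longrightarrow> g x (lift x a) w = g' (f x) a (fderiv f x w)"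
proof -
  assume x: "x \<in> V"
  have "linear (\<lambda>w. g' (f x) a (fderiv f x w))"
    using linear_compose[OF D_linear[OF x] N.lin(1)[OF f_maps[OF x]]] by (simp add: comp_def)
  from theI'[OF M.riesz[OF x this]] show ?thesis unfolding lift_def by blast
qed

lemma lift_smooth: "smooth_on V (\<lambda>x. lift x a)"
proof (rule M.riesz_smooth)
  show "g x (lift x a) w = g' (f x) a (fderiv f x w)" if "x \<in> V" for x w by (rule g_lift[OF that])
  show "smooth_on V (\<lambda>x. g' (f x) a (fderiv f x w))" for w
  proof (rule smooth_on_apply[where A="\<lambda>x. g' (f x) a", OF M.open_S])
    show "linear (g' (f x) a)" if "x \<in> V" for x by (rule N.lin(1)[OF f_maps[OF that]])
    show "smooth_on V (\<lambda>x. g' (f x) a v)" for v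
      by (rule smooth_on_compose[OF M.open_S f_maps f_smooth N.smooth])
  qed (rule smooth_on_fderiv[OF f_smooth])
qed

lemma \<eta>_lift: "x \<in> V \<Longrightarrow> i < s \<Longrightarrow> \<eta> i x (lift x a) = 0"
  using g_lift[of x a "\<xi> i x"] g_\<xi>[of x i "lift x a"] M.symmetric[of x "\<xi> i x"]
  by (simp add: D_\<xi> linear_0[OF N.lin(1)[OF f_maps]])

lemma D_lift: "x \<in> V \<Longrightarrow> fderiv f x (lift x a) = a"
proof -
  assume x: "x \<in> V"
  show ?thesis
  proof (rule N.nondegenerate[OF f_maps[OF x]])
    fix b
    obtain w where w: "b = fderiv f x w" using submersion[OF x] by (metis surjD)
    show "g' (f x) (fderiv f x (lift x a)) b = g' (f x) a b"
      unfolding w base_metric[OF x] by (simp add: \<eta>_lift[OF x] g_lift[OF x])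
  qed
qed

lemma lift_linear: "x \<in> V \<Longrightarrow> linear (lift x)"
  by (rule linearI; rule M.nondegenerate)
    (auto simp: linear_add[OF M.lin(2)] linear_scale[OF M.lin(2)] g_lift
      linear_add[OF N.lin(2)[OF f_maps]] linear_scale[OF N.lin(2)[OF f_maps]])

lemma frame_decomposition: "x \<in> V \<Longrightarrow> w = lift x (fderiv f x w) + (\<Sum>i<s. \<eta> i x w *\<^sub>R \<xi> i x)"
  by (rule M.nondegenerate[of x])
    (simp_all add: linear_add[OF M.lin(2)] g_lift base_metric g_sum_\<xi>)

lemma \<phi>_lift: "x \<in> V \<Longrightarrow> \<phi> x (lift x a) = lift x (J (f x) a)"
  using frame_decomposition[of x "\<phi> x (lift x a)"] J_D[of x "lift x a"]
  by (simp add: \<eta>_\<phi> D_lift)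

text \<open>Since \<open>a\<close> and the \<open>c i\<close> are constants, \<open>fderiv f\<close>
  and every \<open>\<eta> i\<close> take constant values on this field. Every tangent vector is a
  value of such a field (\<open>frame_exhaust\<close>), so tensors may be computed on these fields
  alone.\<close>

definition frame :: "'f \<Rightarrow> (nat \<Rightarrow> real) \<Rightarrow> 'e \<Rightarrow> 'e" where
  "frame a c x = lift x a + (\<Sum>i<s. c i *\<^sub>R \<xi> i x)"

abbreviation \<xi>_sum :: "'e \<Rightarrow> 'e" where "\<xi>_sum x \<equiv> (\<Sum>i<s. \<xi> i x)"

lemma frame_smooth: "smooth_on V (frame a c)"
  unfolding frame_def
  by (intro smooth_on_add[OF M.open_S] smooth_on_sum[OF M.open_S] smooth_on_scaleR[OF M.open_S]
      smooth_on_const lift_smooth \<xi>_smooth) auto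

lemma frame_diff: "x \<in> V \<Longrightarrow> frame a c differentiable (at x)"
  using smooth_on_differentiable[OF frame_smooth] .

lemma D_frame: "x \<in> V \<Longrightarrow> fderiv f x (frame a c x) = a"
  by (simp add: frame_def linear_add[OF D_linear] D_lift D_sum_\<xi>)

lemma \<eta>_frame: "x \<in> V \<Longrightarrow> i < s \<Longrightarrow> \<eta> i x (frame a c x) = c i"
  by (simp add: frame_def linear_add[OF \<eta>_linear] \<eta>_lift \<eta>_sum_\<xi>)

lemma \<phi>_frame: "x \<in> V \<Longrightarrow> \<phi> x (frame a c x) = lift x (J (f x) a)"
  by (simp add: frame_def linear_add[OF \<phi>_linear] \<phi>_lift \<phi>_sum_\<xi>)

lemma frame_exhaust: "x \<in> V \<Longrightarrow> w = frame (fderiv f x w) (\<lambda>i. \<eta> i x w) x"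
  unfolding frame_def by (rule frame_decomposition)

lemma \<xi>_sum_frame: "x \<in> V \<Longrightarrow> \<xi>_sum x = frame 0 (\<lambda>_. 1) x"
  by (simp add: frame_def linear_0[OF lift_linear])

lemma lift_frame: "lift x a = frame a (\<lambda>_. 0) x"
  by (simp add: frame_def)

lemma g_frame: "x \<in> V \<Longrightarrow> g x (frame a c x) (frame b d x) = g' (f x) a b + (\<Sum>i<s. c i * d i)"
  using base_metric[of x "frame a c x" "frame b d x"] by (simp add: D_frame \<eta>_frame)

lemma g_\<xi>_sum_frame: "x \<in> V \<Longrightarrow> g x (\<xi>_sum x) (frame b d x) = (\<Sum>i<s. d i)"
  by (simp add: \<xi>_sum_frame g_frame linear_0[OF N.lin(2)[OF f_maps]])

text \<open>As \<open>fderiv f\<close> is constant on both fields, it maps the bracket to a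
  difference of second derivatives of \<open>f\<close>, which is zero. As \<open>\<eta> i\<close> is
  constant on both, its value on the bracket is \<open>- d\<eta>_i\<close>, hence -2F for every
  \<open>i\<close>.\<close>

lemma bracket_frame:
  assumes x: "x \<in> V"
  shows "lie_bracket (frame a c) (frame b d) x = (- 2 * g' (f x) a (J (f x) b)) *\<^sub>R \<xi>_sum x"
proof -
  let ?L = "lie_bracket (frame a c) (frame b d) x"
  have D: "fderiv f x (fderiv (frame b d) x u) = - fderiv (\<lambda>y. fderiv f y (frame b d x)) x u" for b d u
  proof -
    have "fderiv (\<lambda>y. fderiv f y (frame b d y)) x u = fderiv (\<lambda>y. b) x u"
      by (rule fun_cong[OF fderiv_cong[OF M.open_S x D_frame]])
    then show ?thesis
      using differentiable_apply(2)[OF M.open_S x, of "fderiv f", OF D_linear f_diff2[OF x] frame_diff[OF x], of b d u]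
      by (simp add: eq_neg_iff_add_eq_0 add.commute)
  qed
  have "fderiv f x ?L = 0"
    unfolding lie_bracket_def linear_diff[OF D_linear[OF x]] D using D2_sym[OF x] by simp
  moreover have "\<eta> i x ?L = - 2 * g' (f x) a (J (f x) b)" if i: "i < s" for i
  proof -
    have E: "\<eta> i x (fderiv (frame b d) x u) = - fderiv (\<lambda>y. \<eta> i y (frame b d x)) x u" for b d u
    proof -
      have "fderiv (\<lambda>y. \<eta> i y (frame b d y)) x u = fderiv (\<lambda>y. d i) x u"
        by (rule fun_cong[OF fderiv_cong[OF M.open_S x \<eta>_frame[OF _ i]]])
      then show ?thesis
        using differentiable_apply(2)[OF M.open_S x, of "\<eta> i", OF \<eta>_linear[OF i] \<eta>_diff[OF i x] frame_diff[OF x], of b d u]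
        by (simp add: eq_neg_iff_add_eq_0 add.commute)
    qed
    have "\<eta> i x ?L = - 2 * g x (frame a c x) (\<phi> x (frame b d x))"
      unfolding lie_bracket_def linear_diff[OF \<eta>_linear[OF i x]] E using contact[OF x i, of "frame a c x" "frame b d x"] by simp
    then show ?thesis by (simp add: \<phi>_frame[OF x] lift_frame g_frame[OF x])
  qed
  ultimately have "?L = (\<Sum>i<s. (- 2 * g' (f x) a (J (f x) b)) *\<^sub>R \<xi> i x)"
    using frame_decomposition[OF x, of ?L] by (simp add: linear_0[OF lift_linear[OF x]])
  then show ?thesis by (simp only: scaleR_right.sum)
qed

text \<open>Special cases: two lifts give the lift of the base derivative and an O'Neill term along
  \<open>\<xi>_sum\<close>; the derivative of \<open>\<xi> i\<close> along the lift of
  \<open>a\<close> is minus the lift of \<open>J a\<close>; the \<open>\<xi> i\<close> are parallel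
  along one another.\<close>

lemma lc_frame:
  assumes x: "x \<in> V"
  shows "levi_civita g (frame a c) (frame b d) x =
    lift x (N.\<Gamma> (f x) a b - (\<Sum>i<s. d i) *\<^sub>R J (f x) a - (\<Sum>i<s. c i) *\<^sub>R J (f x) b)
    - g' (f x) a (J (f x) b) *\<^sub>R \<xi>_sum x"
proof (rule M.nondegenerate[OF x])
  fix w
  define e h where "e = fderiv f x w" and "h i = \<eta> i x w" for i
  have w: "w = frame e h x" unfolding e_def h_def by (rule frame_exhaust[OF x])
  have fx: "f x \<in> W" by (rule f_maps[OF x])
  \<comment> \<open>By \<open>g_frame\<close> the inner product is a base function plus a constant,
    so only the base component \<open>a\<close> of the direction counts.\<close>
  have deriv: "fderiv (\<lambda>y. g y (frame b d y) (frame e h y)) x (frame a c x) = fderiv (\<lambda>y. g' y b e) (f x) a"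
    for a b e c d h
  proof -
    have "fderiv (\<lambda>y. g y (frame b d y) (frame e h y)) x (frame a c x) =
        fderiv (\<lambda>y. g' (f y) b e + (\<Sum>i<s. d i * h i)) x (frame a c x)"
      by (rule fun_cong[OF fderiv_cong[OF M.open_S x g_frame]])
    also have "\<dots> = fderiv (\<lambda>y. g' y b e) (f x) a"
      using fderiv_f_compose[OF x N.diff_g[OF fx]] compose_diff[OF x N.diff_g[OF fx]]
      by (simp add: fderiv_add D_frame[OF x])
    finally show ?thesis .
  qed
  have "2 * g x (levi_civita g (frame a c) (frame b d) x) (frame e h x) =
     2 * N.koszul (f x) a b e - 2 * g' (f x) a (J (f x) b) * (\<Sum>i<s. h i)
     + 2 * g' (f x) a (J (f x) e) * (\<Sum>i<s. d i) + 2 * g' (f x) b (J (f x) e) * (\<Sum>i<s. c i)"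
    unfolding M.koszul_formula[OF x frame_diff[OF x] frame_diff[OF x] frame_diff[OF x]] deriv bracket_frame[OF x]
      linear_scale[OF M.lin(2)[OF x]] g_\<xi>_sum_frame[OF x]
    by (simp add: N.koszul_def)
  moreover have "g x (lift x (N.\<Gamma> (f x) a b - (\<Sum>i<s. d i) *\<^sub>R J (f x) a - (\<Sum>i<s. c i) *\<^sub>R J (f x) b)
    - g' (f x) a (J (f x) b) *\<^sub>R \<xi>_sum x) (frame e h x) =
      N.koszul (f x) a b e + (\<Sum>i<s. d i) * g' (f x) a (J (f x) e) + (\<Sum>i<s. c i) * g' (f x) b (J (f x) e)
      - g' (f x) a (J (f x) b) * (\<Sum>i<s. h i)"
    by (simp add: linear_diff[OF M.lin(2)[OF x]] linear_scale[OF M.lin(2)[OF x]] g_\<xi>_sum_frame[OF x]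
        g_lift[OF x] D_frame[OF x] linear_diff[OF N.lin(2)[OF fx]] linear_scale[OF N.lin(2)[OF fx]]
        N.christoffel_koszul[OF fx] base_J_skew[OF x])
  ultimately show "g x (levi_civita g (frame a c) (frame b d) x) w =
     g x (lift x (N.\<Gamma> (f x) a b - (\<Sum>i<s. d i) *\<^sub>R J (f x) a - (\<Sum>i<s. c i) *\<^sub>R J (f x) b)
    - g' (f x) a (J (f x) b) *\<^sub>R \<xi>_sum x) w"
    unfolding w by (simp add: algebra_simps)
qed

end

section \<open>Curvature and Ricci tensor of the total space\<close>

text \<open>\<open>base_J_J\<close> and \<open>base_J_isometry\<close> hold at image points of
  \<open>f\<close>, whereas differentiating them on the base needs an open set. The hermitian
  identities on all of \<open>W\<close> are therefore a separate assumption, discharged by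
  collecting them over all charts of the total space.\<close>

locale kaehler_submersion = f_submersion V g W g' f \<phi> \<xi> \<eta> J n s + H: hermitian_domain W g' J
  for V :: "'e::euclidean_space set" and g and W :: "'f::euclidean_space set" and g' f \<phi> \<xi> \<eta> J n s
begin

lemma base_J_parallel:
  assumes x: "x \<in> V"
  shows "fderiv (\<lambda>z. J z b) (f x) a = J (f x) (N.\<Gamma> (f x) a b) - N.\<Gamma> (f x) a (J (f x) b)"
proof -
  have "H.nabla_J (f x) a b = 0"
    by (rule H.nabla_J_zero[OF f_maps[OF x] base_nijenhuis[OF x]])
      (simp add: H.d\<Omega>_def base_d\<Omega>[OF x])
  then show ?thesis by (simp add: H.nabla_J_def algebra_simps eq_diff_eq)
qed

text \<open>By \<open>lc_frame\<close>, the covariant derivative of one frame field along another is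
  a lift plus a multiple of \<open>\<xi>_sum\<close>, with coefficients that are functions on the
  base. This is the rule for differentiating such a field once more, as the curvature
  requires.\<close>

lemma lc_lifted_field:
  assumes x: "x \<in> V" and B: "B differentiable (at (f x))" and h: "h differentiable (at (f x))"
  shows "levi_civita g (frame p e) (\<lambda>y. lift y (B (f y)) + h (f y) *\<^sub>R \<xi>_sum y) x =
    lift x (fderiv B (f x) p + N.\<Gamma> (f x) p (B (f x)) - (\<Sum>i<s. e i) *\<^sub>R J (f x) (B (f x))
       - (real s * h (f x)) *\<^sub>R J (f x) p)
    + (fderiv h (f x) p - g' (f x) p (J (f x) (B (f x)))) *\<^sub>R \<xi>_sum x"
proof -
  have fx: "f x \<in> W" by (rule f_maps[OF x])
  note lifts = linear_add[OF lift_linear[OF x]] linear_diff[OF lift_linear[OF x]] linear_scale[OF lift_linear[OF x]]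
    linear_neg[OF lift_linear[OF x]]
  have lift_diff: "(\<lambda>y. lift y a) differentiable (at x)" for a
    by (rule smooth_on_differentiable[OF lift_smooth x])
  have dB: "(\<lambda>y. B (f y)) differentiable (at x)" by (rule compose_diff[OF x B])
  note ap = differentiable_apply[OF M.open_S x, of lift, OF lift_linear lift_diff dB]
  have "levi_civita g (frame p e) (\<lambda>y. lift y (B (f y))) x =
     levi_civita g (frame p e) (frame (B (f x)) (\<lambda>_. 0)) x + lift x (fderiv B (f x) p)"
    using ap(2) fderiv_f_compose[OF x B]
    by (simp add: levi_civita_def frame_def[of "B (f x)" "\<lambda>_. 0", abs_def] D_frame[OF x])
  then have 1: "levi_civita g (frame p e) (\<lambda>y. lift y (B (f y))) x =
      lift x (fderiv B (f x) p + N.\<Gamma> (f x) p (B (f x)) - (\<Sum>i<s. e i) *\<^sub>R J (f x) (B (f x)))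
      - g' (f x) p (J (f x) (B (f x))) *\<^sub>R \<xi>_sum x"
    by (simp add: lc_frame[OF x] lifts)
  have \<xi>d: "\<xi>_sum differentiable (at x)"
    by (rule smooth_on_differentiable[OF _ x]) (intro smooth_on_sum[OF M.open_S] \<xi>_smooth, simp)
  have dh: "(\<lambda>y. h (f y)) differentiable (at x)" by (rule compose_diff[OF x h])
  have "levi_civita g (frame p e) \<xi>_sum x = levi_civita g (frame p e) (frame 0 (\<lambda>_. 1)) x"
    by (rule M.lc_cong[OF x]) (auto simp: \<xi>_sum_frame)
  also have "\<dots> = - lift x (real s *\<^sub>R J (f x) p)"
    by (simp add: lc_frame[OF x] lifts linear_0[OF N.christoffel_linear(1)[OF fx]] linear_0[OF base_J_linear[OF fx]]
       linear_0[OF N.lin(1)[OF fx]])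
  finally have 2: "levi_civita g (frame p e) (\<lambda>y. h (f y) *\<^sub>R \<xi>_sum y) x =
     fderiv h (f x) p *\<^sub>R \<xi>_sum x - lift x ((real s * h (f x)) *\<^sub>R J (f x) p)"
    by (simp add: M.lc_scale[OF x dh \<xi>d] fderiv_f_compose[OF x h] D_frame[OF x] lifts)
  have "levi_civita g (frame p e) (\<lambda>y. lift y (B (f y)) + h (f y) *\<^sub>R \<xi>_sum y) x =
     levi_civita g (frame p e) (\<lambda>y. lift y (B (f y))) x + levi_civita g (frame p e) (\<lambda>y. h (f y) *\<^sub>R \<xi>_sum y) x"
    by (rule M.lc_add[OF x ap(1) differentiable_scaleR[OF dh \<xi>d]])
  then show ?thesis unfolding 1 2 by (simp add: lifts algebra_simps)
qed

text \<open>The part along \<open>\<xi>_sum\<close> only enters the Ricci trace through vertical first arguments, where the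
  terms differentiated along the base vanish.\<close>

lemma curv_frame:
  assumes x: "x \<in> V"
  shows "\<exists>k. M.curv x (frame p e x) (frame a c x) (frame b d x) =
    lift x (N.curv (f x) p a b + ((\<Sum>i<s. c i) * (\<Sum>i<s. d i)) *\<^sub>R p - ((\<Sum>i<s. e i) * (\<Sum>i<s. d i)) *\<^sub>R a
      + real s *\<^sub>R (g' (f x) a (J (f x) b) *\<^sub>R J (f x) p - g' (f x) p (J (f x) b) *\<^sub>R J (f x) a
           - (2 * g' (f x) p (J (f x) a)) *\<^sub>R J (f x) b)) + k *\<^sub>R \<xi>_sum x
    \<and> (p = 0 \<longrightarrow> k = (\<Sum>i<s. e i) * g' (f x) a b)"
proof -
  have fx: "f x \<in> W" by (rule f_maps[OF x])
  define y where "y = f x"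
  define C Dd Ee where "C = (\<Sum>i<s. c i)" and "Dd = (\<Sum>i<s. d i)" and "Ee = (\<Sum>i<s. e i)"
  \<comment> \<open>The horizontal and vertical coefficients, as functions on the base, of the
    derivative of \<open>frame b d\<close> along a frame field with base part \<open>p\<close> and
    vertical coefficients summing to \<open>e\<close>; only this sum enters
    \<open>lc_frame\<close>.\<close>
  define B where "B p e z = N.\<Gamma> z p b - Dd *\<^sub>R J z p - e *\<^sub>R J z b" for p and e :: real and z
  define h where "h p z = - g' z p (J z b)" for p z
  have yW: "y \<in> W" unfolding y_def by (rule fx)
  have Bd: "B p e differentiable (at y)" for p e
    unfolding B_def using N.christoffel_diff[OF yW] base_J_diff[OF yW]
    by (intro differentiable_diff differentiable_scaleR differentiable_const)
  have gJd: "(\<lambda>z. g' z p (J z b)) differentiable (at y)" for p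
    by (rule N.g_apply(1)[OF yW differentiable_const base_J_diff[OF yW]])
  have hd: "h p differentiable (at y)" for p
    unfolding h_def by (intro differentiable_minus gJd)
  note lJ = linear_add[OF base_J_linear[OF yW]] linear_diff[OF base_J_linear[OF yW]] linear_scale[OF base_J_linear[OF yW]]
    linear_0[OF base_J_linear[OF yW]] linear_neg[OF base_J_linear[OF yW]]
  note l\<Gamma> = linear_add[OF N.christoffel_linear(1)[OF yW]] linear_diff[OF N.christoffel_linear(1)[OF yW]] linear_scale[OF N.christoffel_linear(1)[OF yW]]
  \<comment> \<open>Parallelism of \<open>J\<close> trades its derivatives for products of
    \<open>\<Gamma>\<close> and \<open>J\<close>. These cancel in the curvature, so that no
    connection term survives outside \<open>N.curv\<close>.\<close>
  have DB: "fderiv (B p e) y q = fderiv (\<lambda>z. N.\<Gamma> z p b) y q - Dd *\<^sub>R (J y (N.\<Gamma> y q p) - N.\<Gamma> y q (J y p))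
      - e *\<^sub>R (J y (N.\<Gamma> y q b) - N.\<Gamma> y q (J y b))" for p e q
    unfolding B_def using N.christoffel_diff[OF yW] base_J_diff[OF yW] base_J_parallel[OF x]
    by (simp add: fderiv_diff fderiv_scaleR differentiable_diff differentiable_scaleR y_def)
  have nab: "levi_civita g (frame q l) (levi_civita g (frame p m) (frame b d)) x =
     lift x (fderiv (B p (\<Sum>i<s. m i)) y q + N.\<Gamma> y q (B p (\<Sum>i<s. m i) y) - (\<Sum>i<s. l i) *\<^sub>R J y (B p (\<Sum>i<s. m i) y)
       - (real s * h p y) *\<^sub>R J y q)
    + (fderiv (h p) y q - g' y q (J y (B p (\<Sum>i<s. m i) y))) *\<^sub>R \<xi>_sum x" for q l p m
  proof -
    have "levi_civita g (frame q l) (levi_civita g (frame p m) (frame b d)) x =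
      levi_civita g (frame q l) (\<lambda>y. lift y (B p (\<Sum>i<s. m i) (f y)) + h p (f y) *\<^sub>R \<xi>_sum y) x"
      by (rule M.lc_cong[OF x refl]) (simp add: lc_frame B_def h_def Dd_def)
    then show ?thesis using lc_lifted_field[OF x Bd[unfolded y_def] hd[unfolded y_def]] by (simp add: y_def)
  qed
  \<comment> \<open>The bracket is at each point a multiple of \<open>\<xi>_sum\<close>, the frame
    field with base part 0 and all vertical coefficients 1; their sum gives the factor
    \<open>real s\<close>.\<close>
  have third: "levi_civita g (lie_bracket (frame p e) (frame a c)) (frame b d) x =
      lift x ((2 * g' y p (J y a) * real s) *\<^sub>R J y b)"
  proof -
    have "levi_civita g (lie_bracket (frame p e) (frame a c)) (frame b d) x =
       (- 2 * g' y p (J y a)) *\<^sub>R levi_civita g (frame 0 (\<lambda>_. 1)) (frame b d) x"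
      unfolding levi_civita_def bracket_frame[OF x] \<xi>_sum_frame[OF x] y_def
      by (simp only: linear_scale[OF fderiv_lin[OF frame_diff[OF x]]] linear_scale[OF M.christoffel_linear(2)[OF x]] scaleR_add_right)
    then show ?thesis
      unfolding lc_frame[OF x] y_def[symmetric]
      by (simp add: lJ linear_0[OF N.christoffel_linear(2)[OF yW]] linear_0[OF N.lin(2)[OF yW]]
          linear_scale[OF lift_linear[OF x]] linear_neg[OF lift_linear[OF x]])
  qed
  define k where "k = (fderiv (h a) y p - g' y p (J y (B a C y))) - (fderiv (h p) y a - g' y a (J y (B p Ee y)))"
  have "M.curv x (frame p e x) (frame a c x) (frame b d x) = riemann g (frame p e) (frame a c) (frame b d) x"
    by (rule M.riemann_tensorial[OF x frame_diff[OF x] frame_diff[OF x] frame_smooth, symmetric])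
  also have "\<dots> = lift x ((fderiv (B a C) y p + N.\<Gamma> y p (B a C y) - Ee *\<^sub>R J y (B a C y) - (real s * h a y) *\<^sub>R J y p)
      - (fderiv (B p Ee) y a + N.\<Gamma> y a (B p Ee y) - C *\<^sub>R J y (B p Ee y) - (real s * h p y) *\<^sub>R J y a)
      - (2 * g' y p (J y a) * real s) *\<^sub>R J y b) + k *\<^sub>R \<xi>_sum x"
    unfolding riemann_def nab third C_def[symmetric] Ee_def[symmetric] k_def
    by (simp add: linear_diff[OF lift_linear[OF x]] scaleR_diff_left)
  also have "(fderiv (B a C) y p + N.\<Gamma> y p (B a C y) - Ee *\<^sub>R J y (B a C y) - (real s * h a y) *\<^sub>R J y p)
      - (fderiv (B p Ee) y a + N.\<Gamma> y a (B p Ee y) - C *\<^sub>R J y (B p Ee y) - (real s * h p y) *\<^sub>R J y a)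
      - (2 * g' y p (J y a) * real s) *\<^sub>R J y b
    = N.curv y p a b + (C * Dd) *\<^sub>R p - (Ee * Dd) *\<^sub>R a
      + real s *\<^sub>R (g' y a (J y b) *\<^sub>R J y p - g' y p (J y b) *\<^sub>R J y a - (2 * g' y p (J y a)) *\<^sub>R J y b)"
    unfolding DB N.curv_def h_def
    by (simp add: B_def lJ l\<Gamma> H.J_J[OF yW] N.christoffel_sym[OF yW, of p a] algebra_simps)
  finally have main: "M.curv x (frame p e x) (frame a c x) (frame b d x) =
     lift x (N.curv y p a b + (C * Dd) *\<^sub>R p - (Ee * Dd) *\<^sub>R a
      + real s *\<^sub>R (g' y a (J y b) *\<^sub>R J y p - g' y p (J y b) *\<^sub>R J y a - (2 * g' y p (J y a)) *\<^sub>R J y b))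
     + k *\<^sub>R \<xi>_sum x" .
  have "k = Ee * g' y a b" if p: "p = 0"
  proof -
    have "fderiv (h p) y a = fderiv (\<lambda>_. 0) y a"
      by (rule fun_cong[OF fderiv_cong[OF N.open_S yW]]) (simp add: h_def p linear_0[OF N.lin(2)])
    moreover have "fderiv (h a) y p = 0" by (simp add: p linear_0[OF fderiv_lin[OF hd]])
    moreover have "J y (B p Ee y) = Ee *\<^sub>R b"
      by (simp add: B_def p lJ H.J_J[OF yW] linear_0[OF N.christoffel_linear(2)[OF yW]])
    ultimately show ?thesis
      by (simp add: k_def p linear_0[OF N.lin(2)[OF yW]] linear_scale[OF N.lin(1)[OF yW]])
  qed
  with main show ?thesis unfolding y_def C_def Dd_def Ee_def by blast
qed

text \<open>Origin of the constants: the horizontal trace contributes \<open>-3 * s\<close>, one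
  part from the term with \<open>J a\<close> and two from the doubled term with \<open>J b\<close>,
  while the vertical directions give back \<open>s\<close>, one for each \<open>\<xi> i\<close>. The
  factor \<open>2 * n\<close> is the trace of the identity on the base.\<close>

lemma ricci_frame:
  assumes x: "x \<in> V"
  shows "ricci g x (frame a c x) (frame b d x) =
    ricci g' (f x) a b - 2 * real s * g' (f x) a b + 2 * real n * (\<Sum>i<s. c i) * (\<Sum>i<s. d i)"
proof -
  have yW: "f x \<in> W" by (rule f_maps[OF x])
  let ?R = "\<lambda>w. M.curv x w (frame a c x) (frame b d x)"
  define C Dd where "C = (\<Sum>i<s. c i)" and "Dd = (\<Sum>i<s. d i)"
  let ?J = "J (f x)" and ?g = "g' (f x)"
  have hor: "fderiv f x (?R (lift x p)) = N.curv (f x) p a b + (C * Dd) *\<^sub>R p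
      + real s *\<^sub>R (?g a (?J b) *\<^sub>R ?J p - ?g p (?J b) *\<^sub>R ?J a - (2 * ?g p (?J a)) *\<^sub>R ?J b)" for p
    using curv_frame[OF x, of p "\<lambda>_. 0" a c b d] D_sum_\<xi>[OF x, of "\<lambda>_. 1"] unfolding lift_frame[of x p]
    by (auto simp: linear_add[OF D_linear[OF x]] linear_scale[OF D_linear[OF x]] D_lift[OF x] C_def Dd_def)
  have ver: "\<eta> i x (?R (\<xi> i x)) = ?g a b" if i: "i < s" for i
  proof -
    \<comment> \<open>With base part 0, the second clause of \<open>curv_frame\<close> supplies the
      vertical coefficient.\<close>
    have \<xi>i: "\<xi> i x = frame 0 (\<lambda>j. if j = i then 1 else 0) x"
      using i by (simp add: frame_def linear_0[OF lift_linear[OF x]] if_distrib[of "\<lambda>t. t *\<^sub>R _"] cong: if_cong)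
    have "(\<Sum>j<s. if j = i then 1 else 0) = (1::real)" using i by simp
    then obtain z where "?R (\<xi> i x) = lift x z + ?g a b *\<^sub>R \<xi>_sum x"
      using curv_frame[OF x, of 0 "\<lambda>j. if j = i then 1 else 0" a c b d] unfolding \<xi>i[symmetric] by auto
    then show ?thesis
      using \<eta>_sum_\<xi>[OF x i, of "\<lambda>_. 1"]
      by (simp add: linear_add[OF \<eta>_linear[OF i x]] linear_scale[OF \<eta>_linear[OF i x]] \<eta>_lift[OF x i])
  qed
  have contract: "(\<Sum>q\<in>Basis. ?g q (?J u) * (v \<bullet> q)) = ?g v (?J u)" for u v
    using linear_expand[OF N.lin(2)[OF yW], of v "?J u"] by (simp add: mult.commute)
  have "ricci g x (frame a c x) (frame b d x) =
     (\<Sum>q\<in>Basis. fderiv f x (?R (lift x q)) \<bullet> q) + (\<Sum>i<s. \<eta> i x (?R (\<xi> i x)))"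
    unfolding M.ricci_curv[OF x]
  proof (rule trace_two_frames[OF M.curv_linear(1)[OF x]])
    show "linear (\<lambda>w. fderiv f x w \<bullet> q)" for q
      by (rule linear_compose[OF D_linear[OF x], unfolded comp_def]) (intro bounded_linear.linear bounded_linear_inner_left)
    show "linear (\<eta> j x)" if "j \<in> {..<s}" for j using that \<eta>_linear[OF _ x] by simp
    show "w = (\<Sum>q\<in>Basis. (fderiv f x w \<bullet> q) *\<^sub>R lift x q) + (\<Sum>i<s. \<eta> i x w *\<^sub>R \<xi> i x)" for w
      using frame_decomposition[OF x, of w] linear_expand[OF lift_linear[OF x], of "fderiv f x w"] by simp
  qed
  also have "(\<Sum>i<s. \<eta> i x (?R (\<xi> i x))) = real s * ?g a b" by (simp add: ver)
  also have "(\<Sum>q\<in>Basis. fderiv f x (?R (lift x q)) \<bullet> q) =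
     (\<Sum>q\<in>Basis. N.curv (f x) q a b \<bullet> q) + (C * Dd) * real (DIM('f))
     + real s * (?g a (?J b) * (\<Sum>q\<in>Basis. ?J q \<bullet> q) - (\<Sum>q\<in>Basis. ?g q (?J b) * (?J a \<bullet> q))
         - 2 * (\<Sum>q\<in>Basis. ?g q (?J a) * (?J b \<bullet> q)))"
    unfolding hor
    by (simp add: inner_add_left inner_diff_left sum.distrib sum_subtractf sum_distrib_left[symmetric] mult.assoc)
  also have "\<dots> = ricci g' (f x) a b + (C * Dd) * (2 * real n) - 3 * real s * ?g a b"
    unfolding contract H.trace_J[OF yW] base_J_isometry[OF x] N.ricci_curv[OF yW] dim_base N.symmetric[OF yW, of b a]
    by simp
  finally show ?thesis by (simp add: C_def Dd_def algebra_simps)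
qed

lemma ricci_total:
  assumes x: "x \<in> V"
  shows "ricci g x u v = ricci g' (f x) (fderiv f x u) (fderiv f x v)
    - 2 * real s * g' (f x) (fderiv f x u) (fderiv f x v)
    + 2 * real n * (\<Sum>i<s. \<eta> i x u) * (\<Sum>i<s. \<eta> i x v)"
  using ricci_frame[OF x, of "fderiv f x u" "\<lambda>i. \<eta> i x u" "fderiv f x v" "\<lambda>i. \<eta> i x v"]
  by (simp add: frame_exhaust[OF x, symmetric])

end

section \<open>From charts to coordinate domains\<close>

lemma smooth_manifold_chart:
  assumes "smooth_manifold T A" "c \<in> A"
  shows "openin T (cdom c)" "open (cran c)" "cdom c \<subseteq> topspace T" "inj_on (cmap c) (cdom c)"
    and "\<And>K. openin T K \<Longrightarrow> K \<subseteq> cdom c \<Longrightarrow> open (cmap c ` K)"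
proof -
  have h: "homeomorphic_map (subtopology T (cdom c)) (top_of_set (cran c)) (cmap c)"
    and o: "openin T (cdom c)" "open (cran c)"
    using assms by (auto simp: smooth_manifold_def)
  show "openin T (cdom c)" "open (cran c)" by (rule o)+
  show sub: "cdom c \<subseteq> topspace T" by (rule openin_subset[OF o(1)])
  show "inj_on (cmap c) (cdom c)"
    using homeomorphic_imp_injective_map[OF h] sub by (simp add: Int_absorb1)
  show "open (cmap c ` K)" if "openin T K" "K \<subseteq> cdom c" for K
  proof -
    have "openin (subtopology T (cdom c)) K" using that by (simp add: openin_subset_topspace_eq openin_open_subtopology o(1))
    then have "openin (top_of_set (cran c)) (cmap c ` K)"
      using homeomorphic_imp_open_map[OF h] by (simp add: open_map_def)
    then show ?thesis using o(2) openin_open_trans by blast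
  qed
qed

lemma cinv_cmap: "smooth_manifold T A \<Longrightarrow> c \<in> A \<Longrightarrow> p \<in> cdom c \<Longrightarrow> cinv c (cmap c p) = p"
  unfolding cinv_def by (rule inv_into_f_f[OF smooth_manifold_chart(4)])

definition coord_domain ::
  "('a, 'e) chart \<Rightarrow> ('b, 'f) chart \<Rightarrow> 'a set \<Rightarrow> ('a \<Rightarrow> 'b) \<Rightarrow> 'e set" where
  "coord_domain c d U f = cmap c ` {p \<in> U \<inter> cdom c. f p \<in> cdom d}"

lemma riemannian_metric_domain:
  assumes "riemannian_metric A g" "c \<in> A" "open S" "S \<subseteq> cran c"
  shows "riemannian_domain S (g c)"
proof
  show "bilinear (g c x)" "g c x u v = g c x v u" "v \<noteq> 0 \<Longrightarrow> g c x v v > 0" if "x \<in> S" for x u v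
    using assms that unfolding riemannian_metric_def by blast+
  show "smooth_on S (\<lambda>x. g c x u v)" for u v
    using assms smooth_on_mono unfolding riemannian_metric_def by blast
qed (rule assms)

text \<open>Conditions quantified over all vector fields are used on constant fields, where
  tensoriality gives their pointwise form; the differential of the leaf map is by definition the
  derivative of its coordinate form.\<close>

lemma canonical_submersion_coordinates:
  fixes B :: "('a set, 'f::euclidean_space) chart set" and A :: "('a, 'e::euclidean_space) chart set"
  assumes M: "S_manifold T A n s \<phi> \<xi> \<eta> g" and C: "canonical_submersion T A n \<phi> g U S B g' J"
    and c: "c \<in> A" and d: "d \<in> B"
  shows "f_submersion (coord_domain c d U (leaf T A \<phi> U)) (g c) (cran d) (g' d)
    (coord_rep c d (leaf T A \<phi> U)) (\<phi> c) (\<lambda>i. \<xi> i c) (\<lambda>i. \<eta> i c) (J d) n s"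
proof -
  define L where "L = leaf T A \<phi> U"
  define V where "V = coord_domain c d U L"
  define f where "f = coord_rep c d L"
  have F: "metric_f_manifold T A n s \<phi> \<xi> \<eta> g" and s: "s \<ge> 1"
    and SM: "\<And>X Y x. smooth_on (cran c) X \<Longrightarrow> smooth_on (cran c) Y \<Longrightarrow> x \<in> cran c \<Longrightarrow>
          (\<forall>j<s. 2 * fundamental_form (g c) (\<phi> c) x (X x) (Y x) = d_one_form (\<eta> j c) X Y x) \<and>
          nijenhuis (\<phi> c) X Y x + (\<Sum>i<s. d_one_form (\<eta> i c) X Y x *\<^sub>R \<xi> i c x) = 0"
    using M c unfolding S_manifold_def by blast+
  have TA: "smooth_manifold T A" and endo: "endomorphism_field A \<phi>" and met: "riemannian_metric A g"
    and vf: "\<And>i. i < s \<Longrightarrow> vector_field A (\<xi> i)" and of: "\<And>i. i < s \<Longrightarrow> one_form A (\<eta> i)"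
    using F unfolding metric_f_manifold_def by blast+
  have ker: "{v. \<phi> c x v = 0} = span ((\<lambda>i. \<xi> i c x) ` {..<s})"
    and \<eta>\<xi>: "\<And>i j. i < s \<Longrightarrow> j < s \<Longrightarrow> \<eta> i c x (\<xi> j c x) = (if i = j then 1 else 0)"
    and \<eta>\<phi>: "\<And>i v. i < s \<Longrightarrow> \<eta> i c x (\<phi> c x v) = 0"
    and \<phi>\<phi>: "\<And>v. \<phi> c x (\<phi> c x v) = - v + (\<Sum>i<s. \<eta> i c x v *\<^sub>R \<xi> i c x)"
    and g\<phi>\<phi>: "\<And>u v. g c x (\<phi> c x u) (\<phi> c x v) = g c x u v - (\<Sum>i<s. \<eta> i c x u * \<eta> i c x v)"
    if "x \<in> cran c" for x
    using F c that unfolding metric_f_manifold_def by blast+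
  have U: "openin T U" and SB: "smooth_manifold S B" and dimf: "DIM('f) = 2 * n"
    and met': "riemannian_metric B g'" and endo': "endomorphism_field B J"
    and sub: "riemannian_submersion T A g U S B g' L"
    and spaces: "\<And>p. p \<in> U \<Longrightarrow> p \<in> cdom c \<Longrightarrow> L p \<in> cdom d \<Longrightarrow>
       vertical_space c d L p = {v. \<phi> c (cmap c p) v = 0} \<and>
       horizontal_space g c d L p = range (\<phi> c (cmap c p)) \<and>
       (\<forall>u\<in>horizontal_space g c d L p.
          J d (cmap d (L p)) (differential c d L p u) = differential c d L p (\<phi> c (cmap c p) u))"
    using C c d unfolding canonical_submersion_def L_def by blast+
  have "smooth_map T A U S B L"
    and R: "\<forall>c\<in>A. \<forall>d\<in>B. \<forall>p\<in>U. p \<in> cdom c \<and> L p \<in> cdom d \<longrightarrow>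
       surj (differential c d L p) \<and>
       (\<forall>u\<in>horizontal_space g c d L p. \<forall>v\<in>horizontal_space g c d L p.
          g' d (cmap d (L p)) (differential c d L p u) (differential c d L p v) = g c (cmap c p) u v)"
    using sub by (simp_all add: riemannian_submersion_def)
  then have cont: "continuous_map (subtopology T U) S L" and Lsm: "smooth_on V f"
    using c d by (simp_all add: smooth_map_def V_def coord_domain_def f_def)
  have surj: "surj (differential c d L p)" if "p \<in> U" "p \<in> cdom c" "L p \<in> cdom d" for p
    using R c d that by blast
  have iso: "g' d (cmap d (L p)) (differential c d L p u) (differential c d L p v) = g c (cmap c p) u v"
    if "p \<in> U" "p \<in> cdom c" "L p \<in> cdom d" "u \<in> horizontal_space g c d L p" "v \<in> horizontal_space g c d L p"
    for p u v
    using R[rule_format, OF c d that(1)] that(2-5) by blast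
  have openV: "open V"
    unfolding V_def coord_domain_def
  proof (rule smooth_manifold_chart(5)[OF TA c])
    have "openin (subtopology T U) {p \<in> topspace (subtopology T U). L p \<in> cdom d}"
      by (rule openin_continuous_map_preimage[OF cont smooth_manifold_chart(1)[OF SB d]])
    then have "openin T {p \<in> topspace (subtopology T U). L p \<in> cdom d}"
      using U openin_open_subtopology by blast
    then have "openin T ({p \<in> topspace (subtopology T U). L p \<in> cdom d} \<inter> cdom c)"
      by (rule openin_Int) (rule smooth_manifold_chart(1)[OF TA c])
    moreover have "{p \<in> topspace (subtopology T U). L p \<in> cdom d} \<inter> cdom c = {p \<in> U \<inter> cdom c. L p \<in> cdom d}"
      using openin_subset[OF U] by auto
    ultimately show "openin T {p \<in> U \<inter> cdom c. L p \<in> cdom d}" by (simp only:)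
  qed auto
  have Vsub: "V \<subseteq> cran c" unfolding V_def coord_domain_def cran_def by auto
  then have Vc: "x \<in> cran c" if "x \<in> V" for x using that by blast
  have pt: "\<exists>p. p \<in> U \<and> p \<in> cdom c \<and> L p \<in> cdom d \<and> x = cmap c p \<and> f x = cmap d (L p) \<and>
      differential c d L p = fderiv f x" if "x \<in> V" for x
    using that cinv_cmap[OF TA c] unfolding V_def coord_domain_def f_def differential_def coord_rep_def comp_def by auto
  have lin\<eta>: "linear (\<eta> i c x)" "smooth_on (cran c) (\<lambda>x. \<eta> i c x v)" if "i < s" "x \<in> cran c" for i x v
    using of[OF that(1)] c that(2) unfolding one_form_def by blast+
  have lin\<phi>: "linear (\<phi> c x)" "smooth_on (cran c) (\<lambda>x. \<phi> c x v)" if "x \<in> cran c" for x v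
    using endo c that unfolding endomorphism_field_def by blast+
  have openc: "open (cran c)" by (rule smooth_manifold_chart(2)[OF TA c])
  have d\<eta>: "d_one_form (\<eta> i c) (\<lambda>_. u) (\<lambda>_. v) x = fderiv (\<lambda>y. \<eta> i c y v) x u - fderiv (\<lambda>y. \<eta> i c y u) x v"
    if "i < s" "x \<in> cran c" for i x u v
    using that by (intro d_one_form_tensorial[OF openc] lin\<eta> smooth_on_differentiable[of "cran c"])
      (auto intro: smooth_on_const)
  have N\<phi>: "nijenhuis (\<phi> c) (\<lambda>_. u) (\<lambda>_. v) x = nijenhuis_at (\<phi> c) x u v" if "x \<in> cran c" for x u v
    using that by (intro nijenhuis_tensorial[OF openc] lin\<phi> smooth_on_differentiable[of "cran c"])
      (auto intro: smooth_on_const)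
  have contact: "2 * g c x u (\<phi> c x v) = d_one_form (\<eta> i c) (\<lambda>_. u) (\<lambda>_. v) x" if "i < s" "x \<in> cran c" for i x u v
    using SM[OF smooth_on_const smooth_on_const that(2), of u v] that(1) by (simp add: fundamental_form_def)
  have "f_submersion V (g c) (cran d) (g' d) f (\<phi> c) (\<lambda>i. \<xi> i c) (\<lambda>i. \<eta> i c) (J d) n s"
  proof (intro f_submersion.intro f_submersion_axioms.intro)
    show "riemannian_domain V (g c)" by (rule riemannian_metric_domain[OF met c openV Vsub])
    show "riemannian_domain (cran d) (g' d)"
      by (rule riemannian_metric_domain[OF met' d smooth_manifold_chart(2)[OF SB d] subset_refl])
    show "f x \<in> cran d" if "x \<in> V" for x using pt[OF that] by (auto simp: cran_def)
    show "smooth_on V f" by (rule Lsm)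
    show "DIM('f) = 2 * n" "1 \<le> s" by (rule dimf s)+
    show "linear (\<phi> c x)" if "x \<in> V" for x by (rule lin\<phi>[OF Vc[OF that]])
    show "smooth_on V (\<lambda>x. \<phi> c x v)" for v
      using endo c Vsub smooth_on_mono unfolding endomorphism_field_def by blast
    show "linear (J d y)" if "y \<in> cran d" for y using endo' d that unfolding endomorphism_field_def by blast
    show "smooth_on (cran d) (\<lambda>y. J d y a)" for a using endo' d unfolding endomorphism_field_def by blast
    show "smooth_on V (\<xi> i c)" if "i < s" for i
      using vf[OF that] c Vsub smooth_on_mono unfolding vector_field_def by blast
    show "linear (\<eta> i c x)" if "i < s" "x \<in> V" for i x by (rule lin\<eta>[OF that(1) Vc[OF that(2)]])
    show "smooth_on V (\<lambda>x. \<eta> i c x v)" if "i < s" for i v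
      using of[OF that] c Vsub smooth_on_mono unfolding one_form_def by blast
    show "\<eta> i c x (\<xi> j c x) = (if i = j then 1 else 0)" if "x \<in> V" "i < s" "j < s" for x i j
      by (rule \<eta>\<xi>[OF Vc[OF that(1)] that(2,3)])
    show "\<eta> i c x (\<phi> c x v) = 0" if "x \<in> V" "i < s" for x i v by (rule \<eta>\<phi>[OF Vc[OF that(1)] that(2)])
    show "\<phi> c x (\<xi> i c x) = 0" if "x \<in> V" "i < s" for x i
      using ker[OF Vc[OF that(1)]] that(2) span_base[of "\<xi> i c x" "(\<lambda>i. \<xi> i c x) ` {..<s}"] by blast
    show "\<phi> c x (\<phi> c x v) = - v + (\<Sum>i<s. \<eta> i c x v *\<^sub>R \<xi> i c x)" if "x \<in> V" for x v
      by (rule \<phi>\<phi>[OF Vc[OF that]])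
    show "g c x (\<phi> c x u) (\<phi> c x v) = g c x u v - (\<Sum>i<s. \<eta> i c x u * \<eta> i c x v)" if "x \<in> V" for x u v
      by (rule g\<phi>\<phi>[OF Vc[OF that]])
    show "2 * g c x u (\<phi> c x v) = fderiv (\<lambda>y. \<eta> i c y v) x u - fderiv (\<lambda>y. \<eta> i c y u) x v"
      if "x \<in> V" "i < s" for x i u v
      using contact[OF that(2) Vc[OF that(1)]] d\<eta>[OF that(2) Vc[OF that(1)]] by simp
    show "nijenhuis_at (\<phi> c) x u v + (\<Sum>i<s. (2 * g c x u (\<phi> c x v)) *\<^sub>R \<xi> i c x) = 0" if "x \<in> V" for x u v
      using SM[OF smooth_on_const smooth_on_const Vc[OF that], of u v] N\<phi>[OF Vc[OF that], of u v]
        contact[OF _ Vc[OF that], of _ u v] by simp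
    show "surj (fderiv f x)" if "x \<in> V" for x using pt[OF that] surj by metis
    show "(fderiv f x v = 0) = (\<phi> c x v = 0)" if "x \<in> V" for x v
      using pt[OF that] spaces unfolding vertical_space_def by (metis (mono_tags, lifting) mem_Collect_eq)
    show "g' d (f x) (fderiv f x (\<phi> c x u)) (fderiv f x (\<phi> c x v)) = g c x (\<phi> c x u) (\<phi> c x v)"
      if "x \<in> V" for x u v
      using pt[OF that] spaces iso by (metis rangeI)
    show "J d (f x) (fderiv f x (\<phi> c x v)) = fderiv f x (\<phi> c x (\<phi> c x v))" if "x \<in> V" for x v
      using pt[OF that] spaces by (metis rangeI)
  qed
  then show ?thesis unfolding V_def f_def L_def .
qed

text \<open>The leaf map is onto and the charts cover the total space. The chart \<open>c\<close>
  varies with the point \<open>y\<close>, so identities on a base chart are proved point by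
  point.\<close>

lemma canonical_submersion_covers_base:
  assumes TA: "smooth_manifold T A" and C: "canonical_submersion T A n \<phi> g U S B g' J"
    and d: "d \<in> B" and y: "y \<in> cran d"
  shows "\<exists>c\<in>A. \<exists>x\<in>coord_domain c d U (leaf T A \<phi> U). coord_rep c d (leaf T A \<phi> U) x = y"
proof -
  let ?L = "leaf T A \<phi> U"
  have SB: "smooth_manifold S B" and im: "?L ` U = topspace S" and U: "openin T U"
    using C unfolding canonical_submersion_def riemannian_submersion_def by blast+
  obtain q where q: "q \<in> cdom d" "y = cmap d q" using y by (auto simp: cran_def)
  then obtain p where p: "p \<in> U" "q = ?L p" using im smooth_manifold_chart(3)[OF SB d] by blast
  then obtain c where c: "c \<in> A" "p \<in> cdom c"
    using TA openin_subset[OF U] unfolding smooth_manifold_def by blast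
  then have "cmap c p \<in> coord_domain c d U ?L" "coord_rep c d ?L (cmap c p) = y"
    using p q cinv_cmap[OF TA c] by (auto simp: coord_domain_def coord_rep_def)
  then show ?thesis using c(1) by blast
qed

lemma canonical_submersion_hermitian:
  assumes M: "S_manifold T A n s \<phi> \<xi> \<eta> g" and C: "canonical_submersion T A n \<phi> g U S B g' J" and d: "d \<in> B"
  shows "hermitian_domain (cran d) (g' d) (J d)"
proof -
  have TA: "smooth_manifold T A" using M by (simp add: S_manifold_def metric_f_manifold_def)
  note cover = canonical_submersion_covers_base[OF TA C d]
  note sub = canonical_submersion_coordinates[OF M C _ d]
  have SB: "smooth_manifold S B" and met': "riemannian_metric B g'" and endo': "endomorphism_field B J"
    using C unfolding canonical_submersion_def by blast+
  show ?thesis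
  proof (intro hermitian_domain.intro hermitian_domain_axioms.intro)
    show "riemannian_domain (cran d) (g' d)"
      by (rule riemannian_metric_domain[OF met' d smooth_manifold_chart(2)[OF SB d] subset_refl])
    show "linear (J d y)" if "y \<in> cran d" for y using endo' d that unfolding endomorphism_field_def by blast
    show "smooth_on (cran d) (\<lambda>y. J d y a)" for a using endo' d unfolding endomorphism_field_def by blast
    show "J d y (J d y a) = - a" if "y \<in> cran d" for y a
      using cover[OF that] f_submersion.base_J_J[OF sub] by metis
    show "g' d y (J d y a) (J d y b) = g' d y a b" if "y \<in> cran d" for y a b
      using cover[OF that] f_submersion.base_J_isometry[OF sub] by metis
  qed
qed

text \<open>Tensoriality reduces integrability and closedness to constant fields, where they hold at
  every image point. The hermitian property supplies the skew-symmetry that tensoriality of the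
  exterior derivative requires.\<close>

lemma canonical_submersion_kaehler:
  assumes M: "S_manifold T A n s \<phi> \<xi> \<eta> g" and C: "canonical_submersion T A n \<phi> g U S B g' J"
  shows "kaehler_manifold S B g' J"
proof -
  have TA: "smooth_manifold T A" using M by (simp add: S_manifold_def metric_f_manifold_def)
  note cover = canonical_submersion_covers_base[OF TA C]
  note sub = canonical_submersion_coordinates[OF M C]
  have SB: "smooth_manifold S B" and met': "riemannian_metric B g'" and endo': "endomorphism_field B J"
    using C unfolding canonical_submersion_def by blast+
  have "nijenhuis (J d) X Y y = 0"
    if d: "d \<in> B" and X: "smooth_on (cran d) X" and Y: "smooth_on (cran d) Y" and y: "y \<in> cran d" for d X Y y
  proof -
    interpret H: hermitian_domain "cran d" "g' d" "J d" by (rule canonical_submersion_hermitian[OF M C d])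
    have "nijenhuis (J d) X Y y = nijenhuis_at (J d) y (X y) (Y y)"
      by (intro nijenhuis_tensorial[OF H.open_S y] H.J_linear H.J_diff smooth_on_differentiable[OF X]
          smooth_on_differentiable[OF Y] y)
    moreover obtain c x where c: "c \<in> A" and x: "x \<in> coord_domain c d U (leaf T A \<phi> U)"
      and xy: "coord_rep c d (leaf T A \<phi> U) x = y"
      using cover[OF d y] by blast
    ultimately show ?thesis using f_submersion.base_nijenhuis[OF sub[OF c d] x] by (simp add: xy)
  qed
  moreover have "d_two_form (fundamental_form (g' d) (J d)) X Y Z y = 0"
    if d: "d \<in> B" and X: "smooth_on (cran d) X" and Y: "smooth_on (cran d) Y" and Z: "smooth_on (cran d) Z"
      and y: "y \<in> cran d" for d X Y Z y
  proof -
    interpret H: hermitian_domain "cran d" "g' d" "J d" by (rule canonical_submersion_hermitian[OF M C d])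
    have "d_two_form (\<lambda>y u v. g' d y u (J d y v)) X Y Z y =
        fderiv (\<lambda>z. g' d z (Y y) (J d z (Z y))) y (X y) + fderiv (\<lambda>z. g' d z (Z y) (J d z (X y))) y (Y y)
      + fderiv (\<lambda>z. g' d z (X y) (J d z (Y y))) y (Z y)"
    proof (rule d_two_form_tensorial[OF H.open_S y])
      show "bilinear (\<lambda>u v. g' d z u (J d z v))" if "z \<in> cran d" for z
        using H.lin[OF that] H.J_linear[OF that] by (auto simp: bilinear_def linear_iff)
      show "g' d y u (J d y v) = - g' d y v (J d y u)" for u v
        using H.g_J_left[OF y, of v u] H.symmetric[OF y] by simp
      show "(\<lambda>z. g' d z u (J d z v)) differentiable (at y)" for u v
        by (rule H.g_apply(1)[OF y differentiable_const H.J_diff[OF y]])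
    qed (rule smooth_on_differentiable[OF _ y] X Y Z)+
    then have "d_two_form (fundamental_form (g' d) (J d)) X Y Z y =
        fderiv (\<lambda>z. g' d z (Y y) (J d z (Z y))) y (X y) + fderiv (\<lambda>z. g' d z (Z y) (J d z (X y))) y (Y y)
      + fderiv (\<lambda>z. g' d z (X y) (J d z (Y y))) y (Z y)"
      by (simp add: fundamental_form_def[abs_def])
    moreover obtain c x where c: "c \<in> A" and x: "x \<in> coord_domain c d U (leaf T A \<phi> U)"
      and xy: "coord_rep c d (leaf T A \<phi> U) x = y"
      using cover[OF d y] by blast
    ultimately show ?thesis using f_submersion.base_d\<Omega>[OF sub[OF c d] x] by (simp add: xy)
  qed
  moreover have "J d y (J d y v) = - v" "g' d y (J d y u) (J d y v) = g' d y u v"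
    if "d \<in> B" "y \<in> cran d" for d y u v
    using hermitian_domain.J_J hermitian_domain.g_J_J canonical_submersion_hermitian[OF M C that(1)] that(2) by blast+
  ultimately show ?thesis using SB met' endo' unfolding kaehler_manifold_def by blast
qed

lemma canonical_submersion_kaehler_coordinates:
  assumes M: "S_manifold T A n s \<phi> \<xi> \<eta> g" and C: "canonical_submersion T A n \<phi> g U S B g' J"
    and c: "c \<in> A" and d: "d \<in> B"
  shows "kaehler_submersion (coord_domain c d U (leaf T A \<phi> U)) (g c) (cran d) (g' d)
    (coord_rep c d (leaf T A \<phi> U)) (\<phi> c) (\<lambda>i. \<xi> i c) (\<lambda>i. \<eta> i c) (J d) n s"
  using canonical_submersion_coordinates[OF assms] canonical_submersion_hermitian[OF M C d]
  by (rule kaehler_submersion.intro)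

section \<open>The two implications\<close>

text \<open>Translates between the product of sums in the Ricci formula and the sum over distinct
  indices in \<open>eta_einstein\<close>.\<close>

lemma sum_off_diagonal:
  fixes a b :: "nat \<Rightarrow> real"
  shows "(\<Sum>i<s. \<Sum>j\<in>{..<s} - {i}. a i * b j) = (\<Sum>i<s. a i) * (\<Sum>i<s. b i) - (\<Sum>i<s. a i * b i)"
  by (simp add: sum_product sum_diff1 flip: sum_subtractf)

text \<open>The condition is pointwise, so local submersions with a common \<open>lam\<close>
  suffice. Each product of \<open>\<eta> i\<close> and \<open>\<eta> j\<close> enters the Ricci
  tensor with \<open>2 * n\<close>, which is \<alpha> + \<beta>; for equal indices, pulling back the
  base metric subtracts \<open>lam - 2 * s\<close>, and this leaves \<beta>.\<close>

lemma eta_einstein_total_space: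
  assumes M: "S_manifold T A n s \<phi> \<xi> \<eta> g"
    and base: "\<forall>p\<in>topspace T. \<exists>U S (B :: ('a set, 'f::euclidean_space) chart set) g' J.
            p \<in> U \<and> canonical_submersion T A n \<phi> g U S B g' J \<and> kaehler_einstein S B g' J lam"
  shows "eta_einstein A s \<eta> g (lam - 2 * real s) (2 * real n - (lam - 2 * real s))"
  unfolding eta_einstein_def
proof (intro ballI allI)
  fix c x u v assume c: "c \<in> A" and x: "x \<in> cran c"
  have TA: "smooth_manifold T A" using M by (simp add: S_manifold_def metric_f_manifold_def)
  obtain p where p: "p \<in> cdom c" "x = cmap c p" using x by (auto simp: cran_def)
  then have "p \<in> topspace T" using smooth_manifold_chart(3)[OF TA c] by blast
  from base[rule_format, OF this]
  obtain U S and B :: "('a set, 'f) chart set" and g' J where U: "p \<in> U"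
    and C: "canonical_submersion T A n \<phi> g U S B g' J" and E: "kaehler_einstein S B g' J lam"
    by (elim exE conjE)
  let ?L = "leaf T A \<phi> U"
  have "?L ` U = topspace S" "smooth_manifold S B"
    using C unfolding canonical_submersion_def riemannian_submersion_def by blast+
  then have "?L p \<in> topspace S" "(\<Union>d\<in>B. cdom d) = topspace S"
    using U by (auto simp: smooth_manifold_def)
  then obtain d where d: "d \<in> B" "?L p \<in> cdom d" by blast
  interpret K: kaehler_submersion "coord_domain c d U ?L" "g c" "cran d" "g' d" "coord_rep c d ?L" "\<phi> c"
      "\<lambda>i. \<xi> i c" "\<lambda>i. \<eta> i c" "J d" n s
    by (rule canonical_submersion_kaehler_coordinates[OF M C c d(1)])
  have xV: "x \<in> coord_domain c d U ?L" using p U d by (auto simp: coord_domain_def)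
  have "ricci (g' d) y a b = lam * g' d y a b" if "y \<in> cran d" for y a b
    using E d(1) that unfolding kaehler_einstein_def by blast
  then have "ricci (g c) x u v = (lam - 2 * real s) * (g c x u v - (\<Sum>i<s. \<eta> i c x u * \<eta> i c x v))
      + 2 * real n * (\<Sum>i<s. \<eta> i c x u) * (\<Sum>i<s. \<eta> i c x v)"
    unfolding K.ricci_total[OF xV] K.base_metric[OF xV, symmetric]
    using K.f_maps[OF xV] by (simp add: algebra_simps)
  then show "ricci (g c) x u v = (lam - 2 * real s) * g c x u v
      + (2 * real n - (lam - 2 * real s)) * (\<Sum>i<s. \<eta> i c x u * \<eta> i c x v)
      + (lam - 2 * real s + (2 * real n - (lam - 2 * real s)))
         * (\<Sum>i<s. \<Sum>j\<in>{..<s} - {i}. \<eta> i c x u * \<eta> j c x v)"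
    unfolding sum_off_diagonal by (simp add: algebra_simps)
qed

text \<open>On horizontal lifts every \<open>\<eta> i\<close> vanishes, so only the \<alpha>-term is
  left, and \<open>ricci_frame\<close> exceeds it by the shift \<open>2 * s\<close>.\<close>

lemma kaehler_einstein_base:
  fixes B :: "('a set, 'f::euclidean_space) chart set"
  assumes M: "S_manifold T A n s \<phi> \<xi> \<eta> g" and C: "canonical_submersion T A n \<phi> g U S B g' J"
    and E: "eta_einstein A s \<eta> g \<alpha> \<beta>"
  shows "kaehler_einstein S B g' J (\<alpha> + 2 * real s)"
proof -
  have TA: "smooth_manifold T A" using M by (simp add: S_manifold_def metric_f_manifold_def)
  let ?L = "leaf T A \<phi> U"
  have "ricci (g' d) y a b = (\<alpha> + 2 * real s) * g' d y a b" if d: "d \<in> B" and y: "y \<in> cran d" for d y a b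
  proof -
    obtain c x where c: "c \<in> A" and x: "x \<in> coord_domain c d U ?L" and xy: "coord_rep c d ?L x = y"
      using canonical_submersion_covers_base[OF TA C d y] by blast
    interpret K: kaehler_submersion "coord_domain c d U ?L" "g c" "cran d" "g' d" "coord_rep c d ?L" "\<phi> c"
        "\<lambda>i. \<xi> i c" "\<lambda>i. \<eta> i c" "J d" n s
      by (rule canonical_submersion_kaehler_coordinates[OF M C c d])
    have "x \<in> cran c" using x by (auto simp: coord_domain_def cran_def)
    then have "ricci (g c) x (K.lift x a) (K.lift x b) = \<alpha> * g c x (K.lift x a) (K.lift x b)"
      using E c by (simp add: eta_einstein_def K.\<eta>_lift[OF x])
    also have "g c x (K.lift x a) (K.lift x b) = g' d y a b"
      by (simp add: K.g_lift[OF x] K.D_lift[OF x] xy)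
    finally show ?thesis
      using K.ricci_frame[OF x, of a "\<lambda>_. 0" b "\<lambda>_. 0"] by (simp add: K.lift_frame xy algebra_simps)
  qed
  then show ?thesis using canonical_submersion_kaehler[OF M C] unfolding kaehler_einstein_def by blast
qed

text \<open>A point of the base and positivity of the metric on one basis vector isolate
  \<open>lam\<close>.\<close>

lemma kaehler_einstein_ricci_flat_iff:
  fixes B :: "('a, 'f::euclidean_space) chart set"
  assumes E: "kaehler_einstein S B g' J lam" and ne: "topspace S \<noteq> {}"
  shows "ricci_flat B g' \<longleftrightarrow> lam = 0"
proof
  have SB: "(\<Union>d\<in>B. cdom d) = topspace S" and met: "riemannian_metric B g'"
    using E unfolding kaehler_einstein_def kaehler_manifold_def smooth_manifold_def by blast+
  then obtain d y where d: "d \<in> B" and y: "y \<in> cran d" using ne by (fastforce simp: cran_def)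
  obtain b :: 'f where "b \<in> Basis" using nonempty_Basis by blast
  then have pos: "g' d y b b > 0"
    using met d y unfolding riemannian_metric_def by (metis nonzero_Basis)
  assume "ricci_flat B g'"
  then have "lam * g' d y b b = 0"
    using E d y unfolding ricci_flat_def kaehler_einstein_def by metis
  then show "lam = 0" using pos by simp
next
  assume "lam = 0"
  then show "ricci_flat B g'" using E by (simp add: ricci_flat_def kaehler_einstein_def)
qed

theorem theorem4p23:
  fixes T :: "'a topology" and A :: "('a, 'e::euclidean_space) chart set"
    and n s :: nat
    and \<phi> :: "('a, 'e) chart \<Rightarrow> 'e \<Rightarrow> 'e \<Rightarrow> 'e"
    and \<xi> :: "nat \<Rightarrow> ('a, 'e) chart \<Rightarrow> 'e \<Rightarrow> 'e"
    and \<eta> :: "nat \<Rightarrow> ('a, 'e) chart \<Rightarrow> 'e \<Rightarrow> 'e \<Rightarrow> real"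
    and g :: "('a, 'e) chart \<Rightarrow> 'e \<Rightarrow> 'e \<Rightarrow> 'e \<Rightarrow> real"
  assumes "S_manifold T A n s \<phi> \<xi> \<eta> g"
  shows
    "(\<forall>lam :: real.
        (\<forall>p\<in>topspace T. \<exists>U S (B :: ('a set, 'f::euclidean_space) chart set) g' J.
            p \<in> U \<and> canonical_submersion T A n \<phi> g U S B g' J \<and> kaehler_einstein S B g' J lam)
        \<longrightarrow> eta_einstein A s \<eta> g (lam - 2 * real s) (2 * real n - (lam - 2 * real s)))
     \<and>
     (\<forall>\<alpha> \<beta> :: real. eta_einstein A s \<eta> g \<alpha> \<beta> \<longrightarrow>
        (\<forall>U S (B :: ('a set, 'f) chart set) g' J.
            canonical_submersion T A n \<phi> g U S B g' J \<longrightarrow>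
            kaehler_einstein S B g' J (\<alpha> + 2 * real s) \<and>
            (ricci_flat B g' \<longleftrightarrow> \<alpha> + 2 * real s = 0)))"
proof (intro conjI allI impI)
  show "eta_einstein A s \<eta> g (lam - 2 * real s) (2 * real n - (lam - 2 * real s))"
    if "\<forall>p\<in>topspace T. \<exists>U S (B :: ('a set, 'f) chart set) g' J.
            p \<in> U \<and> canonical_submersion T A n \<phi> g U S B g' J \<and> kaehler_einstein S B g' J lam" for lam
    by (rule eta_einstein_total_space[OF assms that])
next
  fix \<alpha> \<beta> U S and B :: "('a set, 'f) chart set" and g' J
  assume E: "eta_einstein A s \<eta> g \<alpha> \<beta>" and C: "canonical_submersion T A n \<phi> g U S B g' J"
  show K: "kaehler_einstein S B g' J (\<alpha> + 2 * real s)" by (rule kaehler_einstein_base[OF assms C E])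
  have "leaf T A \<phi> U ` U = topspace S" "U \<noteq> {}"
    using C by (simp_all add: canonical_submersion_def riemannian_submersion_def)
  then have "topspace S \<noteq> {}" by auto
  then show "ricci_flat B g' \<longleftrightarrow> \<alpha> + 2 * real s = 0"
    by (rule kaehler_einstein_ricci_flat_iff[OF K])
qed

end
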